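(* Let $$Q(z)=\prod_{d_1\ge1}\prod_{d_2\ge1}\big(1+z^{d_1d_2}\big)^{1/(d_1d_2)}=\sum_{n\ge0}Q_nz^n.$$ Let $\ell=\log 2$ and $$d_0=\frac{\gamma^2\ell}{2}+\frac{\pi^2\ell}{12}-\gamma\ell^2+\frac{\ell^3}{6}-3\gamma_1\ell,\qquad d_1=\frac{\ell^2}{2}-2\gamma\ell,\qquad d_2=\frac{\ell}{2}.$$ For $n\ge1$ let $x_n=\dfrac{n\,e^{-d_1/(2d_2)}}{2d_2}$, $\theta(n)=\dfrac{2d_2}{n}\operatorname{W}(x_n)$ and $\theta_1(n)=\dfrac{2d_2}{n}\log(x_n)$. Then, as $n\to\infty$, $$Q_n\sim\frac{e^{\,d_0+d_1\log\theta(n)+d_2\log^2\theta(n)-d_1}}{2\sqrt{\pi}\,\sqrt{-d_2\log\theta_1(n)}}\;\theta_1(n)^{\,1-2d_2}.$$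
   Context: $\log$ is the natural logarithm. $\gamma$ is the Euler–Mascheroni constant and $\gamma_1$ the first Stieltjes constant, where the Stieltjes constants $\gamma_n$ are defined by $\zeta(s)=\frac{1}{s-1}+\sum_{n\ge0}\frac{(-1)^n\gamma_n}{n!}(s-1)^n$. $\operatorname{W}$ is the principal branch of the Lambert W function (inverse of $x\mapsto xe^x$ on $[0,\infty)$). $a_n\sim b_n$ means $a_n/b_n\to1$. *)

theory Defs
  imports "HOL-Complex_Analysis.Complex_Analysis"
begin

text \<open>
  The Dirichlet series of the Riemann zeta function; it is only meaningful for \<open>Re s > 1\<close>.
\<close>
definition zeta_series :: "complex \<Rightarrow> complex" where
  "zeta_series s = (\<Sum>k. 1 / of_nat (Suc k) powr s)"

text \<open>
  The coefficients of the Laurent expansion of the zeta function at \<open>1\<close>. That expansion is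
  determined by its values on the part of a punctured neighbourhood of \<open>1\<close> with \<open>Re s > 1\<close>,
  where the zeta function is its Dirichlet series, so no analytic continuation is mentioned.
\<close>
definition stieltjes :: "nat \<Rightarrow> real" where
  "stieltjes = (THE g. \<forall>\<^sub>F s in at 1 within {s. Re s > 1}.
     (\<lambda>n. (-1) ^ n * of_real (g n) / fact n * (s - 1) ^ n) sums (zeta_series s - 1 / (s - 1)))"

text \<open>Principal branch, on \<open>[0, \<infinity>)\<close> only.\<close>
definition lambert_W :: "real \<Rightarrow> real" where
  "lambert_W = the_inv_into {0..} (\<lambda>w. w * exp w)"

text \<open>
  Defined for \<open>norm z < 1\<close>. The indices are shifted by one because infinite products range over
  all natural numbers, and the powers are principal ones.
\<close>
definition Q_fun :: "complex \<Rightarrow> complex" where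
  "Q_fun z = (\<Prod>i. \<Prod>j. (1 + z ^ (Suc i * Suc j)) powr (1 / of_nat (Suc i * Suc j)))"

definition Q_coeff :: "nat \<Rightarrow> complex" where
  "Q_coeff n = fps_nth (fps_expansion Q_fun 0) n"

end

theory Submission
  imports Defs "HOL-Probability.Sinc_Integral" "HOL-Real_Asymp.Real_Asymp"
begin

text \<open>
  The proof is a saddle point argument on the circle of radius \<open>exp (- \<theta> n)\<close>. Put
  \<open>\<phi> u = ln (1 + exp (- u))\<close>. Then the logarithm of \<open>Q (exp (- t))\<close> is the sum of
  \<open>\<phi> (m * t) / m\<close> over all products \<open>m = d\<^sub>1 d\<^sub>2\<close>. By Dirichlet's hyperbola method the sum of
  \<open>1 / m\<close> over \<open>m \<le> x\<close> is a quadratic polynomial in \<open>ln x\<close> up to \<open>o(1)\<close>; summation by parts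
  turns this into expansions, up to \<open>o(1)\<close> as \<open>t\<close> tends to 0, of this sum and of its analogues
  with \<open>u * \<phi>' u\<close> and \<open>u\<^sup>2 * \<phi>'' u\<close> in place of \<open>\<phi>\<close>. The constants \<open>d\<^sub>0\<close> and \<open>d\<^sub>1\<close> are then identified by
  comparing with the Mellin transform \<open>\<Gamma>(s) \<zeta>(1 + s)\<^sup>3 (1 - 2 powr (- s))\<close> as \<open>s\<close> tends to 0.

  On the circle, with \<open>L = - ln r\<close>, the quotient \<open>Q (exp (- r * (1 + \<i> * v / sqrt L))) / Q (exp (- r))\<close>,
  corrected by the saddle point phase, tends to \<open>exp (- ln 2 * v\<^sup>2 / 2)\<close> by a second order Taylor
  expansion, and its modulus is at most \<open>1 / (1 + v\<^sup>2 / 512)\<close> on the whole circle, so that dominated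
  convergence applies without splitting off minor arcs.
\<close>

section \<open>The Laurent expansion of the zeta function at 1\<close>

text \<open>Origin of \<open>\<theta>\<close>: with the logarithm of Q replaced by its expansion,
  the exponent \<open>d0 + d1 * ln r + d2 * (ln r)^2 + n * r\<close> is stationary exactly when
  \<open>n * r = - d1 - 2 * d2 * ln r\<close>, and Lambert's W solves this in closed form. There
  \<open>exp (n * r) = exp (- d1) * r powr (- 2 * d2)\<close>; together with a factor
  \<open>r\<close> from the arc length this explains the \<open>- d1\<close> in the exponent and the
  power \<open>1 - 2 * d2\<close>. The weights 1/m make the logarithm of Q grow only like
  \<open>L^2\<close>, so the peak has relative width \<open>1 / sqrt L\<close>. Off the peak the
  logarithm drops, up to constants, by \<open>L * ln (1 + y^2 / 16)\<close> near the axis and by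
  \<open>L^2\<close> far from it; this has to beat \<open>ln (1 + y^2 * L / 512)\<close> for all
  \<open>y\<close> up to \<open>pi / r\<close>. Moving a Mellin contour across \<open>s = 0\<close>
  would require growth bounds for zeta on vertical lines. Instead, the elementary part shows that an
  expansion exists, with unevaluated constants, and then only the Abelian direction is required:
  limits along real \<open>s\<close> tending to 0 from the right name these constants.\<close>

definition zeta_real :: "real \<Rightarrow> real" where
  "zeta_real s = (\<Sum>k. 1 / real (Suc k) powr s)"

lemma summable_zeta_real:
  assumes "s > 1"
  shows "summable (\<lambda>k. 1 / real (Suc k) powr s)"
proof -
  have "summable (\<lambda>n. real n powr (-s))"
    using assms by (subst summable_real_powr_iff) auto
  then have "summable (\<lambda>n. real (Suc n) powr (-s))"
    by (subst summable_Suc_iff)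
  then show ?thesis
    by (simp add: powr_minus_divide)
qed

lemma summable_zeta_series:
  assumes "Re s > 1"
  shows "summable (\<lambda>k. 1 / of_nat (Suc k) powr s)"
proof (rule summable_norm_cancel)
  have "norm (1 / of_nat (Suc k) powr s) = 1 / real (Suc k) powr Re s" for k
    by (subst norm_divide, subst norm_powr_real_powr) (auto simp del: of_nat_Suc)
  then show "summable (\<lambda>k. norm (1 / of_nat (Suc k) powr s))"
    using summable_zeta_real[OF assms] by (simp only:)
qed

lemma zeta_series_of_real:
  assumes "s > 1"
  shows "zeta_series (of_real s) = of_real (zeta_real s)"
proof -
  have "1 / of_nat (Suc k) powr complex_of_real s = complex_of_real (1 / real (Suc k) powr s)" for k
    using powr_of_real[of "real (Suc k)" s] by (simp del: of_nat_Suc)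
  then show ?thesis
    unfolding zeta_series_def zeta_real_def
    using suminf_of_real[OF summable_zeta_real[OF assms], where 'a=complex] by simp
qed

text \<open>The difference of the two series vanishes on a real interval \<open>(0, e)\<close>, so
  its zeros accumulate at the centre, while zeros of a nonzero power series are isolated. Used both
  for the uniqueness of the Stieltjes constants and, with conjugated coefficients, for their
  reality.\<close>

lemma powser_unique_at_right:
  fixes a b :: "nat \<Rightarrow> complex"
  assumes a: "\<forall>\<^sub>F x in at_right 0. (\<lambda>n. a n * of_real x ^ n) sums g x"
    and b: "\<forall>\<^sub>F x in at_right 0. (\<lambda>n. b n * of_real x ^ n) sums g x"
  shows "a = b"
proof (rule ccontr)
  assume "a \<noteq> b"
  then obtain m where m: "a m \<noteq> b m" by auto
  \<comment> \<open>Shifting the coefficients by one multiplies the difference by \<open>z\<close>;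
    this forces the value 0 at the centre, as \<open>powser_0_nonzero\<close> demands, and changes
    nothing away from 0.\<close>
  define d where "d n = (case n of 0 \<Rightarrow> 0 | Suc k \<Rightarrow> a k - b k)" for n
  have "\<forall>\<^sub>F x in at_right 0. (\<lambda>n. (a n - b n) * of_real x ^ n) sums 0"
    using a b
  proof eventually_elim
    case (elim x)
    from sums_diff[OF elim] show ?case by (simp add: algebra_simps)
  qed
  then obtain e where e: "e > 0" "\<And>x. 0 < x \<Longrightarrow> x < e \<Longrightarrow> (\<lambda>n. (a n - b n) * of_real x ^ n) sums 0"
    by (auto simp: eventually_at_right_field)
  have d_sums: "(\<lambda>n. d n * z ^ n) sums (z * s)" if "(\<lambda>n. (a n - b n) * z ^ n) sums s" for z s
  proof -
    have "(\<lambda>n. d (Suc n) * z ^ Suc n) sums (z * s)"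
      using sums_mult[OF that, of z] by (simp add: d_def mult_ac)
    then show ?thesis
      using sums_Suc_iff[of "\<lambda>n. d n * z ^ n"] by (simp add: d_def)
  qed
  define r where "r = e / 2"
  have r: "r > 0" "r < e" using e(1) by (auto simp: r_def)
  define f where "f z = (\<Sum>n. d n * z ^ n)" for z
  have "(\<lambda>n. d n * (z - 0) ^ n) sums f z" if "norm (z - 0) < r" for z
  proof -
    have "summable (\<lambda>n. d n * of_real r ^ n)"
      using d_sums[OF e(2)[OF r]] by (rule sums_summable)
    then have "summable (\<lambda>n. d n * z ^ n)"
      by (rule powser_inside) (use that r in auto)
    then show ?thesis unfolding f_def by (simp add: summable_sums)
  qed
  moreover have "f 0 = 0"
    by (simp add: f_def d_def)
  moreover have "d (Suc m) \<noteq> 0" using m by (simp add: d_def)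
  ultimately obtain s where s: "s > 0" "\<And>z. z \<in> cball 0 s - {0} \<Longrightarrow> f z \<noteq> 0"
    using powser_0_nonzero[OF r(1), where a=d and f=f and \<xi>=0 and m="Suc m"] by blast
  define x where "x = min s r"
  have "f (of_real x) = 0"
    using d_sums[OF e(2)[of x]] s(1) r unfolding f_def x_def by (simp add: sums_iff min_def)
  moreover have "f (of_real x) \<noteq> 0"
    using s r by (intro s(2)) (auto simp: x_def)
  ultimately show False by simp
qed

text \<open>Second order Taylor remainders of \<open>x powr (1 - s)\<close> at the integers: summed up, they
  telescope to \<open>(s - 1) * zeta_series s - 1\<close>, but they converge in a neighbourhood of 1.\<close>

definition zeta_rem :: "nat \<Rightarrow> complex \<Rightarrow> complex" where
  "zeta_rem k s = (s - 1) * of_nat (Suc k) powr (-s) - of_nat (Suc k) powr (1 - s)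
     + of_nat (Suc (Suc k)) powr (1 - s)"

text \<open>First-order Taylor formula for \<open>z powr (1 - s)\<close> from \<open>Suc k\<close>
  to \<open>Suc k + 1\<close>; the second derivative is
  \<open>(1 - s) * (- s) * z powr (- s - 1)\<close>. The extra power of \<open>k\<close> gained over
  the terms of the zeta series is what allows passing to the left of
  \<open>Re s = 1\<close>.\<close>

lemma zeta_rem_bound:
  assumes "Re s \<ge> 0"
  shows "cmod (zeta_rem k s) \<le> cmod (s - 1) * cmod s * real (Suc k) powr (- Re s - 1)"
proof -
  define a :: complex where "a = of_nat (Suc k)"
  define f where "f i z = (if i = 0 then z powr (1 - s) else if i = Suc 0 then (1 - s) * z powr (-s)
      else (1 - s) * (-s) * z powr (-s - 1))" for i :: nat and z :: complex
  define B where "B = cmod (s - 1) * cmod s * real (Suc k) powr (- Re s - 1)"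
  have seg: "\<exists>t. x = of_real t \<and> t \<ge> real (Suc k)" if "x \<in> closed_segment a (a + 1)" for x
  proof -
    from that obtain u where "x = (1 - u) *\<^sub>R a + u *\<^sub>R (a + 1)" "0 \<le> u"
      by (auto simp: closed_segment_def)
    then show ?thesis
      by (intro exI[of _ "real (Suc k) + u"]) (auto simp: a_def scaleR_conv_of_real algebra_simps)
  qed
  have "cmod (f 0 (a + 1) - (\<Sum>i\<le>1. f i a * (a + 1 - a) ^ i / fact i)) \<le> B * cmod (a + 1 - a) ^ Suc 1 / fact 1"
  proof (rule complex_Taylor)
    show "convex (closed_segment a (a + 1))" by simp
  next
    fix i :: nat and x
    assume x: "x \<in> closed_segment a (a + 1)" and i: "i \<le> 1"
    from seg[OF x] obtain t where t: "x = of_real t" "t \<ge> real (Suc k)" by auto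
    then have "x \<notin> \<real>\<^sub>\<le>\<^sub>0" by (auto simp: complex_nonpos_Reals_iff)
    then have D: "((\<lambda>z. z powr p) has_field_derivative p * x powr (p - 1)) (at x within S)" for p S
      by (intro has_field_derivative_at_within[OF has_field_derivative_powr])
    show "(f i has_field_derivative f (Suc i) x) (at x within closed_segment a (a + 1))"
    proof (cases i)
      case 0
      have "f 0 = (\<lambda>z. z powr (1 - s))" "f (Suc 0) x = (1 - s) * x powr ((1 - s) - 1)"
        by (auto simp: f_def)
      then show ?thesis using D[of "1 - s"] 0 by simp
    next
      case (Suc j)
      with i have i1: "i = Suc 0" by simp
      have "f (Suc 0) = (\<lambda>z. (1 - s) * z powr (-s))"
        "f (Suc (Suc 0)) x = (1 - s) * ((-s) * x powr (-s - 1))"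
        by (auto simp: f_def)
      then show ?thesis unfolding i1 by (simp only:) (intro DERIV_cmult D)
    qed
  next
    fix x assume x: "x \<in> closed_segment a (a + 1)"
    from seg[OF x] obtain t where t: "x = of_real t" "t \<ge> real (Suc k)" by auto
    have "cmod (x powr (-s - 1)) = t powr (- Re s - 1)"
      using t by (subst norm_powr_real_powr) auto
    also have "\<dots> \<le> real (Suc k) powr (- Re s - 1)"
      using t assms by (intro powr_mono2') auto
    finally have "cmod (x powr (-s - 1)) \<le> real (Suc k) powr (- Re s - 1)" .
    then have "cmod (s - 1) * cmod s * cmod (x powr (-s - 1)) \<le> B"
      unfolding B_def by (intro mult_left_mono) auto
    moreover have "cmod (f (Suc 1) x) = cmod (s - 1) * cmod s * cmod (x powr (-s - 1))"
      by (simp add: f_def norm_mult norm_minus_commute)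
    ultimately show "cmod (f (Suc 1) x) \<le> B" by simp
  qed auto
  moreover have "f 0 (a + 1) - (\<Sum>i\<le>1. f i a * (a + 1 - a) ^ i / fact i) = zeta_rem k s"
    by (simp add: f_def a_def zeta_rem_def algebra_simps)
  ultimately show ?thesis by (simp add: B_def)
qed

text \<open>The continuation of \<open>(s - 1) * zeta(s)\<close> across its removable singularity at
  1.\<close>

definition zeta_reg :: "complex \<Rightarrow> complex" where
  "zeta_reg s = 1 + (\<Sum>k. zeta_rem k s)"

lemma zeta_reg_holomorphic: "zeta_reg holomorphic_on ball 1 (1/2)"
proof -
  have "uniform_limit (ball 1 (1/2)) (\<lambda>n s. \<Sum>k<n. zeta_rem k s) (\<lambda>s. \<Sum>k. zeta_rem k s) sequentially"
  proof (rule Weierstrass_m_test)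
    fix k :: nat and s :: complex assume "s \<in> ball 1 (1/2)"
    then have s: "cmod (s - 1) < 1/2" by (simp add: dist_norm norm_minus_commute)
    from complex_Re_le_cmod[of "1 - s"] s have re: "Re s \<ge> 1/2"
      by (simp add: norm_minus_commute)
    have s': "cmod s \<le> 2" using norm_triangle_ineq[of 1 "s - 1"] s by simp
    have "cmod (zeta_rem k s) \<le> cmod (s - 1) * cmod s * real (Suc k) powr (- Re s - 1)"
      using re by (intro zeta_rem_bound) auto
    \<comment> \<open>On the ball \<open>\<bar>s - 1\<bar> < 1/2\<close>,
      \<open>\<bar>s\<bar> \<le> 2\<close> and \<open>Re s \<ge> 1/2\<close>, so the exponent
      \<open>- Re s - 1\<close> is at most \<open>-3/2\<close>.\<close>
    also have "\<dots> \<le> (1/2 * 2) * real (Suc k) powr (-3/2)"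
      using s s' re by (intro mult_mono powr_mono) auto
    finally show "cmod (zeta_rem k s) \<le> real (Suc k) powr (-3/2)" by simp
  next
    show "summable (\<lambda>k. real (Suc k) powr (-3/2))"
      by (subst summable_Suc_iff) (simp add: summable_real_powr_iff)
  qed
  note ul = this
  have "(\<lambda>s. \<Sum>k. zeta_rem k s) holomorphic_on ball 1 (1/2)"
  proof (rule holomorphic_uniform_sequence)
    show "\<And>n. (\<lambda>s. \<Sum>k<n. zeta_rem k s) holomorphic_on ball 1 (1/2)"
      unfolding zeta_rem_def by (intro holomorphic_intros)
  next
    fix x :: complex assume "x \<in> ball 1 (1/2)"
    then obtain d where "d > 0" "cball x d \<subseteq> ball 1 (1/2)"
      by (meson open_ball open_contains_cball)
    then show "\<exists>d>0. cball x d \<subseteq> ball 1 (1 / 2) \<and>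
         uniform_limit (cball x d) (\<lambda>n s. \<Sum>k<n. zeta_rem k s) (\<lambda>s. \<Sum>k. zeta_rem k s) sequentially"
      using uniform_limit_on_subset[OF ul] by blast
  qed auto
  then show ?thesis
    unfolding zeta_reg_def by (intro holomorphic_intros)
qed

lemma zeta_reg_1: "zeta_reg 1 = 1"
proof -
  have "zeta_rem k 1 = 0" for k
    unfolding zeta_rem_def by (simp del: of_nat_Suc)
  then show ?thesis by (simp add: zeta_reg_def)
qed

lemma zeta_reg_eq:
  assumes "Re s > 1"
  shows "zeta_reg s = (s - 1) * zeta_series s"
proof -
  have psum: "(\<Sum>k<n. zeta_rem k s) =
     (s - 1) * (\<Sum>k<n. 1 / of_nat (Suc k) powr s) - 1 + of_nat (Suc n) powr (1 - s)" for n
  proof (induction n)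
    case 0
    show ?case by simp
  next
    case (Suc n)
    then show ?case by (simp add: zeta_rem_def powr_minus algebra_simps divide_inverse del: of_nat_Suc)
  qed
  have "(\<lambda>n. of_nat (Suc n) powr (1 - s)) \<longlonglongrightarrow> 0"
  proof (rule tendsto_norm_zero_cancel)
    have "(\<lambda>n. real (Suc n) powr (1 - Re s)) \<longlonglongrightarrow> 0"
      using assms filterlim_compose[OF filterlim_real_sequentially filterlim_Suc]
      by (intro tendsto_neg_powr) auto
    moreover have "norm (of_nat (Suc n) powr (1 - s)) = real (Suc n) powr (1 - Re s)" for n
      by (subst norm_powr_real_powr) (auto simp del: of_nat_Suc)
    ultimately show "(\<lambda>n. norm (of_nat (Suc n) powr (1 - s))) \<longlonglongrightarrow> 0" by simp
  qed
  moreover have "(\<lambda>n. \<Sum>k<n. 1 / of_nat (Suc k) powr s) \<longlonglongrightarrow> zeta_series s"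
    using summable_sums[OF summable_zeta_series[OF assms]] unfolding sums_def zeta_series_def .
  ultimately have "(\<lambda>n. (s - 1) * (\<Sum>k<n. 1 / of_nat (Suc k) powr s) - 1 + of_nat (Suc n) powr (1 - s))
      \<longlonglongrightarrow> (s - 1) * zeta_series s - 1 + 0"
    by (intro tendsto_intros)
  then have "(\<lambda>k. zeta_rem k s) sums ((s - 1) * zeta_series s - 1)"
    unfolding sums_def psum by simp
  then show ?thesis by (simp add: zeta_reg_def sums_iff)
qed

lemma filterlim_one_plus_of_real:
  "filterlim (\<lambda>x. 1 + complex_of_real x) (at 1 within {s. Re s > 1}) (at_right 0)"
  unfolding filterlim_at
proof
  have "((\<lambda>x. 1 + complex_of_real x) \<longlongrightarrow> 1 + complex_of_real 0) (at_right 0)"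
    by (intro tendsto_intros)
  then show "((\<lambda>x. 1 + complex_of_real x) \<longlongrightarrow> 1) (at_right 0)" by simp
  show "\<forall>\<^sub>F x in at_right 0. 1 + complex_of_real x \<in> {s. 1 < Re s} \<and> 1 + complex_of_real x \<noteq> 1"
    using eventually_at_right_less[of 0] by eventually_elim auto
qed

text \<open>Justifies the definite description in \<open>stieltjes\<close>. Existence comes from the
  Taylor series of \<open>zeta_reg\<close>, but the witness must be real-valued, so the coefficients
  have to be shown real; uniqueness is read off on the ray \<open>1 + x\<close> with
  \<open>x > 0\<close>, which lies in the half plane.\<close>

lemma stieltjes_sums:
  "\<forall>\<^sub>F s in at 1 within {s. Re s > 1}.
     (\<lambda>n. (-1) ^ n * of_real (stieltjes n) / fact n * (s - 1) ^ n) sums (zeta_series s - 1 / (s - 1))"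
proof -
  define P where "P g = (\<forall>\<^sub>F s in at 1 within {s. Re s > 1}.
     (\<lambda>n. (-1) ^ n * of_real (g n) / fact n * (s - 1) ^ n) sums (zeta_series s - 1 / (s - 1)))"
    for g :: "nat \<Rightarrow> real"
  \<comment> \<open>\<open>c 0 = 1\<close> is the residue of the pole; dividing by
    \<open>s - 1\<close> shifts the index, so the Laurent coefficients proper are
    \<open>c (Suc n)\<close>.\<close>
  define c where "c n = (deriv ^^ n) zeta_reg 1 / fact n" for n
  have zsum: "(\<lambda>n. c (Suc n) * (s - 1) ^ n) sums (zeta_series s - 1 / (s - 1))"
    if "s \<in> ball 1 (1/2)" "Re s > 1" for s
  proof -
    have s: "s \<noteq> 1" using that by auto
    have "(\<lambda>n. c n * (s - 1) ^ n) sums zeta_reg s"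
      unfolding c_def using zeta_reg_holomorphic that(1) by (rule holomorphic_power_series)
    moreover have "c 0 = 1" by (simp add: c_def zeta_reg_1)
    ultimately have "(\<lambda>n. c (Suc n) * (s - 1) ^ Suc n) sums (zeta_reg s - 1)"
      by (subst sums_Suc_iff) simp
    then have "(\<lambda>n. c (Suc n) * (s - 1) ^ Suc n / (s - 1)) sums ((zeta_reg s - 1) / (s - 1))"
      by (rule sums_divide)
    then show ?thesis
      using s zeta_reg_eq[OF that(2)] by (simp add: diff_divide_distrib)
  qed
  have real_line: "\<forall>\<^sub>F x in at_right 0. Q (1 + complex_of_real x)"
    if "\<forall>\<^sub>F s in at 1 within {s. Re s > 1}. Q s" for Q
    using eventually_compose_filterlim[OF that filterlim_one_plus_of_real] .
  have ev_ball: "\<forall>\<^sub>F s in at 1 within {s. Re s > 1}. s \<in> ball 1 (1/2) \<and> Re s > 1"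
    by (auto simp: eventually_at dist_commute intro!: exI[of _ "1/2"])
  \<comment> \<open>The sum is real on the ray, so conjugating the coefficients gives another
    expansion of the same function there.\<close>
  have c_real: "cnj (c (Suc n)) = c (Suc n)" for n
  proof -
    define G where "G x = complex_of_real (zeta_real (1 + x) - 1 / x)" for x
    have *: "\<forall>\<^sub>F x in at_right 0. (\<lambda>n. c (Suc n) * of_real x ^ n) sums G x"
      using real_line[OF ev_ball] eventually_at_right_less[of 0]
    proof eventually_elim
      case (elim x)
      then have "zeta_series (complex_of_real (1 + x)) = of_real (zeta_real (1 + x))"
        by (intro zeta_series_of_real) auto
      then show ?case
        using zsum[of "1 + of_real x"] elim by (simp add: G_def)
    qed
    have "(\<lambda>n. cnj (c (Suc n))) = (\<lambda>n. c (Suc n))"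
    proof (rule powser_unique_at_right)
      show "\<forall>\<^sub>F x in at_right 0. (\<lambda>n. cnj (c (Suc n)) * of_real x ^ n) sums G x"
        using *
      proof eventually_elim
        case (elim x)
        then have "(\<lambda>n. cnj (c (Suc n) * of_real x ^ n)) sums cnj (G x)"
          by (subst sums_cnj)
        then show ?case by (simp add: G_def)
      qed
    qed (rule *)
    then show ?thesis by metis
  qed
  define g where "g n = (-1) ^ n * fact n * Re (c (Suc n))" for n :: nat
  have g: "(-1) ^ n * of_real (g n) / fact n = c (Suc n)" for n
  proof -
    have "c (Suc n) = of_real (Re (c (Suc n)))"
      using c_real[of n] by (metis complex_is_Real_iff Reals_cnj_iff of_real_Re)
    moreover have "(-1) ^ n * of_real (g n) / fact n = complex_of_real (Re (c (Suc n)))"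
      by (simp add: g_def flip: power_mult_distrib)
    ultimately show ?thesis by simp
  qed
  have ex: "P g"
    unfolding P_def g using ev_ball by eventually_elim (use zsum in auto)
  have uniq: "g1 = g2" if "P g1" "P g2" for g1 g2
  proof -
    let ?a = "\<lambda>g n. (-1) ^ n * complex_of_real (g n) / fact n"
    have "?a g1 = ?a g2"
      by (rule powser_unique_at_right)
         (use real_line[OF that(1)[unfolded P_def]] real_line[OF that(2)[unfolded P_def]] in simp_all)
    show ?thesis
    proof
      fix n
      have "?a g1 n = ?a g2 n" using \<open>?a g1 = ?a g2\<close> by metis
      then show "g1 n = g2 n" by simp
    qed
  qed
  have "P (THE g. P g)"
    using theI[of P, OF ex] uniq ex by blast
  then show ?thesis
    unfolding stieltjes_def P_def .
qed

text \<open>The form in which the Laurent expansion is used: \<open>s * zeta(1 + s) = 1 + stieltjes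
  0 * s - stieltjes 1 * s^2 + o(s^2)\<close>, the minus sign being the \<open>(-1) ^ n\<close> of
  the definition.\<close>

lemma zeta_real_expansion:
  "((\<lambda>s. (s * zeta_real (1 + s) - 1 - stieltjes 0 * s) / s\<^sup>2) \<longlongrightarrow> - stieltjes 1) (at_right 0)"
proof -
  define p where "p n = (-1) ^ n * stieltjes n / fact n" for n
  have "\<forall>\<^sub>F x in at_right 0. (\<lambda>n. p n * x ^ n) sums (zeta_real (1 + x) - 1 / x)"
  proof -
    from eventually_compose_filterlim[OF stieltjes_sums filterlim_one_plus_of_real] eventually_at_right_less[of 0]
    show ?thesis
    proof eventually_elim
      case (elim x)
      have "zeta_series (complex_of_real (1 + x)) = of_real (zeta_real (1 + x))"
        by (intro zeta_series_of_real) (use elim in auto)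
      with elim have "(\<lambda>n. complex_of_real (p n * x ^ n)) sums of_real (zeta_real (1 + x) - 1 / x)"
        by (simp add: p_def)
      then show ?case by (subst (asm) sums_of_real_iff)
    qed
  qed
  then obtain e where e: "e > 0" "\<And>x. 0 < x \<Longrightarrow> x < e \<Longrightarrow> (\<lambda>n. p n * x ^ n) sums (zeta_real (1 + x) - 1 / x)"
    by (auto simp: eventually_at_right_field)
  define r where "r = e / 2"
  have r: "r > 0" "r < e" using e(1) by (auto simp: r_def)
  define f where "f x = (\<Sum>n. p (Suc n) * x ^ n)" for x
  have fs: "(\<lambda>n. p (Suc n) * x ^ n) sums f x" if "norm x < r" for x
  proof -
    have "summable (\<lambda>n. p n * r ^ n)"
      using e(2)[OF r] by (rule sums_summable)
    then have "summable (\<lambda>n. p n * x ^ n)"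
      by (rule powser_inside) (use that r in auto)
    then show ?thesis
      unfolding f_def using powser_split_head(3) by (auto intro: summable_sums)
  qed
  have "(f \<longlongrightarrow> p (Suc 0)) (at 0)"
    using r(1) fs by (rule powser_limit_0)
  then have "(f \<longlongrightarrow> - stieltjes 1) (at_right 0)"
    by (auto simp: p_def intro: filterlim_mono[OF _ order.refl] at_le)
  moreover have "\<forall>\<^sub>F x in at_right 0. x < r"
    using r(1) by (rule order_tendstoD(2)[OF tendsto_ident_at])
  then have "\<forall>\<^sub>F x in at_right 0. f x = (x * zeta_real (1 + x) - 1 - stieltjes 0 * x) / x\<^sup>2"
    using eventually_at_right_less[of 0]
  proof eventually_elim
    case (elim x)
    have "(\<lambda>n. p (Suc n) * x ^ n * x) sums (f x * x)"
      by (intro sums_mult2 fs) (use elim in auto)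
    moreover have "(\<lambda>n. p (Suc n) * x ^ Suc n) sums (zeta_real (1 + x) - 1 / x - p 0)"
      using e(2)[of x] elim r by (subst sums_Suc_iff) auto
    ultimately have "f x * x = zeta_real (1 + x) - 1 / x - p 0"
      by (auto simp: mult_ac intro: sums_unique2)
    then show ?case using elim by (simp add: field_simps power2_eq_square p_def)
  qed
  ultimately show ?thesis
    by (rule Lim_transform_eventually)
qed

section \<open>Mellin transforms\<close>

text \<open>An \<open>ennreal\<close> integral lets sums be exchanged with the integral before
  anything is known to be finite; finiteness follows from the computed values.\<close>

definition mellin :: "real \<Rightarrow> (real \<Rightarrow> real) \<Rightarrow> ennreal" where
  "mellin s g = (\<integral>\<^sup>+t. ennreal (g t * t powr (s - 1)) * indicator {0<..} t \<partial>lborel)"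

lemma mellin_cong:
  assumes "\<And>t. t > 0 \<Longrightarrow> g t = h t"
  shows "mellin s g = mellin s h"
  unfolding mellin_def by (intro nn_integral_cong) (auto simp: indicator_def assms)

lemma mellin_scale:
  assumes [measurable]: "g \<in> borel_measurable borel" and a: "a > 0"
  shows "mellin s (\<lambda>t. g (a * t)) = ennreal (a powr (-s)) * mellin s g"
proof -
  have "mellin s g = ennreal a * (\<integral>\<^sup>+t. ennreal (g (0 + a * t) * (0 + a * t) powr (s - 1)) * indicator {0<..} (0 + a * t) \<partial>lborel)"
    unfolding mellin_def using a by (subst nn_integral_real_affine[where c=a and t=0]) auto
  also have "(\<integral>\<^sup>+t. ennreal (g (0 + a * t) * (0 + a * t) powr (s - 1)) * indicator {0<..} (0 + a * t) \<partial>lborel)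
     = (\<integral>\<^sup>+t. ennreal (a powr (s - 1)) * (ennreal (g (a * t) * t powr (s - 1)) * indicator {0<..} t) \<partial>lborel)"
    using a by (intro nn_integral_cong)
      (auto simp: indicator_def powr_mult zero_less_mult_iff ennreal_mult'[symmetric] mult_ac)
  also have "\<dots> = ennreal (a powr (s - 1)) * mellin s (\<lambda>t. g (a * t))"
    unfolding mellin_def by (subst nn_integral_cmult) auto
  finally have "ennreal (a powr (-s)) * mellin s g
      = ennreal (a powr (-s)) * (ennreal a * (ennreal (a powr (s - 1)) * mellin s (\<lambda>t. g (a * t))))"
    by (simp only:)
  also have "\<dots> = ennreal (a powr (-s) * a * a powr (s - 1)) * mellin s (\<lambda>t. g (a * t))"
    using a by (simp add: ennreal_mult' mult_ac)
  also have "a powr (-s) * a * a powr (s - 1) = 1"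
    using a by (simp add: powr_minus powr_diff field_simps)
  finally show ?thesis by simp
qed

text \<open>Each scaling by \<open>v n\<close> contributes \<open>v n powr (- s)\<close>, and the
  weight \<open>1 / v n\<close> moves the resulting Dirichlet series from \<open>s\<close> to
  \<open>1 + s\<close>.\<close>

lemma mellin_weighted_sum:
  assumes [measurable]: "g \<in> borel_measurable borel"
    and nonneg: "\<And>t. t > 0 \<Longrightarrow> g t \<ge> 0" and v: "\<And>n. v n > 0"
    and sm: "\<And>t. t > 0 \<Longrightarrow> summable (\<lambda>n. g (v n * t) / v n)"
  shows "mellin s (\<lambda>t. \<Sum>n. g (v n * t) / v n) = (\<Sum>n. ennreal (v n powr (-1 - s))) * mellin s g"
proof -
  have "mellin s (\<lambda>t. \<Sum>n. g (v n * t) / v n) =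
     (\<integral>\<^sup>+t. (\<Sum>n. ennreal (1 / v n) * (ennreal (g (v n * t) * t powr (s - 1)) * indicator {0<..} t)) \<partial>lborel)"
    unfolding mellin_def
  proof (intro nn_integral_cong)
    fix t :: real
    show "ennreal ((\<Sum>n. g (v n * t) / v n) * t powr (s - 1)) * indicator {0<..} t =
       (\<Sum>n. ennreal (1 / v n) * (ennreal (g (v n * t) * t powr (s - 1)) * indicator {0<..} t))"
    proof (cases "t > 0")
      case True
      have nn: "0 \<le> g (v n * t) / v n" for n
        using v[of n] True nonneg[of "v n * t"] by simp
      have "ennreal ((\<Sum>n. g (v n * t) / v n) * t powr (s - 1))
          = (\<Sum>n. ennreal (g (v n * t) / v n)) * ennreal (t powr (s - 1))"
        using suminf_nonneg[OF sm[OF True]] nn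
        by (subst ennreal_mult') (auto simp: suminf_ennreal2 sm[OF True])
      also have "\<dots> = (\<Sum>n. ennreal (g (v n * t) / v n) * ennreal (t powr (s - 1)))"
        by simp
      also have "\<dots> = (\<Sum>n. ennreal (1 / v n) * (ennreal (g (v n * t) * t powr (s - 1))))"
      proof (rule suminf_cong)
        fix n
        show "ennreal (g (v n * t) / v n) * ennreal (t powr (s - 1)) = ennreal (1 / v n) * (ennreal (g (v n * t) * t powr (s - 1)))"
          using v[of n] True nonneg[of "v n * t"] by (simp flip: ennreal_mult')
      qed
      finally show ?thesis using True by simp
    qed auto
  qed
  also have "\<dots> = (\<Sum>n. (\<integral>\<^sup>+t. ennreal (1 / v n) * (ennreal (g (v n * t) * t powr (s - 1)) * indicator {0<..} t) \<partial>lborel))"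
    by (intro nn_integral_suminf) measurable
  also have "\<dots> = (\<Sum>n. ennreal (1 / v n) * mellin s (\<lambda>t. g (v n * t)))"
    unfolding mellin_def by (subst nn_integral_cmult) auto
  also have "\<dots> = (\<Sum>n. ennreal (v n powr (-1 - s)) * mellin s g)"
  proof (rule suminf_cong)
    fix n
    have "ennreal (1 / v n) * (ennreal (v n powr - s) * mellin s g) = ennreal (1 / v n * v n powr - s) * mellin s g"
      using v[of n] by (subst ennreal_mult) (auto simp: mult.assoc)
    also have "1 / v n * v n powr -s = v n powr (-1 - s)"
      using v[of n] by (simp add: powr_diff powr_minus field_simps)
    finally show "ennreal (1 / v n) * mellin s (\<lambda>t. g (v n * t)) = ennreal (v n powr (-1 - s)) * mellin s g"
      using v[of n] by (simp add: mellin_scale)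
  qed
  finally show ?thesis by simp
qed

lemma mellin_exp:
  assumes "s > 0"
  shows "mellin s (\<lambda>t. exp (-t)) = ennreal (Gamma s)"
  unfolding Gamma_conv_nn_integral_real[OF assms] mellin_def
  by (intro nn_integral_cong) (auto simp: indicator_def exp_minus field_simps)

lemma suminf_powr_eq_zeta:
  assumes "s > 0"
  shows "(\<Sum>n. ennreal (real (Suc n) powr (-1 - s))) = ennreal (zeta_real (1 + s))"
proof -
  have "(\<Sum>n. ennreal (1 / real (Suc n) powr (1 + s))) = ennreal (zeta_real (1 + s))"
    unfolding zeta_real_def using assms
    by (intro suminf_ennreal2 summable_zeta_real) auto
  moreover have "1 / real (Suc n) powr (1 + s) = real (Suc n) powr (-1 - s)" for n
    using powr_minus_divide[of "real (Suc n)" "1 + s"] by (simp add: algebra_simps)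
  ultimately show ?thesis by simp
qed

lemma neg_ln_one_minus_exp_sums:
  assumes "t > 0"
  shows "(\<lambda>n. exp (- (real (Suc n) * t)) / real (Suc n)) sums (- ln (1 - exp (-t)))"
proof -
  have "(\<lambda>n. - ((- (- exp (-t))) ^ n) / real n) sums ln (1 + (- exp (-t)))"
    using assms by (intro ln_series') auto
  from sums_minus[OF this] have "(\<lambda>n. exp (-t) ^ n / real n) sums (- ln (1 - exp (-t)))"
    by simp
  then have "(\<lambda>n. exp (-t) ^ Suc n / real (Suc n)) sums (- ln (1 - exp (-t)))"
    by (subst sums_Suc_iff) simp
  moreover have "exp (-t) ^ Suc n = exp (- (real (Suc n) * t))" for n
    using exp_of_nat_mult[of "Suc n" "-t"] by simp
  ultimately show ?thesis by simp
qed

text \<open>Expanding the logarithm gives a positive weighted sum of exponentials. This function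
  serves twice: it leads to \<open>softplus\<close>, and its own simple behaviour at 0 identifies
  \<open>stieltjes 0\<close>.\<close>

lemma mellin_neg_ln_one_minus_exp:
  assumes "s > 0"
  shows "mellin s (\<lambda>t. - ln (1 - exp (-t))) = ennreal (zeta_real (1 + s) * Gamma s)"
proof -
  have "mellin s (\<lambda>t. - ln (1 - exp (-t))) = mellin s (\<lambda>t. \<Sum>n. exp (- (real (Suc n) * t)) / real (Suc n))"
    using neg_ln_one_minus_exp_sums by (intro mellin_cong) (simp add: sums_iff)
  also have "\<dots> = (\<Sum>n. ennreal (real (Suc n) powr (-1 - s))) * mellin s (\<lambda>t. exp (-t))"
    by (rule mellin_weighted_sum)
       (use neg_ln_one_minus_exp_sums in \<open>auto simp: sums_iff\<close>)
  finally show ?thesis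
    using assms Gamma_real_pos[of s] by (simp only: mellin_exp suminf_powr_eq_zeta) (simp add: ennreal_mult'')
qed

lemma zeta_real_nonneg: "s > 1 \<Longrightarrow> zeta_real s \<ge> 0"
  unfolding zeta_real_def by (intro suminf_nonneg summable_zeta_real) auto

text \<open>The usual softplus function evaluated at \<open>- u\<close>; the \<open>\<phi>\<close>
  of the overview.\<close>

definition softplus :: "real \<Rightarrow> real" where
  "softplus u = ln (1 + exp (-u))"

lemma softplus_measurable [measurable]: "softplus \<in> borel_measurable borel"
  unfolding softplus_def by measurable

lemma softplus_nonneg: "softplus u \<ge> 0"
  by (simp add: softplus_def)

lemma softplus_le: "softplus u \<le> exp (-u)"
  unfolding softplus_def by (rule ln_add_one_self_le_self) simp

text \<open>The series of \<open>ln (1 + exp (-t))\<close> alternates in sign, so it is not a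
  positive weighted sum. The factorisation
  \<open>1 - exp (-2t) = (1 - exp (-t)) * (1 + exp (-t))\<close> instead writes
  \<open>- ln (1 - exp (-t))\<close> as a sum of two nonnegative functions, \<open>softplus\<close>
  and a rescaled copy of itself; the copy has finite transform and can be subtracted.\<close>

lemma mellin_softplus:
  assumes s: "s > 0"
  shows "mellin s softplus = ennreal ((1 - 2 powr (-s)) * zeta_real (1 + s) * Gamma s)"
proof -
  let ?f = "\<lambda>t::real. - ln (1 - exp (-t))"
  have Z: "0 \<le> zeta_real (1 + s) * Gamma s"
    using s by (intro mult_nonneg_nonneg zeta_real_nonneg) (auto simp: Gamma_real_nonneg)
  have split: "?f t = softplus t + ?f (2 * t)" if "t > 0" for t
  proof -
    have e: "exp (-t) < 1" using that by simp
    have "1 - exp (-(2*t)) = (1 - exp (-t)) * (1 + exp (-t))"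
      by (simp add: algebra_simps flip: exp_add)
    then have "ln (1 - exp (-(2*t))) = ln (1 - exp (-t)) + ln (1 + exp (-t))"
      using e by (simp add: ln_mult_pos add_pos_pos)
    then show ?thesis by (simp add: softplus_def)
  qed
  have fnn: "?f t \<ge> 0" if "t > 0" for t
    using that by (simp add: ln_le_zero_iff)
  have "mellin s ?f = (\<integral>\<^sup>+t. ennreal (softplus t * t powr (s - 1)) * indicator {0<..} t
        + ennreal (?f (2 * t) * t powr (s - 1)) * indicator {0<..} t \<partial>lborel)"
    unfolding mellin_def
  proof (intro nn_integral_cong)
    fix t :: real
    show "ennreal (?f t * t powr (s - 1)) * indicator {0<..} t = ennreal (softplus t * t powr (s - 1)) * indicator {0<..} t
        + ennreal (?f (2 * t) * t powr (s - 1)) * indicator {0<..} t"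
    proof (cases "t > 0")
      case True
      have nn: "0 \<le> ?f (2 * t) * t powr (s - 1)" "0 \<le> softplus t * t powr (s - 1)"
        using fnn[of "2 * t"] True softplus_nonneg[of t] by (intro mult_nonneg_nonneg; simp)+
      have "ennreal (?f t * t powr (s - 1)) = ennreal (softplus t * t powr (s - 1) + ?f (2 * t) * t powr (s - 1))"
        unfolding split[OF True] by (simp only: distrib_right)
      also have "\<dots> = ennreal (softplus t * t powr (s - 1)) + ennreal (?f (2 * t) * t powr (s - 1))"
        using nn(2,1) by (rule ennreal_plus)
      finally show ?thesis using True by simp
    qed auto
  qed
  also have "\<dots> = mellin s softplus + mellin s (\<lambda>t. ?f (2 * t))"
    unfolding mellin_def by (intro nn_integral_add) measurable
  also have "mellin s (\<lambda>t. ?f (2 * t)) = ennreal (2 powr (-s)) * mellin s ?f"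
    by (rule mellin_scale) auto
  finally have eq: "ennreal (zeta_real (1 + s) * Gamma s) = mellin s softplus + ennreal (2 powr (-s) * (zeta_real (1 + s) * Gamma s))"
    using s Z by (simp add: mellin_neg_ln_one_minus_exp ennreal_mult')
  have "mellin s softplus = ennreal (zeta_real (1 + s) * Gamma s) - ennreal (2 powr (-s) * (zeta_real (1 + s) * Gamma s))"
    unfolding eq by (rule ennreal_add_diff_cancel_right[symmetric]) simp
  also have "\<dots> = ennreal (zeta_real (1 + s) * Gamma s - 2 powr (-s) * (zeta_real (1 + s) * Gamma s))"
    using Z by (intro ennreal_minus) auto
  finally show ?thesis by (simp add: algebra_simps)
qed

text \<open>All weights \<open>d\<^sub>1 d\<^sub>2\<close> of the product, enumerated by a single index.\<close>

definition wt :: "nat \<Rightarrow> nat" where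
  "wt n = (case prod_decode n of (i, j) \<Rightarrow> Suc i * Suc j)"

lemma wt_pos [simp]: "wt n > 0"
  by (auto simp: wt_def split: prod.splits)

lemma suminf_wt:
  fixes f :: "nat \<Rightarrow> ennreal"
  shows "(\<Sum>n. f (wt n)) = (\<Sum>i. \<Sum>j. f (Suc i * Suc j))"
proof -
  have "(\<Sum>n. (\<lambda>(i, j). f (Suc i * Suc j)) (prod_decode n)) = (\<Sum>i. \<Sum>j. f (Suc i * Suc j))"
    by (intro suminf_ennreal_2dimen) simp
  then show ?thesis by (simp add: wt_def case_prod_beta)
qed

text \<open>Since \<open>(i + 1) * (j + 1) \<ge> i + j\<close>, the double series is dominated by a
  product of two geometric series.\<close>

lemma summable_power_wt:
  fixes q :: real
  assumes "0 \<le> q" "q < 1"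
  shows "summable (\<lambda>n. q ^ wt n)"
proof (rule summable_suminf_not_top)
  have geo: "(\<Sum>j. ennreal (q ^ j)) = ennreal (1 / (1 - q))"
    using assms suminf_geometric[of q] by (subst suminf_ennreal2) (auto intro: summable_geometric)
  have "(\<Sum>n. ennreal (q ^ wt n)) = (\<Sum>i. \<Sum>j. ennreal (q ^ (Suc i * Suc j)))"
    using suminf_wt[of "\<lambda>m. ennreal (q ^ m)"] .
  also have "\<dots> \<le> (\<Sum>i. \<Sum>j. ennreal (q ^ i) * ennreal (q ^ j))"
  proof (intro suminf_le)
    fix i j
    have "q ^ (Suc i * Suc j) \<le> q ^ (i + j)"
      using assms by (intro power_decreasing) auto
    then show "ennreal (q ^ (Suc i * Suc j)) \<le> ennreal (q ^ i) * ennreal (q ^ j)"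
      using assms by (simp add: power_add ennreal_mult[symmetric] ennreal_leI del: mult_Suc mult_Suc_right)
  qed auto
  also have "\<dots> = ennreal (1 / (1 - q)) * ennreal (1 / (1 - q))"
    by (simp add: geo)
  also have "\<dots> < top" by (simp add: ennreal_mult_less_top)
  finally show "(\<Sum>n. ennreal (q ^ wt n)) \<noteq> top" by simp
qed (use assms in auto)

lemma summable_exp_wt:
  assumes "r > 0"
  shows "summable (\<lambda>n. exp (- (real (wt n) * r)))"
  using summable_power_wt[of "exp (-r)"] assms by (simp add: exp_of_nat_mult[symmetric])

lemma wt_div_le:
  assumes "x \<ge> 0"
  shows "x / real (wt n) \<le> x"
  using divide_left_mono[of 1 "real (wt n)" x] assms wt_pos[of n] by simp

section \<open>The generating function on the real axis and its Mellin transform\<close>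

definition logQ :: "real \<Rightarrow> real" where
  "logQ t = (\<Sum>n. softplus (real (wt n) * t) / real (wt n))"

lemma summable_logQ:
  assumes "t > 0"
  shows "summable (\<lambda>n. softplus (real (wt n) * t) / real (wt n))"
proof (rule summable_comparison_test'[OF summable_exp_wt[OF assms]])
  fix n :: nat
  show "norm (softplus (real (wt n) * t) / real (wt n)) \<le> exp (- (real (wt n) * t))"
    using wt_div_le[OF softplus_nonneg[of "real (wt n) * t"], of n] softplus_le[of "real (wt n) * t"]
    by (simp add: softplus_nonneg)
qed

text \<open>The sums over the two divisors give two zeta factors and \<open>softplus\<close> gives
  the third. The pole of \<open>Gamma\<close> is offset by the zero of
  \<open>1 - 2 powr (-s)\<close>, so the pole at \<open>s = 0\<close> has order three, matching a
  quadratic polynomial in \<open>ln t\<close>.\<close>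

lemma mellin_logQ:
  assumes s: "s > 0"
  shows "mellin s logQ = ennreal (zeta_real (1 + s) ^ 3 * (1 - 2 powr (-s)) * Gamma s)"
proof -
  have "(\<Sum>n. ennreal (real (wt n) powr (-1 - s))) = (\<Sum>i. \<Sum>j. ennreal (real (Suc i * Suc j) powr (-1 - s)))"
    by (rule suminf_wt)
  also have "\<dots> = (\<Sum>i. \<Sum>j. ennreal (real (Suc i) powr (-1 - s)) * ennreal (real (Suc j) powr (-1 - s)))"
    by (intro suminf_cong) (simp only: of_nat_mult, simp add: powr_mult ennreal_mult)
  also have "\<dots> = ennreal (zeta_real (1 + s)) * ennreal (zeta_real (1 + s))"
    using s by (simp only: ennreal_suminf_cmult ennreal_suminf_multc suminf_powr_eq_zeta)
  finally have w: "(\<Sum>n. ennreal (real (wt n) powr (-1 - s))) = ennreal (zeta_real (1 + s)) * ennreal (zeta_real (1 + s))" .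
  have "mellin s logQ = (\<Sum>n. ennreal (real (wt n) powr (-1 - s))) * mellin s softplus"
    unfolding logQ_def
    by (rule mellin_weighted_sum) (use summable_logQ in \<open>auto simp: softplus_nonneg\<close>)
  also have "\<dots> = ennreal (zeta_real (1 + s) * zeta_real (1 + s) * ((1 - 2 powr (-s)) * zeta_real (1 + s) * Gamma s))"
    unfolding w using s zeta_real_nonneg[of "1 + s"]
    by (simp add: mellin_softplus ennreal_mult')
  finally show ?thesis by (simp add: power3_eq_cube mult_ac)
qed

text \<open>The model terms of an expansion at 0, restricted to \<open>(0, 1)\<close>: a power
  \<open>(ln t)^k\<close> produces a pole of order \<open>k + 1\<close> at
  \<open>s = 0\<close>.\<close>

lemma integral_ln_power_powr:
  fixes s :: real
  assumes s: "s > 0"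
  shows "set_integrable lborel {0<..<1} (\<lambda>t. t powr (s - 1))"
    and "(LBINT t:{0<..<1}. t powr (s - 1)) = 1 / s"
    and "set_integrable lborel {0<..<1} (\<lambda>t. ln t * t powr (s - 1))"
    and "(LBINT t:{0<..<1}. ln t * t powr (s - 1)) = - 1 / s\<^sup>2"
    and "set_integrable lborel {0<..<1} (\<lambda>t. (ln t)\<^sup>2 * t powr (s - 1))"
    and "(LBINT t:{0<..<1}. (ln t)\<^sup>2 * t powr (s - 1)) = 2 / s ^ 3"
proof -
  have FTC: "set_integrable lborel {0<..<1} f \<and> (LBINT t:{0<..<1}. f t) = B - A"
    if "\<And>x. 0 < x \<Longrightarrow> x < 1 \<Longrightarrow> (F has_real_derivative f x) (at x)"
       "\<And>x. 0 < x \<Longrightarrow> x < 1 \<Longrightarrow> isCont f x"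
       "\<And>x. 0 < x \<Longrightarrow> x < 1 \<Longrightarrow> 0 \<le> f x"
       "(F \<longlongrightarrow> A) (at_right 0)" "(F \<longlongrightarrow> B) (at_left 1)" for f F :: "real \<Rightarrow> real" and A B
  proof -
    have e: "einterval (ereal 0) (ereal 1) = {0<..<1}"
      by (auto simp: einterval_def)
    have A1: "set_integrable lborel (einterval (ereal 0) (ereal 1)) f"
      by (rule interval_integral_FTC_nonneg(1)[of "ereal 0" "ereal 1" F f A B])
         (use that in \<open>auto simp: ereal_tendsto_simps AE_I2 simp del: zero_ereal_def\<close>)
    have A2: "(LBINT t=ereal 0..ereal 1. f t) = B - A"
      by (rule interval_integral_FTC_nonneg(2)[of "ereal 0" "ereal 1" F f A B])
         (use that in \<open>auto simp: ereal_tendsto_simps AE_I2 simp del: zero_ereal_def\<close>)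
    from A1 A2 show ?thesis
      unfolding e by (simp add: interval_lebesgue_integral_def e)
  qed
  have 0: "set_integrable lborel {0<..<1} (\<lambda>t. t powr (s - 1)) \<and>
      (LBINT t:{0<..<1}. t powr (s - 1)) = 1 / s - 0"
  proof (rule FTC[where F="\<lambda>t. t powr s / s"])
    show "((\<lambda>t. t powr s / s) \<longlongrightarrow> 0) (at_right 0)" using s by real_asymp
    show "((\<lambda>t. t powr s / s) \<longlongrightarrow> 1 / s) (at_left 1)" using s by (auto intro!: tendsto_eq_intros)
  qed (use s in \<open>auto intro!: derivative_eq_intros continuous_intros simp: powr_diff\<close>)
  show "set_integrable lborel {0<..<1} (\<lambda>t. t powr (s - 1))"
    and "(LBINT t:{0<..<1}. t powr (s - 1)) = 1 / s" using 0 by auto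
  have 1: "set_integrable lborel {0<..<1} (\<lambda>t. - ln t * t powr (s - 1)) \<and>
      (LBINT t:{0<..<1}. - ln t * t powr (s - 1)) = 1 / s\<^sup>2 - 0"
  proof (rule FTC[where F="\<lambda>t. t powr s * (1 / s\<^sup>2 - ln t / s)"])
    show "((\<lambda>t. t powr s * (1 / s\<^sup>2 - ln t / s)) \<longlongrightarrow> 0) (at_right 0)" using s by real_asymp
    show "((\<lambda>t. t powr s * (1 / s\<^sup>2 - ln t / s)) \<longlongrightarrow> 1 / s\<^sup>2) (at_left 1)" using s by real_asymp
    show "((\<lambda>t. t powr s * (1 / s\<^sup>2 - ln t / s)) has_real_derivative - ln x * x powr (s - 1)) (at x)"
      if "0 < x" "x < 1" for x
      using s that
      by (auto intro!: derivative_eq_intros simp: powr_diff) (simp add: field_simps power2_eq_square)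
  qed (use s in \<open>auto intro!: derivative_eq_intros continuous_intros simp: mult_nonpos_nonneg\<close>)
  \<comment> \<open>The fundamental theorem was applied to a nonnegative integrand, so the sign of
    \<open>ln t\<close> on \<open>(0, 1)\<close> is restored here.\<close>
  have eq1: "(\<lambda>t. ln t * t powr (s - 1)) = (\<lambda>t. (-1) * (- ln t * t powr (s - 1)))" by simp
  show "set_integrable lborel {0<..<1} (\<lambda>t. ln t * t powr (s - 1))"
    unfolding eq1 using 1 by (intro set_integrable_mult_right) auto
  show "(LBINT t:{0<..<1}. ln t * t powr (s - 1)) = - 1 / s\<^sup>2"
    unfolding eq1 using 1 by (subst set_integral_mult_right) auto
  have 2: "set_integrable lborel {0<..<1} (\<lambda>t. (ln t)\<^sup>2 * t powr (s - 1)) \<and>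
      (LBINT t:{0<..<1}. (ln t)\<^sup>2 * t powr (s - 1)) = 2 / s ^ 3 - 0"
  proof (rule FTC[where F="\<lambda>t. t powr s * ((ln t)\<^sup>2 / s - 2 * ln t / s\<^sup>2 + 2 / s ^ 3)"])
    show "((\<lambda>t. t powr s * ((ln t)\<^sup>2 / s - 2 * ln t / s\<^sup>2 + 2 / s ^ 3)) \<longlongrightarrow> 0) (at_right 0)" using s by real_asymp
    show "((\<lambda>t. t powr s * ((ln t)\<^sup>2 / s - 2 * ln t / s\<^sup>2 + 2 / s ^ 3)) \<longlongrightarrow> 2 / s ^ 3) (at_left 1)" using s by real_asymp
    show "((\<lambda>t. t powr s * ((ln t)\<^sup>2 / s - 2 * ln t / s\<^sup>2 + 2 / s ^ 3)) has_real_derivative (ln x)\<^sup>2 * x powr (s - 1)) (at x)"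
      if "0 < x" "x < 1" for x
      using s that
      by (auto intro!: derivative_eq_intros simp: powr_diff) (simp add: field_simps power2_eq_square eval_nat_numeral)
  qed (use s in \<open>auto intro!: derivative_eq_intros continuous_intros\<close>)
  then show "set_integrable lborel {0<..<1} (\<lambda>t. (ln t)\<^sup>2 * t powr (s - 1))"
    and "(LBINT t:{0<..<1}. (ln t)\<^sup>2 * t powr (s - 1)) = 2 / s ^ 3" by auto
qed

text \<open>
  The coefficients of an expansion of \<open>G\<close> at 0 can be read off its Mellin transform as
  \<open>s\<close> tends to 0 from the right, without inverting the transform.
\<close>

lemma mellin_abelian:
  fixes G M :: "real \<Rightarrow> real"
  assumes [measurable]: "G \<in> borel_measurable borel"
    and nonneg: "\<And>t. t > 0 \<Longrightarrow> G t \<ge> 0"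
    and mel: "\<And>s. 0 < s \<Longrightarrow> mellin s G = ennreal (M s)" "\<And>s. 0 < s \<Longrightarrow> M s \<ge> 0"
    and lim: "((\<lambda>t. G t - (p * (ln t)\<^sup>2 + q * ln t + c)) \<longlongrightarrow> 0) (at_right 0)"
  shows "((\<lambda>s. (s ^ 3 * M s - 2 * p + q * s) / s\<^sup>2) \<longlongrightarrow> c) (at_right 0)"
proof -
  \<comment> \<open>The expansion is subtracted on \<open>(0, 1)\<close> only, where its transform
    is explicit; thus \<open>e\<close> tends to 0 at 0 and equals \<open>G\<close> from 1
    on.\<close>
  define e where "e t = indicator {0<..} t * G t
     - indicator {0<..<1} t * (p * (ln t)\<^sup>2 + q * ln t + c)" for t :: real
  have [measurable]: "e \<in> borel_measurable borel" unfolding e_def by measurable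
  have G_int: "has_bochner_integral lborel (\<lambda>t. indicator {0<..} t * G t * t powr (s - 1)) (M s)" if "s > 0" for s
  proof (rule has_bochner_integral_nn_integral)
    have "(\<integral>\<^sup>+t. ennreal (indicator {0<..} t * G t * t powr (s - 1)) \<partial>lborel) = mellin s G"
      unfolding mellin_def by (intro nn_integral_cong) (auto simp: indicator_def)
    then show "(\<integral>\<^sup>+t. ennreal (indicator {0<..} t * G t * t powr (s - 1)) \<partial>lborel) = ennreal (M s)"
      using mel(1)[OF that] by simp
    show "AE t in lborel. 0 \<le> indicator {0<..} t * G t * t powr (s - 1)"
      by (intro AE_I2) (auto simp: indicator_def nonneg)
  qed (use mel(2) that in auto)
  have P_int: "has_bochner_integral lborel (\<lambda>t. indicator {0<..<1} t * (p * (ln t)\<^sup>2 + q * ln t + c) * t powr (s - 1))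
     (p * (2 / s ^ 3) + q * (- 1 / s\<^sup>2) + c * (1 / s))" if s: "s > 0" for s
  proof -
    have "has_bochner_integral lborel (\<lambda>t. p * (indicator {0<..<1} t * ((ln t)\<^sup>2 * t powr (s - 1)))
         + q * (indicator {0<..<1} t * (ln t * t powr (s - 1)))
         + c * (indicator {0<..<1} t * (t powr (s - 1))))
      (p * (2 / s ^ 3) + q * (- 1 / s\<^sup>2) + c * (1 / s))"
      using integral_ln_power_powr[OF s]
      unfolding set_integrable_def set_lebesgue_integral_def has_bochner_integral_iff real_scaleR_def
      by auto
    then show ?thesis
      by (rule iffD1[OF has_bochner_integral_cong, rotated 3]) (auto simp: algebra_simps)
  qed
  have e_int: "has_bochner_integral lborel (\<lambda>t. e t * t powr (s - 1))
      (M s - (p * (2 / s ^ 3) + q * (- 1 / s\<^sup>2) + c * (1 / s)))" if s: "s > 0" for s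
    using has_bochner_integral_diff[OF G_int[OF s] P_int[OF s]]
    by (rule iffD1[OF has_bochner_integral_cong, rotated 3]) (auto simp: e_def algebra_simps)
  define I where "I s = (LINT t|lborel. e t * t powr (s - 1))" for s
  \<comment> \<open>Near 0 the bound \<open>\<bar>e\<bar> \<le> \<eta> / 2\<close> is integrated
    against \<open>t powr (s - 1)\<close>, whose integral over \<open>(0, 1)\<close> is
    \<open>1 / s\<close>; the factor \<open>s\<close> reduces this to \<open>\<eta> / 2\<close> and
    kills the contribution of the other \<open>t\<close>, which stays bounded.\<close>
  have "((\<lambda>s. s * I s) \<longlongrightarrow> 0) (at_right 0)"
  proof (rule tendstoI)
    fix \<eta> :: real assume \<eta>: "\<eta> > 0"
    have "\<forall>\<^sub>F t in at_right 0. \<bar>G t - (p * (ln t)\<^sup>2 + q * ln t + c)\<bar> < \<eta> / 2"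
      using tendstoD[OF lim, of "\<eta> / 2"] \<eta> by (simp add: dist_real_def)
    then obtain d' where d': "d' > 0" "\<And>t. 0 < t \<Longrightarrow> t < d' \<Longrightarrow> \<bar>G t - (p * (ln t)\<^sup>2 + q * ln t + c)\<bar> < \<eta> / 2"
      by (auto simp: eventually_at_right_field)
    define d where "d = min d' (1/2)"
    have d: "d > 0" "d < 1" using d' by (auto simp: d_def)
    have e_small: "\<bar>e t\<bar> \<le> \<eta> / 2" if "0 < t" "t < d" for t
      using d'(2)[of t] that by (auto simp: e_def d_def)
    \<comment> \<open>For \<open>t \<ge> d\<close> and \<open>0 < s \<le> 1/2\<close> one has
      \<open>t powr (s - 1) \<le> d powr (-1/2) * t powr (-1/2)\<close>; the bound does not depend
      on \<open>s\<close> and is integrable against \<open>e\<close>, by convergence of the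
      transform at \<open>s = 1/2\<close>.\<close>
    define K where "K = (LINT t|lborel. d powr (-1/2) * (\<bar>e t\<bar> * t powr (-1/2)))"
    have K_int: "integrable lborel (\<lambda>t. d powr (-1/2) * (\<bar>e t\<bar> * t powr (-1/2)))"
    proof -
      have "integrable lborel (\<lambda>t. \<bar>e t * t powr (1/2 - 1)\<bar>)"
        using e_int[of "1/2"] by (intro integrable_abs) (auto simp: has_bochner_integral_iff)
      then show ?thesis by (simp add: abs_mult)
    qed
    have bound: "\<bar>I s\<bar> \<le> \<eta> / 2 * (1 / s) + K" if s: "0 < s" "s \<le> 1/2" for s
    proof -
      have int1: "integrable lborel (\<lambda>t. \<eta> / 2 * (indicator {0<..<1} t * t powr (s - 1)))"
        using integral_ln_power_powr(1)[OF s(1)] by (simp add: set_integrable_def)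
      have val1: "(LINT t|lborel. \<eta> / 2 * (indicator {0<..<1} t * t powr (s - 1))) = \<eta> / 2 * (1 / s)"
        using integral_ln_power_powr(2)[OF s(1)] by (simp add: set_lebesgue_integral_def)
      have "\<bar>I s\<bar> \<le> (LINT t|lborel. \<bar>e t * t powr (s - 1)\<bar>)"
        unfolding I_def by (rule integral_abs_bound)
      also have "\<dots> \<le> (LINT t|lborel. \<eta> / 2 * (indicator {0<..<1} t * t powr (s - 1)) + d powr (-1/2) * (\<bar>e t\<bar> * t powr (-1/2)))"
      proof (rule integral_mono)
        show "integrable lborel (\<lambda>t. \<bar>e t * t powr (s - 1)\<bar>)"
          using e_int[OF s(1)] by (intro integrable_abs) (auto simp: has_bochner_integral_iff)
        show "integrable lborel (\<lambda>t. \<eta> / 2 * (indicator {0<..<1} t * t powr (s - 1)) + d powr (-1/2) * (\<bar>e t\<bar> * t powr (-1/2)))"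
          using int1 K_int by auto
      next
        fix t :: real
        consider "t \<le> 0" | "0 < t" "t < d" | "t \<ge> d" "t > 0" by linarith
        then show "\<bar>e t * t powr (s - 1)\<bar> \<le> \<eta> / 2 * (indicator {0<..<1} t * t powr (s - 1)) + d powr (-1/2) * (\<bar>e t\<bar> * t powr (-1/2))"
        proof cases
          case 1
          then show ?thesis by (simp add: e_def)
        next
          case 2
          have "\<bar>e t * t powr (s - 1)\<bar> \<le> \<eta> / 2 * t powr (s - 1)"
            using mult_right_mono[OF e_small[OF 2], of "t powr (s - 1)"] by (simp add: abs_mult)
          then show ?thesis using 2 d by (simp add: add_increasing2)
        next
          case 3
          have "t powr (s - 1) = t powr (s - 1/2) * t powr (-1/2)"
            using 3 by (simp flip: powr_add)
          also have "t powr (s - 1/2) \<le> d powr (s - 1/2)"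
            using 3 d s by (intro powr_mono2') auto
          also have "d powr (s - 1/2) \<le> d powr (-1/2)"
            using d s by (intro powr_mono') auto
          finally have "t powr (s - 1) \<le> d powr (-1/2) * t powr (-1/2)" by (simp add: mult_right_mono)
          then have "\<bar>e t\<bar> * t powr (s - 1) \<le> \<bar>e t\<bar> * (d powr (-1/2) * t powr (-1/2))"
            by (intro mult_left_mono) auto
          then show ?thesis using \<eta> by (simp add: abs_mult mult_ac add_increasing)
        qed
      qed
      also have "\<dots> = \<eta> / 2 * (1 / s) + K"
        unfolding K_def using int1 K_int val1 by (subst Bochner_Integration.integral_add) auto
      finally show ?thesis .
    qed
    have "\<forall>\<^sub>F s in at_right 0. s < \<eta> / (2 * (\<bar>K\<bar> + 1))"
      by (rule order_tendstoD(2)[OF tendsto_ident_at]) (use \<eta> in auto)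
    moreover have "\<forall>\<^sub>F s in at_right 0. s < (1/2::real)"
      by (rule order_tendstoD(2)[OF tendsto_ident_at]) auto
    ultimately show "\<forall>\<^sub>F s in at_right 0. dist (s * I s) 0 < \<eta>"
      using eventually_at_right_less[of 0]
    proof eventually_elim
      case (elim s)
      have "\<bar>s * I s\<bar> \<le> s * (\<eta> / 2 * (1 / s) + K)"
        using bound[of s] elim by (simp add: abs_mult mult_left_mono)
      also have "\<dots> = \<eta> / 2 + s * K" using elim by (simp add: field_simps)
      also have "s * K \<le> s * (\<bar>K\<bar> + 1)" using elim by (intro mult_left_mono) auto
      also have "s * (\<bar>K\<bar> + 1) < \<eta> / 2" using elim by (simp add: field_simps)
      finally show ?case by (simp add: dist_real_def)
    qed
  qed
  then have "((\<lambda>s. c + s * I s) \<longlongrightarrow> c + 0) (at_right 0)"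
    by (intro tendsto_intros)
  moreover have "\<forall>\<^sub>F s in at_right 0. c + s * I s = (s ^ 3 * M s - 2 * p + q * s) / s\<^sup>2"
    using eventually_at_right_less[of 0]
  proof eventually_elim
    case (elim s)
    have "I s = M s - (p * (2 / s ^ 3) + q * (- 1 / s\<^sup>2) + c * (1 / s))"
      using e_int[of s] elim unfolding I_def by (simp add: has_bochner_integral_iff)
    then show ?case using elim by (simp add: field_simps power2_eq_square power3_eq_cube)
  qed
  ultimately show ?thesis
    by (auto intro: Lim_transform_eventually)
qed

section \<open>Second-order expansions at 0 from the right and the values of the constants\<close>

definition expands :: "(real \<Rightarrow> real) \<Rightarrow> real \<Rightarrow> real \<Rightarrow> real \<Rightarrow> bool" where
  "expands f a0 a1 a2 \<longleftrightarrow> ((\<lambda>s. (f s - a0 - a1 * s) / s\<^sup>2) \<longlongrightarrow> a2) (at_right 0)"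

lemma expands_mult:
  assumes "expands f a0 a1 a2" "expands g b0 b1 b2"
  shows "expands (\<lambda>s. f s * g s) (a0 * b0) (a0 * b1 + a1 * b0) (a0 * b2 + a1 * b1 + a2 * b0)"
proof -
  define A where "A s = (f s - a0 - a1 * s) / s\<^sup>2" for s
  define B where "B s = (g s - b0 - b1 * s) / s\<^sup>2" for s
  have AB: "(A \<longlongrightarrow> a2) (at_right 0)" "(B \<longlongrightarrow> b2) (at_right 0)"
    using assms by (simp_all add: A_def[abs_def] B_def[abs_def] expands_def)
  have "((\<lambda>s. a0 * B s + a1 * b1 + A s * b0 + s * (a1 * B s + A s * b1) + s\<^sup>2 * (A s * B s))
     \<longlongrightarrow> a0 * b2 + a1 * b1 + a2 * b0 + 0 * (a1 * b2 + a2 * b1) + 0\<^sup>2 * (a2 * b2)) (at_right 0)"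
    by (intro tendsto_intros AB)
  moreover have "\<forall>\<^sub>F s in at_right 0.
      a0 * B s + a1 * b1 + A s * b0 + s * (a1 * B s + A s * b1) + s\<^sup>2 * (A s * B s)
      = (f s * g s - a0 * b0 - (a0 * b1 + a1 * b0) * s) / s\<^sup>2"
    using eventually_at_right_less[of 0]
  proof eventually_elim
    case (elim s)
    have f: "f s = a0 + a1 * s + A s * s\<^sup>2" and g: "g s = b0 + b1 * s + B s * s\<^sup>2"
      using elim by (auto simp: A_def B_def)
    show ?case unfolding f g using elim by (simp add: field_simps power2_eq_square)
  qed
  ultimately show ?thesis
    unfolding expands_def by (auto intro: Lim_transform_eventually)
qed

lemma expands_cong:
  assumes "expands f a0 a1 a2" "a0 = b0" "a1 = b1" "a2 = b2"
  shows "expands f b0 b1 b2"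
  using assms by simp

lemma Polygamma_1_1: "Polygamma 1 (1::real) = pi\<^sup>2 / 6"
proof -
  have "(\<Sum>k. inverse ((1 + real k)\<^sup>2)) = pi\<^sup>2 / 6"
    using inverse_squares_sums by (simp add: sums_iff inverse_eq_divide add.commute)
  then show ?thesis
    by (simp add: Polygamma_def numeral_2_eq_2)
qed

text \<open>The coefficients are those of \<open>Gamma'(1) = - \<gamma>\<close> and
  \<open>Gamma''(1) = \<gamma>^2 + pi^2 / 6\<close>. L'Hopital's rule is used once; the remaining
  quotient is a difference quotient of \<open>Gamma * Digamma\<close> at 1.\<close>

lemma expands_Gamma:
  "expands (\<lambda>s. Gamma (1 + s)) 1 (- euler_mascheroni) (euler_mascheroni\<^sup>2 / 2 + pi\<^sup>2 / 12)"
  unfolding expands_def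
proof (rule lhopital_right_0)
  let ?g = "\<lambda>s::real. Gamma (1 + s) * Digamma (1 + s)"
  have pos: "1 + s \<notin> \<int>\<^sub>\<le>\<^sub>0" if "s \<ge> 0" for s :: real
    using that by (auto elim!: nonpos_Ints_cases)
  have DG: "((\<lambda>s. Gamma (1 + s)) has_real_derivative ?g s) (at s)" if "s \<ge> 0" for s :: real
    using pos[OF that] by (auto intro!: derivative_eq_intros)
  have "((\<lambda>s. Gamma (1 + s)) \<longlongrightarrow> Gamma (1 + 0 :: real)) (at_right 0)"
    using DERIV_isCont[OF DG[of 0]] by (auto simp: isCont_def intro: tendsto_mono[OF at_le])
  then have "((\<lambda>s. Gamma (1 + s) - 1 - (- euler_mascheroni) * s) \<longlongrightarrow> Gamma (1 + 0 :: real) - 1 - (- euler_mascheroni) * 0) (at_right 0)"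
    by (intro tendsto_diff tendsto_mult tendsto_const tendsto_ident_at)
  then show "((\<lambda>s. Gamma (1 + s) - 1 - (- euler_mascheroni) * s) \<longlongrightarrow> (0::real)) (at_right 0)" by simp
  show "((\<lambda>s::real. s\<^sup>2) \<longlongrightarrow> 0) (at_right 0)" by real_asymp
  show "\<forall>\<^sub>F s in at_right 0. (s::real)\<^sup>2 \<noteq> 0"
    using eventually_at_right_less[of 0] by eventually_elim auto
  show "\<forall>\<^sub>F s in at_right 0. 2 * (s::real) \<noteq> 0"
    using eventually_at_right_less[of 0] by eventually_elim auto
  show "\<forall>\<^sub>F s in at_right 0. ((\<lambda>s. Gamma (1 + s) - 1 - (- euler_mascheroni) * s) has_real_derivative
      (?g s + euler_mascheroni)) (at s)"
    using eventually_at_right_less[of 0]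
  proof eventually_elim
    case (elim s)
    then show ?case by (auto intro!: derivative_eq_intros DG[THEN DERIV_cong])
  qed
  show "\<forall>\<^sub>F s in at_right 0. ((\<lambda>s::real. s\<^sup>2) has_real_derivative 2 * s) (at s)"
    by (auto intro!: always_eventually derivative_eq_intros)
  have "(?g has_real_derivative (euler_mascheroni\<^sup>2 + pi\<^sup>2 / 6)) (at 0)"
    using pos[of 0] Polygamma_1_1
    by (auto intro!: derivative_eq_intros simp: power2_eq_square)
  then have "((\<lambda>s. (?g s - ?g 0) / s) \<longlongrightarrow> euler_mascheroni\<^sup>2 + pi\<^sup>2 / 6) (at_right 0)"
    by (auto simp: has_field_derivative_iff intro: tendsto_mono[OF at_le])
  then have "((\<lambda>s. (?g s - ?g 0) / s / 2) \<longlongrightarrow> (euler_mascheroni\<^sup>2 + pi\<^sup>2 / 6) / 2) (at_right 0)"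
    by (intro tendsto_intros) auto
  then show "((\<lambda>s. (?g s + euler_mascheroni) / (2 * s)) \<longlongrightarrow> euler_mascheroni\<^sup>2 / 2 + pi\<^sup>2 / 12) (at_right 0)"
    by (simp add: add_divide_distrib mult.commute)
qed

text \<open>Compares the Mellin transform of \<open>- ln (1 - exp (-t)) = - ln t + o(1)\<close> with its expansion.\<close>

lemma stieltjes_0: "stieltjes 0 = euler_mascheroni"
proof -
  let ?f = "\<lambda>t::real. - ln (1 - exp (-t))"
  let ?M = "\<lambda>s. zeta_real (1 + s) * Gamma s"
  have 1: "((\<lambda>s. (s ^ 3 * ?M s - 2 * 0 + (-1) * s) / s\<^sup>2) \<longlongrightarrow> 0) (at_right 0)"
  proof (rule mellin_abelian[where G="?f"])
    show "?f t \<ge> 0" if "t > 0" for t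
      using that by (simp add: ln_le_zero_iff)
    show "((\<lambda>t. ?f t - (0 * (ln t)\<^sup>2 + -1 * ln t + 0)) \<longlongrightarrow> 0) (at_right 0)"
      by real_asymp
  qed (auto simp: mellin_neg_ln_one_minus_exp intro!: mult_nonneg_nonneg zeta_real_nonneg Gamma_real_nonneg)
  define X where "X s = s * zeta_real (1 + s) * Gamma (1 + s)" for s
  have X: "expands X (1 * 1) (1 * (- euler_mascheroni) + stieltjes 0 * 1)
     (1 * (euler_mascheroni\<^sup>2 / 2 + pi\<^sup>2 / 12) + stieltjes 0 * (- euler_mascheroni) + (- stieltjes 1) * 1)"
    unfolding X_def
    by (intro expands_mult expands_Gamma) (use zeta_real_expansion in \<open>simp add: expands_def\<close>)
  let ?d = "stieltjes 0 - euler_mascheroni"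
  \<comment> \<open>The expression simplifies to \<open>(X s - 1) / s\<close>, so its limit is the
    linear coefficient of \<open>X\<close>; the Abelian limit \<open>1\<close> says that the same
    quotient tends to 0.\<close>
  have "((\<lambda>s. s * ((X s - 1 - ?d * s) / s\<^sup>2) + ?d) \<longlongrightarrow>
     0 * (1 * (euler_mascheroni\<^sup>2 / 2 + pi\<^sup>2 / 12) + stieltjes 0 * (- euler_mascheroni) + (- stieltjes 1) * 1) + ?d) (at_right 0)"
    using X unfolding expands_def by (intro tendsto_intros) simp
  moreover have "\<forall>\<^sub>F s in at_right 0. s * ((X s - 1 - ?d * s) / s\<^sup>2) + ?d = (s ^ 3 * ?M s - 2 * 0 + (-1) * s) / s\<^sup>2"
    using eventually_at_right_less[of 0]
  proof eventually_elim
    case (elim s)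
    have "Gamma (1 + s) = s * Gamma s"
      using Gamma_plus1[of s] elim nonpos_Ints_nonpos[of s] by (fastforce simp: add.commute)
    then show ?case using elim by (simp add: X_def field_simps power2_eq_square power3_eq_cube)
  qed
  ultimately have "((\<lambda>s. (s ^ 3 * ?M s - 2 * 0 + (-1) * s) / s\<^sup>2) \<longlongrightarrow> ?d) (at_right 0)"
    by (auto intro: Lim_transform_eventually)
  with 1 have "?d = 0" by (intro tendsto_unique[of "at_right 0"]) auto
  then show ?thesis by simp
qed

lemma logQ_nonneg: "t > 0 \<Longrightarrow> logQ t \<ge> 0"
  unfolding logQ_def by (intro suminf_nonneg summable_logQ) (auto simp: softplus_nonneg)

lemma logQ_measurable [measurable]: "logQ \<in> borel_measurable borel"
  unfolding logQ_def by measurable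

text \<open>The transform, multiplied by \<open>s^3\<close>, is expanded in two ways: from the
  assumed expansion of \<open>logQ\<close> as \<open>l - q * s + c * s^2 + o(s^2)\<close>, and as a
  product of known expansions. Comparing coefficients evaluates \<open>q\<close> and
  \<open>c\<close>.\<close>

lemma logQ_coefficients:
  fixes l q c :: real
  assumes l: "l = ln 2"
    and lim: "((\<lambda>t. logQ t - (l / 2 * (ln t)\<^sup>2 + q * ln t + c)) \<longlongrightarrow> 0) (at_right 0)"
  shows "q = l\<^sup>2 / 2 - 2 * euler_mascheroni * l"
    and "c = euler_mascheroni\<^sup>2 * l / 2 + pi\<^sup>2 * l / 12 - euler_mascheroni * l\<^sup>2 + l ^ 3 / 6
                - 3 * stieltjes 1 * l"
proof -
  let ?\<gamma> = "euler_mascheroni :: real"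
  define d1 where "d1 = l\<^sup>2 / 2 - 2 * ?\<gamma> * l"
  define d0 where "d0 = ?\<gamma>\<^sup>2 * l / 2 + pi\<^sup>2 * l / 12 - ?\<gamma> * l\<^sup>2 + l ^ 3 / 6 - 3 * stieltjes 1 * l"
  let ?M = "\<lambda>s. zeta_real (1 + s) ^ 3 * (1 - 2 powr (-s)) * Gamma s"
  have 1: "((\<lambda>s. (s ^ 3 * ?M s - 2 * (l / 2) + q * s) / s\<^sup>2) \<longlongrightarrow> c) (at_right 0)"
  proof (rule mellin_abelian[where G=logQ])
    show "?M s \<ge> 0" if "s > 0" for s
      using that powr_mono[of "-s" 0 2]
      by (intro mult_nonneg_nonneg zero_le_power zeta_real_nonneg Gamma_real_nonneg) auto
  qed (use lim in \<open>simp_all add: logQ_nonneg mellin_logQ\<close>)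
  have Z: "expands (\<lambda>s. s * zeta_real (1 + s)) 1 ?\<gamma> (- stieltjes 1)"
    using zeta_real_expansion by (simp add: expands_def stieltjes_0)
  have P: "expands (\<lambda>s. (1 - 2 powr (-s)) / s) l (- (l\<^sup>2 / 2)) (l ^ 3 / 6)"
  proof -
    have lpos: "l > 0" by (simp add: l)
    have "((\<lambda>x::real. ((1 - exp (-x)) / x - 1 + x / 2) / x\<^sup>2) \<longlongrightarrow> 1 / 6) (at_right 0)"
      by real_asymp
    moreover have "filterlim (\<lambda>s. l * s) (at_right 0) (at_right 0)"
      using lpos by real_asymp
    ultimately have "((\<lambda>s. ((1 - exp (-(l * s))) / (l * s) - 1 + l * s / 2) / (l * s)\<^sup>2) \<longlongrightarrow> 1 / 6) (at_right 0)"
      by (rule filterlim_compose)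
    then have "((\<lambda>s. l ^ 3 * (((1 - exp (-(l * s))) / (l * s) - 1 + l * s / 2) / (l * s)\<^sup>2)) \<longlongrightarrow> l ^ 3 * (1 / 6)) (at_right 0)"
      by (rule tendsto_mult_left)
    moreover have "\<forall>\<^sub>F s in at_right 0. l ^ 3 * (((1 - exp (-(l * s))) / (l * s) - 1 + l * s / 2) / (l * s)\<^sup>2)
        = ((1 - 2 powr (-s)) / s - l - (- (l\<^sup>2 / 2)) * s) / s\<^sup>2"
      using eventually_at_right_less[of 0]
    proof eventually_elim
      case (elim s)
      define A where "A = (1 - exp (- (l * s))) / (l * s)"
      have A: "(1 - 2 powr (-s)) / s = l * A"
        using lpos elim by (simp add: powr_def l A_def mult.commute)
      have *: "l ^ 3 * (X / (l * s)\<^sup>2) = l * X / s\<^sup>2" for X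
        using lpos elim by (simp add: power2_eq_square power3_eq_cube)
      show ?case
        unfolding A A_def[symmetric] * by (simp add: algebra_simps power2_eq_square)
    qed
    ultimately show ?thesis
      unfolding expands_def by (auto intro: Lim_transform_eventually)
  qed
  \<comment> \<open>The powers of \<open>s\<close> are distributed so that every factor is regular
    at 0: each zeta takes one \<open>s\<close>, and the zero of \<open>1 - 2 powr (-s)\<close> is
    paired with the pole of \<open>Gamma s\<close>.\<close>
  have "expands (\<lambda>s. (s * zeta_real (1 + s)) * ((s * zeta_real (1 + s)) * ((s * zeta_real (1 + s)) * (((1 - 2 powr (-s)) / s) * Gamma (1 + s)))))
     l (- d1) d0"
    by (rule expands_cong[OF expands_mult[OF Z expands_mult[OF Z expands_mult[OF Z expands_mult[OF P expands_Gamma]]]]])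
       (simp_all add: d1_def d0_def field_simps power2_eq_square power3_eq_cube)
  moreover have "\<forall>\<^sub>F s in at_right 0. ((s * zeta_real (1 + s)) * ((s * zeta_real (1 + s)) * ((s * zeta_real (1 + s)) * (((1 - 2 powr (-s)) / s) * Gamma (1 + s))))
       - l - (- d1) * s) / s\<^sup>2 = (s ^ 3 * ?M s - l + d1 * s) / s\<^sup>2"
    using eventually_at_right_less[of 0]
  proof eventually_elim
    case (elim s)
    have G: "Gamma (1 + s) = s * Gamma s"
      using Gamma_plus1[of s] elim nonpos_Ints_nonpos[of s] by (fastforce simp: add.commute)
    have "(s * Z) * ((s * Z) * ((s * Z) * ((P / s) * (s * g)))) = s ^ 3 * (Z ^ 3 * P * g)" for Z P g
      using elim by (simp add: power3_eq_cube)
    then show ?case unfolding G by simp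
  qed
  ultimately have 2: "((\<lambda>s. (s ^ 3 * ?M s - l + d1 * s) / s\<^sup>2) \<longlongrightarrow> d0) (at_right 0)"
    unfolding expands_def by (auto intro: Lim_transform_eventually)
  \<comment> \<open>In the difference of the two limits only \<open>(q - d1) / s\<close> survives;
    it can converge only if \<open>q = d1\<close>, and its limit is then 0, which gives
    \<open>c = d0\<close>.\<close>
  have 3: "((\<lambda>s. (q - d1) / s) \<longlongrightarrow> c - d0) (at_right 0)"
  proof (rule Lim_transform_eventually[OF tendsto_diff[OF 1 2]])
    show "\<forall>\<^sub>F s in at_right 0. (s ^ 3 * ?M s - 2 * (l / 2) + q * s) / s\<^sup>2 - (s ^ 3 * ?M s - l + d1 * s) / s\<^sup>2 = (q - d1) / s"
      using eventually_at_right_less[of 0]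
      by eventually_elim (simp add: field_simps power2_eq_square)
  qed
  have "((\<lambda>s. s * ((q - d1) / s)) \<longlongrightarrow> 0 * (c - d0)) (at_right 0)"
    by (intro tendsto_intros 3)
  moreover have "\<forall>\<^sub>F s in at_right 0. s * ((q - d1) / s) = q - d1"
    using eventually_at_right_less[of "0::real"] by eventually_elim simp
  ultimately have "((\<lambda>s::real. q - d1) \<longlongrightarrow> 0 * (c - d0)) (at_right 0)"
    by (rule Lim_transform_eventually)
  then have q: "q = d1" by (simp add: tendsto_const_iff)
  have "((\<lambda>s::real. 0) \<longlongrightarrow> c - d0) (at_right 0)"
    using 3 unfolding q by simp
  then have c: "c = d0" by (simp add: tendsto_const_iff)
  show "q = l\<^sup>2 / 2 - 2 * ?\<gamma> * l" 
    using q unfolding d1_def .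
  show "c = ?\<gamma>\<^sup>2 * l / 2 + pi\<^sup>2 * l / 12 - ?\<gamma> * l\<^sup>2 + l ^ 3 / 6 - 3 * stieltjes 1 * l"
    using c unfolding d0_def .
qed

section \<open>The hyperbola method\<close>

text \<open>The sum of \<open>d(m) / m\<close> over \<open>m \<le> x\<close>, with \<open>d\<close>
  the divisor function: each index \<open>n\<close> stands for one ordered factorisation of
  \<open>m = wt n\<close>.\<close>

definition wsum :: "real \<Rightarrow> real" where
  "wsum x = (\<Sum>n | real (wt n) \<le> x. 1 / real (wt n))"

definition hyp_pairs :: "real \<Rightarrow> (nat \<times> nat) set" where
  "hyp_pairs x = {(i, j). 1 \<le> i \<and> 1 \<le> j \<and> real (i * j) \<le> x}"

lemma finite_hyp_pairs: "finite (hyp_pairs x)"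
proof (rule finite_subset)
  show "hyp_pairs x \<subseteq> {..nat \<lfloor>x\<rfloor>} \<times> {..nat \<lfloor>x\<rfloor>}"
  proof
    fix p assume "p \<in> hyp_pairs x"
    then obtain i j where p: "p = (i, j)" "1 \<le> i" "1 \<le> j" "real (i * j) \<le> x"
      by (auto simp: hyp_pairs_def)
    have "i \<le> i * j" "j \<le> i * j" using p by auto
    then have "real i \<le> x" "real j \<le> x"
      using p(4) by (meson of_nat_le_iff order.trans)+
    then show "p \<in> {..nat \<lfloor>x\<rfloor>} \<times> {..nat \<lfloor>x\<rfloor>}" using p(1) by (auto simp: le_nat_floor)
  qed
qed auto

lemma bij_betw_wt_hyp_pairs:
  "bij_betw (\<lambda>n. case prod_decode n of (i, j) \<Rightarrow> (Suc i, Suc j)) {n. real (wt n) \<le> x} (hyp_pairs x)"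
proof (rule bij_betwI[where g="\<lambda>(i, j). prod_encode (i - 1, j - 1)"])
  show "(\<lambda>n. case prod_decode n of (i, j) \<Rightarrow> (Suc i, Suc j)) \<in> {n. real (wt n) \<le> x} \<rightarrow> hyp_pairs x"
    by (auto simp: wt_def hyp_pairs_def algebra_simps split: prod.splits)
  show "(\<lambda>(i, j). prod_encode (i - 1, j - 1)) \<in> hyp_pairs x \<rightarrow> {n. real (wt n) \<le> x}"
    by (auto simp: wt_def hyp_pairs_def algebra_simps split: prod.splits)
  show "(case (case prod_decode n of (i, j) \<Rightarrow> (Suc i, Suc j)) of (i, j) \<Rightarrow> prod_encode (i - 1, j - 1)) = n" for n
    by (auto split: prod.splits) (metis prod_decode_inverse)
  show "(case prod_decode (case p of (i, j) \<Rightarrow> prod_encode (i - 1, j - 1)) of (i, j) \<Rightarrow> (Suc i, Suc j)) = p"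
    if "p \<in> hyp_pairs x" for p
    using that by (auto simp: hyp_pairs_def)
qed

lemma finite_wt_le: "finite {n. real (wt n) \<le> x}"
  using bij_betw_finite[OF bij_betw_wt_hyp_pairs[of x]] finite_hyp_pairs by simp

lemma wsum_conv_pairs: "wsum x = (\<Sum>(i, j)\<in>hyp_pairs x. 1 / (real i * real j))"
proof -
  have "(\<Sum>(i, j)\<in>hyp_pairs x. 1 / (real i * real j)) =
     (\<Sum>n | real (wt n) \<le> x. case (case prod_decode n of (i, j) \<Rightarrow> (Suc i, Suc j)) of (i, j) \<Rightarrow> 1 / (real i * real j))"
    using sum.reindex_bij_betw[OF bij_betw_wt_hyp_pairs, symmetric] .
  also have "\<dots> = wsum x"
    unfolding wsum_def wt_def by (intro sum.cong) (auto split: prod.splits simp del: of_nat_Suc mult_Suc mult_Suc_right)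
  finally show ?thesis by simp
qed

text \<open>A lattice point with both coordinates above \<open>N\<close> has product larger than
  \<open>y\<^sup>2\<close>, so the region is covered by the part with \<open>i \<le> N\<close> and
  its mirror image, which overlap in the square \<open>{1..N} \<times> {1..N}\<close>. Parametrising
  by \<open>y\<^sup>2\<close> makes the cut symmetric.\<close>

lemma wsum_hyperbola:
  fixes y :: real
  assumes y: "y \<ge> 1"
  defines "N \<equiv> nat \<lfloor>y\<rfloor>"
  shows "wsum (y\<^sup>2) = 2 * (\<Sum>i=1..N. harm (nat \<lfloor>y\<^sup>2 / real i\<rfloor>) / real i) - (harm N)\<^sup>2"
proof -
  define A where "A = {(i, j) \<in> hyp_pairs (y\<^sup>2). i \<le> N}"
  define B where "B = {(i, j) \<in> hyp_pairs (y\<^sup>2). j \<le> N}"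
  let ?f = "\<lambda>(i, j). 1 / (real i * real j)"
  have N: "real N \<le> y" "y < real N + 1" using y by (auto simp: N_def)
  have "hyp_pairs (y\<^sup>2) = A \<union> B"
  proof -
    have "i \<le> N \<or> j \<le> N" if "real i * real j \<le> y\<^sup>2" for i j
    proof (rule ccontr)
      assume "\<not> (i \<le> N \<or> j \<le> N)"
      then have "y < real i" "y < real j" using N by linarith+
      then have "y * y < real i * real j" using y by (intro mult_strict_mono) auto
      then show False using that by (simp add: power2_eq_square)
    qed
    then show ?thesis by (auto simp: A_def B_def hyp_pairs_def)
  qed
  have fin: "finite A" "finite B"
    using finite_hyp_pairs[of "y\<^sup>2"] by (auto simp: A_def B_def intro: finite_subset[rotated])
  have AB: "A \<inter> B = {1..N} \<times> {1..N}"
  proof -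
    have "real (i * j) \<le> y\<^sup>2" if "i \<le> N" "j \<le> N" for i j
    proof -
      have "real i \<le> y" "real j \<le> y" using that N by linarith+
      then have "real i * real j \<le> y * y" by (intro mult_mono) (use y in auto)
      then show ?thesis by (simp add: power2_eq_square)
    qed
    then show ?thesis by (auto simp: A_def B_def hyp_pairs_def)
  qed
  have A: "A = Sigma {1..N} (\<lambda>i. {1..nat \<lfloor>y\<^sup>2 / real i\<rfloor>})"
    by (auto simp: A_def hyp_pairs_def le_nat_floor field_simps le_nat_iff le_floor_iff)
  have sA: "sum ?f A = (\<Sum>i=1..N. harm (nat \<lfloor>y\<^sup>2 / real i\<rfloor>) / real i)"
    unfolding A by (subst sum.Sigma[symmetric])
      (auto simp: harm_def sum_divide_distrib field_simps intro!: sum.cong)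
  have "B = prod.swap ` A"
    by (force simp: A_def B_def hyp_pairs_def mult.commute image_iff)
  then have sB: "sum ?f B = sum ?f A"
    by (simp only:, subst sum.reindex) (auto simp: case_prod_beta mult.commute)
  have sAB: "sum ?f (A \<inter> B) = (harm N)\<^sup>2"
    unfolding AB sum.cartesian_product[symmetric] power2_eq_square harm_def sum_product
    by (simp add: field_simps)
  have "wsum (y\<^sup>2) = sum ?f (A \<union> B)"
    using wsum_conv_pairs \<open>hyp_pairs (y\<^sup>2) = A \<union> B\<close> by simp
  also have "\<dots> = sum ?f A + sum ?f B - sum ?f (A \<inter> B)"
    using fin by (rule sum_Un)
  finally show ?thesis using sA sB sAB by simp
qed

text \<open>Two errors arise: from \<open>harm m\<close> against \<open>ln (m + 1)\<close>, at most
  \<open>1 / (2 * m)\<close>, and from \<open>ln (m + 1)\<close> against \<open>ln y\<close>, at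
  most \<open>1 / y\<close>. They have opposite signs, so they need not be added.\<close>

lemma harm_floor_bound:
  fixes y :: real
  assumes y: "y \<ge> 1"
  shows "\<bar>harm (nat \<lfloor>y\<rfloor>) - ln y - euler_mascheroni\<bar> \<le> 1 / y"
proof -
  define m where "m = nat \<lfloor>y\<rfloor>"
  have m: "real m \<le> y" "y < real m + 1" "m \<ge> 1"
    using y by (auto simp: m_def le_nat_iff)
  then obtain n where n: "m = Suc n" by (cases m) auto
  have lo: "euler_mascheroni \<ge> harm m - ln (real m + 1) + 1 / (2 * (real m + 1))"
    and up: "euler_mascheroni \<le> harm m - ln (real m + 1) + 1 / (2 * real m)"
    using euler_mascheroni_lower[of n] euler_mascheroni_upper[of n] by (simp_all add: n add_ac)
  have "ln (real m + 1) - ln y = ln ((real m + 1) / y)"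
    using m y by (simp add: ln_div)
  also have "\<dots> \<le> (real m + 1) / y - 1"
    using m y by (intro ln_le_minus_one) auto
  also have "\<dots> \<le> 1 / y" using m y by (simp add: field_simps)
  finally have d1: "ln (real m + 1) - ln y \<le> 1 / y" .
  have d2: "ln (real m + 1) \<ge> ln y" using m y by auto
  have "1 / (2 * real m) \<le> 1 / y"
  proof (rule divide_left_mono)
    have "1 \<le> real m" using m(3) by simp
    then show "y \<le> 2 * real m" using m(2) by linarith
  qed (use m y in auto)
  moreover have "0 \<le> 1 / (2 * (real m + 1))" by simp
  ultimately show ?thesis
    unfolding m_def[symmetric] using lo up d1 d2 by linarith
qed

text \<open>Consecutive differences are of order \<open>ln k / k^2\<close>, hence summable; the
  exponent \<open>-3/2\<close> merely leaves room for the logarithm. The limit is not evaluated: it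
  enters the constant term of the expansion of \<open>logQ\<close>, which
  \<open>logQ_coefficients\<close> determines.\<close>

lemma sum_ln_over_asymp:
  "\<exists>c. ((\<lambda>y::real. (\<Sum>i=1..nat \<lfloor>y\<rfloor>. ln (real i) / real i) - (ln y)\<^sup>2 / 2) \<longlongrightarrow> c) at_top"
proof -
  define a where "a n = (\<Sum>i=1..n. ln (real i) / real i) - (ln (real n))\<^sup>2 / 2" for n
  have "summable (\<lambda>k. a (Suc k) - a k)"
  proof (rule summable_comparison_test_bigo)
    show "summable (\<lambda>k. norm (real k powr (-3/2)))"
      by (simp add: summable_real_powr_iff)
    have "\<forall>\<^sub>F k in sequentially. a (Suc k) - a k = ln (real k) * (1 / (real k + 1) - ln (1 + 1 / real k))
        + ln (1 + 1 / real k) / (real k + 1) - (ln (1 + 1 / real k))\<^sup>2 / 2"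
      using eventually_gt_at_top[of 0]
    proof eventually_elim
      case (elim k)
      have "1 + 1 / real k = (real k + 1) / real k" using elim by (simp add: field_simps)
      then have "ln (real k + 1) = ln (real k) + ln (1 + 1 / real k)"
        using elim by (simp add: ln_div)
      then show ?case
        by (simp add: a_def algebra_simps power2_eq_square add_divide_distrib diff_divide_distrib)
    qed
    moreover have "(\<lambda>k. ln (real k) * (1 / (real k + 1) - ln (1 + 1 / real k))
        + ln (1 + 1 / real k) / (real k + 1) - (ln (1 + 1 / real k))\<^sup>2 / 2) \<in> O(\<lambda>k. real k powr (-3/2))"
      by real_asymp
    ultimately show "(\<lambda>k. a (Suc k) - a k) \<in> O(\<lambda>k. real k powr (-3/2))"
      by (subst landau_o.big.in_cong)
  qed
  then have "convergent (\<lambda>n. a n - a 0)"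
    by (simp add: summable_iff_convergent sum_lessThan_telescope)
  then obtain c0 where "(\<lambda>n. a n - a 0) \<longlonglongrightarrow> c0"
    by (auto simp: convergent_def)
  then have "(\<lambda>n. (a n - a 0) + a 0) \<longlonglongrightarrow> c0 + a 0"
    by (intro tendsto_intros)
  then have "a \<longlonglongrightarrow> c0 + a 0" by simp
  moreover have "filterlim (\<lambda>y::real. nat \<lfloor>y\<rfloor>) sequentially at_top"
    by (intro filterlim_compose[OF filterlim_nat_sequentially] filterlim_floor_sequentially)
  ultimately have "((\<lambda>y::real. a (nat \<lfloor>y\<rfloor>)) \<longlongrightarrow> c0 + a 0) at_top"
    by (rule filterlim_compose)
  moreover have "((\<lambda>y::real. (ln (of_int \<lfloor>y\<rfloor>))\<^sup>2 / 2 - (ln y)\<^sup>2 / 2) \<longlongrightarrow> 0) at_top"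
    by real_asymp
  ultimately have "((\<lambda>y::real. a (nat \<lfloor>y\<rfloor>) + ((ln (of_int \<lfloor>y\<rfloor>))\<^sup>2 / 2 - (ln y)\<^sup>2 / 2)) \<longlongrightarrow> c0 + a 0 + 0) at_top"
    by (intro tendsto_intros)
  moreover have "\<forall>\<^sub>F y::real in at_top. a (nat \<lfloor>y\<rfloor>) + ((ln (of_int \<lfloor>y\<rfloor>))\<^sup>2 / 2 - (ln y)\<^sup>2 / 2)
      = (\<Sum>i=1..nat \<lfloor>y\<rfloor>. ln (real i) / real i) - (ln y)\<^sup>2 / 2"
    using eventually_ge_at_top[of 1] by eventually_elim (simp add: a_def)
  ultimately show ?thesis
    by (blast intro: Lim_transform_eventually)
qed

text \<open>Each harmonic number in \<open>wsum_hyperbola\<close> is replaced by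
  \<open>ln + \<gamma>\<close>. For \<open>i \<le> y\<close> the replacement in the
  \<open>i\<close>-th term costs at most \<open>(i / y\<^sup>2) / i = 1 / y\<^sup>2\<close>, so all
  of them together cost at most \<open>1 / y\<close>.\<close>

lemma wsum_asymp:
  "\<exists>c. ((\<lambda>x. wsum x - ((ln x)\<^sup>2 / 2 + 2 * euler_mascheroni * ln x + c)) \<longlongrightarrow> 0) at_top"
proof -
  let ?\<gamma> = "euler_mascheroni :: real"
  define T where "T y = (\<Sum>i=1..nat \<lfloor>y\<rfloor>. ln (real i) / real i)" for y :: real
  obtain c1 where c1: "((\<lambda>y. T y - (ln y)\<^sup>2 / 2) \<longlongrightarrow> c1) at_top"
    using sum_ln_over_asymp unfolding T_def by blast
  define h :: "real \<Rightarrow> real" where "h y = harm (nat \<lfloor>y\<rfloor>)" for y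
  define e where "e y = h y - ln y - ?\<gamma>" for y :: real
  \<comment> \<open>\<open>S\<close> collects the replacement errors: the subtracted expression is
    the same sum with \<open>ln (y\<^sup>2 / i) + \<gamma>\<close> in place of the harmonic
    numbers.\<close>
  define S where "S y = (\<Sum>i=1..nat \<lfloor>y\<rfloor>. h (y\<^sup>2 / real i) / real i) - ((2 * ln y + ?\<gamma>) * h y - T y)" for y :: real
  have e: "\<bar>e y\<bar> \<le> 1 / y" if "y \<ge> 1" for y
    using harm_floor_bound[OF that] by (simp add: e_def h_def)
  have S: "\<bar>S y\<bar> \<le> 1 / y" if y: "y \<ge> 1" for y
  proof -
    have N: "real (nat \<lfloor>y\<rfloor>) \<le> y" using y by auto
    have "(2 * ln y + ?\<gamma>) * h y - T y = (\<Sum>i=1..nat \<lfloor>y\<rfloor>. (ln (y\<^sup>2 / real i) + ?\<gamma>) / real i)"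
    proof -
      have "(\<Sum>i=1..nat \<lfloor>y\<rfloor>. (ln (y\<^sup>2 / real i) + ?\<gamma>) / real i) =
         (\<Sum>i=1..nat \<lfloor>y\<rfloor>. (2 * ln y + ?\<gamma>) * inverse (real i) - ln (real i) / real i)"
        using y by (intro sum.cong) (auto simp: ln_div ln_realpow field_simps)
      then show ?thesis
        by (simp add: T_def h_def harm_def sum_subtractf sum_distrib_left)
    qed
    then have "S y = (\<Sum>i=1..nat \<lfloor>y\<rfloor>. e (y\<^sup>2 / real i) / real i)"
      unfolding S_def e_def by (simp add: sum_subtractf[symmetric] diff_divide_distrib add_divide_distrib algebra_simps)
    then have "\<bar>S y\<bar> \<le> (\<Sum>i=1..nat \<lfloor>y\<rfloor>. \<bar>e (y\<^sup>2 / real i) / real i\<bar>)"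
      by (simp only: sum_abs)
    also have "\<dots> \<le> (\<Sum>i=1..nat \<lfloor>y\<rfloor>. 1 / y\<^sup>2)"
    proof (rule sum_mono)
      fix i assume i: "i \<in> {1..nat \<lfloor>y\<rfloor>}"
      then have i': "real i \<le> y" "i \<ge> 1" using N by auto
      have "real i \<le> y\<^sup>2" using i' y by (metis order.trans power2_eq_square mult_left_le_imp_le self_le_power order_less_imp_le zero_less_numeral)
      then have "\<bar>e (y\<^sup>2 / real i)\<bar> \<le> 1 / (y\<^sup>2 / real i)"
        using i' by (intro e) (simp add: field_simps)
      then have "\<bar>e (y\<^sup>2 / real i)\<bar> / real i \<le> 1 / (y\<^sup>2 / real i) / real i"
        by (intro divide_right_mono) auto
      then show "\<bar>e (y\<^sup>2 / real i) / real i\<bar> \<le> 1 / y\<^sup>2"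
        using i' by (simp add: abs_divide)
    qed
    also have "\<dots> = real (nat \<lfloor>y\<rfloor>) / y\<^sup>2" by simp
    also have "\<dots> \<le> y / y\<^sup>2" using N by (intro divide_right_mono) auto
    also have "\<dots> = 1 / y" using y by (simp add: power2_eq_square)
    finally show ?thesis .
  qed
  have S_lim: "(S \<longlongrightarrow> 0) at_top"
    by (rule Lim_null_comparison[of _ "\<lambda>y. 1 / y"])
       (use S in \<open>auto intro!: eventually_mono[OF eventually_ge_at_top[of 1]]\<close>, real_asymp)
  have e_lim: "(e \<longlongrightarrow> 0) at_top"
    by (rule Lim_null_comparison[of _ "\<lambda>y. 1 / y"])
       (use e in \<open>auto intro!: eventually_mono[OF eventually_ge_at_top[of 1]]\<close>, real_asymp)
  have el_lim: "((\<lambda>y. e y * ln y) \<longlongrightarrow> 0) at_top"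
  proof (rule Lim_null_comparison[of _ "\<lambda>y. 1 / y * ln y"])
    show "\<forall>\<^sub>F y in at_top. norm (e y * ln y) \<le> 1 / y * ln y"
      using eventually_ge_at_top[of 1]
      by eventually_elim (use e in \<open>auto simp: abs_mult simp del: times_divide_eq_left intro!: mult_right_mono\<close>)
    show "((\<lambda>y::real. 1 / y * ln y) \<longlongrightarrow> 0) at_top" by real_asymp
  qed
  \<comment> \<open>With \<open>ln y\<close> written as \<open>Y\<close>, the main terms are
    \<open>2 * (2 * Y + \<gamma>) * (Y + \<gamma>) - 2 * (Y^2 / 2 + c1) - (Y + \<gamma>)^2 = 2 * Y^2
    + 4 * \<gamma> * Y + c\<close>.\<close>
  define c where "c = ?\<gamma>\<^sup>2 - 2 * c1"
  have "((\<lambda>y. 2 * S y + 2 * (e y * ln y) - (e y)\<^sup>2 - 2 * ((T y - (ln y)\<^sup>2 / 2) - c1))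
      \<longlongrightarrow> 2 * 0 + 2 * 0 - 0\<^sup>2 - 2 * (c1 - c1)) at_top"
    by (intro tendsto_intros S_lim e_lim el_lim c1)
  then have "((\<lambda>y. 2 * S y + 2 * (e y * ln y) - (e y)\<^sup>2 - 2 * ((T y - (ln y)\<^sup>2 / 2) - c1)) \<longlongrightarrow> 0) at_top"
    by simp
  moreover have "\<forall>\<^sub>F y in at_top. 2 * S y + 2 * (e y * ln y) - (e y)\<^sup>2 - 2 * ((T y - (ln y)\<^sup>2 / 2) - c1)
     = wsum (y\<^sup>2) - ((ln (y\<^sup>2))\<^sup>2 / 2 + 2 * ?\<gamma> * ln (y\<^sup>2) + c)"
    using eventually_ge_at_top[of 1]
  proof eventually_elim
    case (elim y)
    have hy: "h y = ln y + ?\<gamma> + e y" by (simp add: e_def)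
    have "wsum (y\<^sup>2) = 2 * (S y + ((2 * ln y + ?\<gamma>) * h y - T y)) - (h y)\<^sup>2"
      using wsum_hyperbola[OF elim] by (simp add: S_def h_def)
    moreover have "ln (y\<^sup>2) = 2 * ln y" using elim by (simp add: ln_realpow)
    ultimately show ?case unfolding hy c_def by (simp add: algebra_simps power2_eq_square)
  qed
  ultimately have "((\<lambda>y. wsum (y\<^sup>2) - ((ln (y\<^sup>2))\<^sup>2 / 2 + 2 * ?\<gamma> * ln (y\<^sup>2) + c)) \<longlongrightarrow> 0) at_top"
    by (rule Lim_transform_eventually)
  from filterlim_compose[OF this sqrt_at_top]
  have "((\<lambda>x. wsum ((sqrt x)\<^sup>2) - ((ln ((sqrt x)\<^sup>2))\<^sup>2 / 2 + 2 * ?\<gamma> * ln ((sqrt x)\<^sup>2) + c)) \<longlongrightarrow> 0) at_top" .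
  moreover have "\<forall>\<^sub>F x in at_top. wsum ((sqrt x)\<^sup>2) - ((ln ((sqrt x)\<^sup>2))\<^sup>2 / 2 + 2 * ?\<gamma> * ln ((sqrt x)\<^sup>2) + c)
      = wsum x - ((ln x)\<^sup>2 / 2 + 2 * ?\<gamma> * ln x + c)"
    using eventually_ge_at_top[of 0] by eventually_elim simp
  ultimately show ?thesis
    by (blast intro: Lim_transform_eventually)
qed

section \<open>Asymptotics of weighted sums\<close>

lemma integral_halfline_FTC:
  fixes f F :: "real \<Rightarrow> real"
  assumes F: "\<And>x. x > a \<Longrightarrow> (F has_real_derivative f x) (at x)"
    and f: "\<And>x. x > a \<Longrightarrow> isCont f x"
    and int: "integrable lborel (\<lambda>x. indicator {a<..} x * f x)"
    and A: "(F \<longlongrightarrow> A) (at_right a)" and B: "(F \<longlongrightarrow> B) at_top"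
  shows "(LINT x|lborel. indicator {a<..} x * f x) = B - A"
proof -
  have e: "einterval (ereal a) \<infinity> = {a<..}"
    by (auto simp: einterval_def)
  have "(LBINT x=ereal a..\<infinity>. f x) = B - A"
  proof (rule interval_integral_FTC_integrable[where F=F])
    show "(F has_vector_derivative f x) (at x)" if "ereal a < ereal x" for x
      using F[of x] that by (simp add: has_real_derivative_iff_has_vector_derivative)
    show "set_integrable lborel (einterval (ereal a) \<infinity>) f"
      using int by (simp add: e set_integrable_def)
  qed (use A B f in \<open>auto simp: ereal_tendsto_simps\<close>)
  then show ?thesis
    by (simp add: interval_lebesgue_integral_def set_lebesgue_integral_def e)
qed

lemma integrable_halfline_FTC_nonneg:
  fixes f F :: "real \<Rightarrow> real"
  assumes F: "\<And>x. x > a \<Longrightarrow> (F has_real_derivative f x) (at x)"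
    and f: "\<And>x. x > a \<Longrightarrow> isCont f x" and nonneg: "\<And>x. x > a \<Longrightarrow> f x \<ge> 0"
    and A: "(F \<longlongrightarrow> A) (at_right a)" and B: "(F \<longlongrightarrow> B) at_top"
  shows "integrable lborel (\<lambda>x. indicator {a<..} x * f x)"
proof -
  have e: "einterval (ereal a) \<infinity> = {a<..}"
    by (auto simp: einterval_def)
  have "set_integrable lborel (einterval (ereal a) \<infinity>) f"
    by (rule interval_integral_FTC_nonneg(1)[of "ereal a" "\<infinity>" F f A B])
       (use assms in \<open>auto simp: ereal_tendsto_simps AE_I2\<close>)
  then show ?thesis by (simp add: e set_integrable_def)
qed

text \<open>The common majorant of all integrals below: it allows a squared logarithm at 0, coming
  from the quadratic polynomial in \<open>wsum_asymp\<close>, against exponential decay at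
  infinity.\<close>

lemma integrable_ln_sq_exp:
  "integrable lborel (\<lambda>u::real. indicator {0<..} u * ((1 + (ln u)\<^sup>2) * exp (- u / 2)))"
proof (rule Bochner_Integration.integrable_bound)
  have 1: "integrable lborel (\<lambda>u::real. indicator {0<..} u * ((1 + u\<^sup>2) * exp (- u / 2)))"
  proof (rule integrable_halfline_FTC_nonneg[where F="\<lambda>u. - (2 * u\<^sup>2 + 8 * u + 18) * exp (- u / 2)"])
    show "((\<lambda>u::real. - (2 * u\<^sup>2 + 8 * u + 18) * exp (- u / 2)) \<longlongrightarrow> - 18) (at_right 0)" by real_asymp
    show "((\<lambda>u::real. - (2 * u\<^sup>2 + 8 * u + 18) * exp (- u / 2)) \<longlongrightarrow> 0) at_top" by real_asymp
  qed (auto intro!: derivative_eq_intros continuous_intros simp: algebra_simps power2_eq_square)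
  have 2: "integrable lborel (\<lambda>u::real. indicator {0<..<1} u * ((ln u)\<^sup>2 * u powr (1 - 1)))"
    using integral_ln_power_powr(5)[of 1] unfolding set_integrable_def by simp
  show "integrable lborel (\<lambda>u::real. indicator {0<..} u * ((1 + u\<^sup>2) * exp (- u / 2)) + indicator {0<..<1} u * ((ln u)\<^sup>2 * u powr (1 - 1)))"
    using 1 2 by (rule Bochner_Integration.integrable_add)
  show "AE u in lborel. norm (indicator {0<..} u * ((1 + (ln u)\<^sup>2) * exp (- u / 2)))
     \<le> norm (indicator {0<..} u * ((1 + u\<^sup>2) * exp (- u / 2)) + indicator {0<..<1} u * ((ln u)\<^sup>2 * u powr (1 - 1)) :: real)"
  proof (rule AE_I2)
    fix u :: real
    consider "u \<le> 0" | "0 < u" "u < 1" | "u \<ge> 1" by linarith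
    then show "norm (indicator {0<..} u * ((1 + (ln u)\<^sup>2) * exp (- u / 2)))
       \<le> norm (indicator {0<..} u * ((1 + u\<^sup>2) * exp (- u / 2)) + indicator {0<..<1} u * ((ln u)\<^sup>2 * u powr (1 - 1)) :: real)"
    proof cases
      case 2
      have "(ln u)\<^sup>2 * exp (- u / 2) \<le> (ln u)\<^sup>2 * 1" using 2 by (intro mult_left_mono) auto
      moreover have "0 \<le> u\<^sup>2 * exp (- u / 2)" by simp
      ultimately have "(1 + (ln u)\<^sup>2) * exp (- u / 2) \<le> (1 + u\<^sup>2) * exp (- u / 2) + (ln u)\<^sup>2"
        unfolding distrib_right by linarith
      then show ?thesis using 2 by (simp add: abs_mult)
    next
      case 3
      have "(ln u)\<^sup>2 \<le> u\<^sup>2" using 3 ln_bound[of u] by (intro power_mono) auto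
      then have "(1 + (ln u)\<^sup>2) * exp (- u / 2) \<le> (1 + u\<^sup>2) * exp (- u / 2)"
        by (intro mult_right_mono) auto
      then show ?thesis using 3 by (simp add: abs_mult)
    qed auto
  qed
qed auto

lemma abs_le_one_plus_square: "\<bar>X\<bar> \<le> 1 + X\<^sup>2" for X :: real
  using sum_squares_bound[of 1 "\<bar>X\<bar>"] by (simp add: power2_eq_square)

lemma wsum_nonneg: "wsum x \<ge> 0"
  unfolding wsum_def by (intro sum_nonneg) auto

lemma wsum_mono: "x \<le> y \<Longrightarrow> wsum x \<le> wsum y"
  unfolding wsum_def by (intro sum_mono2 finite_wt_le) auto

lemma wsum_measurable [measurable]: "wsum \<in> borel_measurable borel"
  by (intro borel_measurable_mono monoI wsum_mono)

lemma wsum_eq_0: "x < 1 \<Longrightarrow> wsum x = 0"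
proof -
  assume x: "x < 1"
  have "real (wt n) \<ge> 1" for n using wt_pos[of n] by (simp add: Suc_le_eq)
  then have "{n. real (wt n) \<le> x} = {}" using x by (auto simp: not_le intro: less_le_trans)
  then show ?thesis by (simp add: wsum_def)
qed

text \<open>What summation by parts requires of a weight. The instances are \<open>softplus\<close>,
  \<open>u * sp1 u\<close> and \<open>u\<^sup>2 * sp2 u\<close> for the Taylor coefficients of
  orders 0, 1, 2, \<open>u ^ 3 * exp (-u)\<close> for the Taylor remainder, and a primitive of the
  majorant \<open>exp (- u / 2)\<close> itself. Asking for this rate rather than
  \<open>exp (-u)\<close> absorbs polynomial factors in \<open>u\<close>.\<close>

locale weight_fun =
  fixes \<psi> \<psi>' :: "real \<Rightarrow> real" and C \<psi>0 :: real
  assumes deriv: "\<And>u. u > 0 \<Longrightarrow> (\<psi> has_real_derivative \<psi>' u) (at u)"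
    and cont: "\<And>u. u > 0 \<Longrightarrow> isCont \<psi>' u"
    and bound: "\<And>u. u > 0 \<Longrightarrow> \<bar>\<psi>' u\<bar> \<le> C * exp (- u / 2)"
    and at_inf: "(\<psi> \<longlongrightarrow> 0) at_top"
    and at_zero: "(\<psi> \<longlongrightarrow> \<psi>0) (at_right 0)"
begin

definition p :: "real \<Rightarrow> real" where "p u = indicator {0<..} u * \<psi>' u"

lemma p_measurable [measurable]: "p \<in> borel_measurable borel"
proof -
  have "(\<lambda>u. indicator {0<..} u *\<^sub>R \<psi>' u) \<in> borel_measurable borel"
    by (intro borel_measurable_continuous_on_indicator continuous_at_imp_continuous_on) (auto simp: cont)
  then show ?thesis by (simp add: p_def[abs_def])
qed

lemma p_bound: "\<bar>p u\<bar> \<le> C * (indicator {0<..} u * exp (- u / 2))"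
  using bound[of u] by (auto simp: p_def indicator_def)

lemma integrable_p_times:
  assumes [measurable]: "g \<in> borel_measurable borel"
    and g: "\<And>u. u > 0 \<Longrightarrow> \<bar>g u\<bar> \<le> K * (1 + (ln u)\<^sup>2)"
  shows "integrable lborel (\<lambda>u. g u * p u)"
proof (rule Bochner_Integration.integrable_bound)
  show "integrable lborel (\<lambda>u. K * C * (indicator {0<..} u * ((1 + (ln u)\<^sup>2) * exp (- u / 2))))"
    using integrable_ln_sq_exp by (rule integrable_mult_right)
  show "AE u in lborel. norm (g u * p u) \<le> norm (K * C * (indicator {0<..} u * ((1 + (ln u)\<^sup>2) * exp (- u / 2))))"
  proof (rule AE_I2)
    fix u :: real
    show "norm (g u * p u) \<le> norm (K * C * (indicator {0<..} u * ((1 + (ln u)\<^sup>2) * exp (- u / 2))))"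
    proof (cases "u > 0")
      case True
      have "\<bar>g u\<bar> * \<bar>p u\<bar> \<le> (K * (1 + (ln u)\<^sup>2)) * (C * exp (- u / 2))"
        using g[OF True] p_bound[of u] True abs_ge_zero[of "g u"] by (intro mult_mono) (auto intro: order.trans)
      also have "\<dots> \<le> \<bar>(K * (1 + (ln u)\<^sup>2)) * (C * exp (- u / 2))\<bar>" by simp
      finally show ?thesis using True by (simp add: abs_mult mult_ac)
    qed (auto simp: p_def)
  qed
qed auto

lemma integrable_tail: "integrable lborel (\<lambda>u. indicator {a<..} u * p u)"
  by (rule integrable_p_times[where K=1]) (auto simp: indicator_def)

lemma tail_integral:
  assumes a: "a > 0"
  shows "\<psi> a = - (LINT u|lborel. indicator {a<..} u * p u)"
proof -
  have eq: "(\<lambda>u. indicator {a<..} u * p u) = (\<lambda>u. indicator {a<..} u * \<psi>' u)"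
    using a by (auto simp: p_def indicator_def)
  have "(LINT u|lborel. indicator {a<..} u * \<psi>' u) = 0 - \<psi> a"
  proof (rule integral_halfline_FTC[where F=\<psi>])
    show "integrable lborel (\<lambda>u. indicator {a<..} u * \<psi>' u)"
      using integrable_tail[of a] unfolding eq .
    show "(\<psi> \<longlongrightarrow> \<psi> a) (at_right a)"
      using DERIV_isCont[OF deriv[OF a]] by (auto simp: isCont_def intro: tendsto_mono[OF at_le])
  qed (use a deriv cont at_inf in auto)
  then show ?thesis unfolding eq by simp
qed

lemma integral_p: "(LINT u|lborel. p u) = - \<psi>0"
proof -
  have "(LINT u|lborel. indicator {0<..} u * \<psi>' u) = 0 - \<psi>0"
  proof (rule integral_halfline_FTC[where F=\<psi>])
    show "integrable lborel (\<lambda>u. indicator {0<..} u * \<psi>' u)"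
      using integrable_p_times[of "\<lambda>_. 1" 1] by (simp add: p_def[abs_def])
  qed (use deriv cont at_inf at_zero in auto)
  then show ?thesis by (simp add: p_def[abs_def])
qed

end

text \<open>The derivative here is the majorant in \<open>bound\<close>, so
  \<open>tail_integral\<close> for this instance evaluates the tails that dominate those of any
  other instance.\<close>

lemma weight_fun_exp: "weight_fun (\<lambda>u. - 2 * exp (- u / 2)) (\<lambda>u. exp (- u / 2)) 1 (-2)"
proof
  show "((\<lambda>u::real. - 2 * exp (- u / 2)) \<longlongrightarrow> 0) at_top" by real_asymp
  show "((\<lambda>u::real. - 2 * exp (- u / 2)) \<longlongrightarrow> -2) (at_right 0)" by real_asymp
qed (auto intro!: derivative_eq_intros continuous_intros)

context weight_fun
begin

text \<open>Summation by parts: write \<open>\<psi> a\<close> as an integral of \<open>\<psi>'\<close> over \<open>{a<..}\<close> and exchange sum and integral.\<close>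

lemma weighted_sums_integral:
  assumes r: "r > 0"
  shows "(\<lambda>n. \<psi> (real (wt n) * r) / real (wt n)) sums (- (LINT u|lborel. wsum (u / r) * p u))"
proof -
  interpret E: weight_fun "\<lambda>u. - 2 * exp (- u / 2)" "\<lambda>u. exp (- u / 2)" 1 "-2"
    by (rule weight_fun_exp)
  define f where "f n u = 1 / real (wt n) * (indicator {real (wt n) * r<..} u * p u)" for n u
  \<comment> \<open>The tails \<open>{wt n * r<..}\<close> are open while \<open>wsum\<close> counts
    \<open>wt n \<le> u / r\<close>; the two differ only at the countably many jump points.\<close>
  have ae: "AE u in lborel. u \<notin> range (\<lambda>n. real (wt n) * r)"
    by (rule AE_not_in) (intro countable_imp_null_set_lborel countable_image, auto)
  have fin: "finite {n. real (wt n) * r < u}" for u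
    by (rule finite_subset[OF _ finite_wt_le[of "u / r"]]) (use r in \<open>auto simp: field_simps\<close>)
  have f_int: "integrable lborel (f n)" for n
    unfolding f_def by (intro integrable_mult_right integrable_tail)
  have norm_bound: "(LINT u|lborel. norm (f n u)) \<le> 2 * C * exp (- (real (wt n) * (r / 2)))" for n
  proof -
    let ?a = "real (wt n) * r"
    have a: "?a > 0" using r by simp
    have "(LINT u|lborel. norm (f n u)) \<le> (LINT u|lborel. C * (indicator {?a<..} u * E.p u))"
    proof (rule integral_mono)
      show "integrable lborel (\<lambda>u. norm (f n u))" using f_int by (rule integrable_norm)
      show "integrable lborel (\<lambda>u. C * (indicator {?a<..} u * E.p u))"
        by (intro integrable_mult_right E.integrable_tail)
      fix u
      have "norm (f n u) = \<bar>indicator {?a<..} u * p u\<bar> / real (wt n)"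
        by (simp add: f_def abs_mult)
      also have "\<dots> \<le> \<bar>indicator {?a<..} u * p u\<bar>" by (rule wt_div_le) simp
      also have "\<dots> \<le> C * (indicator {?a<..} u * E.p u)"
        unfolding E.p_def using p_bound[of u] a by (auto simp: indicator_def)
      finally show "norm (f n u) \<le> C * (indicator {?a<..} u * E.p u)" .
    qed
    also have "\<dots> = C * (2 * exp (- ?a / 2))"
      using E.tail_integral[OF a] by simp
    finally show ?thesis by (simp add: mult_ac)
  qed
  have "(\<lambda>n. integral\<^sup>L lborel (f n)) sums (LINT u|lborel. (\<Sum>n. f n u))"
  proof (rule sums_integral[OF f_int])
    show "AE u in lborel. summable (\<lambda>n. norm (f n u))"
    proof (rule AE_I2)
      fix u show "summable (\<lambda>n. norm (f n u))"
        by (rule summable_finite[OF fin[of u]]) (auto simp: f_def)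
    qed
    show "summable (\<lambda>n. LINT u|lborel. norm (f n u))"
    proof (rule summable_comparison_test'[where N=0])
      show "summable (\<lambda>n. 2 * C * exp (- (real (wt n) * (r / 2))))"
        using r by (intro summable_mult summable_exp_wt) auto
    qed (use norm_bound in auto)
  qed
  moreover have "(LINT u|lborel. (\<Sum>n. f n u)) = (LINT u|lborel. wsum (u / r) * p u)"
  proof (rule integral_cong_AE)
    show "AE u in lborel. (\<Sum>n. f n u) = wsum (u / r) * p u"
      using ae
    proof eventually_elim
      case (elim u)
      have "{n. real (wt n) * r < u} = {n. real (wt n) \<le> u / r}"
        using elim r by (force simp: field_simps order.order_iff_strict)
      moreover have "(\<Sum>n. f n u) = (\<Sum>n | real (wt n) * r < u. f n u)"
        by (rule suminf_finite[OF fin[of u]]) (auto simp: f_def)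
      moreover have "\<dots> = (\<Sum>n | real (wt n) * r < u. 1 / real (wt n) * p u)"
        by (intro sum.cong) (auto simp: f_def)
      ultimately show ?case
        by (simp add: wsum_def sum_distrib_right)
    qed
    show "(\<lambda>u. \<Sum>n. f n u) \<in> borel_measurable lborel"
      unfolding f_def by measurable
  qed measurable
  moreover have "integral\<^sup>L lborel (f n) = - (\<psi> (real (wt n) * r) / real (wt n))" for n
    unfolding f_def using r by (simp add: tail_integral)
  ultimately have "(\<lambda>n. - (\<psi> (real (wt n) * r) / real (wt n))) sums (LINT u|lborel. wsum (u / r) * p u)"
    by simp
  from sums_minus[OF this] show ?thesis by simp
qed

text \<open>In the integral of \<open>wsum (u / r) * p u\<close> the quadratic polynomial in
  \<open>ln u - ln r\<close> integrates term by term. Since \<open>p\<close> has integral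
  \<open>- \<psi>0\<close>, the coefficient of \<open>(ln r)\<^sup>2\<close> is explicit; that of
  \<open>ln r\<close> still contains the integral of \<open>ln u * p u\<close>. The error of
  \<open>wsum_asymp\<close> disappears by dominated convergence.\<close>

lemma weighted_sum_asymp:
  "\<exists>c. ((\<lambda>r. (\<Sum>n. \<psi> (real (wt n) * r) / real (wt n))
      - (\<psi>0 / 2 * (ln r)\<^sup>2 + ((LINT u|lborel. ln u * p u) - 2 * euler_mascheroni * \<psi>0) * ln r + c)) \<longlongrightarrow> 0) (at_right 0)"
proof -
  let ?\<gamma> = "euler_mascheroni :: real"
  obtain c where c: "((\<lambda>x. wsum x - ((ln x)\<^sup>2 / 2 + 2 * ?\<gamma> * ln x + c)) \<longlongrightarrow> 0) at_top"
    using wsum_asymp by blast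
  define E where "E x = wsum x - ((ln x)\<^sup>2 / 2 + 2 * ?\<gamma> * ln x + c)" for x
  have E_lim: "(E \<longlongrightarrow> 0) at_top" using c by (simp add: E_def[abs_def])
  have [measurable]: "E \<in> borel_measurable borel" unfolding E_def by measurable
  have quad: "\<bar>X\<^sup>2 / 2 + 2 * ?\<gamma> * X + c\<bar> \<le> (1 + 2 * ?\<gamma> + \<bar>c\<bar>) * (1 + X\<^sup>2)" for X
  proof -
    have "\<bar>2 * ?\<gamma> * X\<bar> \<le> 2 * ?\<gamma> * (1 + X\<^sup>2)"
      using euler_mascheroni_pos abs_le_one_plus_square[of X] by (simp add: abs_mult)
    moreover have "\<bar>X\<^sup>2 / 2\<bar> \<le> 1 * (1 + X\<^sup>2)" by simp
    moreover have "\<bar>c\<bar> \<le> \<bar>c\<bar> * (1 + X\<^sup>2)" by (simp add: algebra_simps)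
    ultimately have "\<bar>X\<^sup>2 / 2 + 2 * ?\<gamma> * X + c\<bar> \<le> 1 * (1 + X\<^sup>2) + 2 * ?\<gamma> * (1 + X\<^sup>2) + \<bar>c\<bar> * (1 + X\<^sup>2)"
      by linarith
    then show ?thesis by (simp add: algebra_simps)
  qed
  \<comment> \<open>Below 1 \<open>wsum\<close> vanishes, so \<open>E\<close> is minus the quadratic
    polynomial and unbounded at 0. From 1 on it is bounded: it is small beyond \<open>X\<close>, and
    up to \<open>X\<close> monotonicity of \<open>wsum\<close> controls it.\<close>
  obtain K where K: "K \<ge> 0" "\<And>x. x \<ge> 1 \<Longrightarrow> \<bar>E x\<bar> \<le> K" "\<And>x. 0 < x \<Longrightarrow> x < 1 \<Longrightarrow> \<bar>E x\<bar> \<le> K * (1 + (ln x)\<^sup>2)"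
  proof -
    obtain X where X: "\<And>x. x \<ge> X \<Longrightarrow> \<bar>E x\<bar> < 1"
      using tendstoD[OF E_lim, of 1] by (auto simp: eventually_at_top_linorder dist_real_def)
    define K0 where "K0 = 1 + 2 * ?\<gamma> + \<bar>c\<bar>"
    have K0: "K0 \<ge> 1" using euler_mascheroni_pos by (simp add: K0_def)
    define K where "K = 1 + wsum X + K0 * (1 + (ln (max X 1))\<^sup>2)"
    have "K0 \<le> K" unfolding K_def using wsum_nonneg[of X] K0 by (simp add: algebra_simps)
    show ?thesis
    proof
      show "K \<ge> 0" using \<open>K0 \<le> K\<close> K0 by linarith
      show "\<bar>E x\<bar> \<le> K" if "x \<ge> 1" for x
      proof (cases "x \<ge> X")
        case True
        then show ?thesis using X[of x] \<open>K0 \<le> K\<close> K0 by linarith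
      next
        case False
        have "(ln x)\<^sup>2 \<le> (ln (max X 1))\<^sup>2" using that False by (intro power_mono) auto
        then have "K0 * (1 + (ln x)\<^sup>2) \<le> K0 * (1 + (ln (max X 1))\<^sup>2)"
          using K0 by (intro mult_left_mono) auto
        moreover have "\<bar>wsum x\<bar> \<le> wsum X" using wsum_nonneg[of x] wsum_mono[of x X] False by simp
        ultimately show ?thesis
          using quad[of "ln x"] unfolding E_def K_def K0_def[symmetric] by linarith
      qed
      show "\<bar>E x\<bar> \<le> K * (1 + (ln x)\<^sup>2)" if "0 < x" "x < 1" for x
      proof -
        have "\<bar>E x\<bar> \<le> K0 * (1 + (ln x)\<^sup>2)"
          using quad[of "ln x"] that by (simp add: E_def wsum_eq_0 K0_def)
        also have "\<dots> \<le> K * (1 + (ln x)\<^sup>2)" using \<open>K0 \<le> K\<close> by (intro mult_right_mono) auto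
        finally show ?thesis .
      qed
    qed
  qed
  \<comment> \<open>For \<open>u < r \<le> 1\<close> one has
    \<open>\<bar>ln (u / r)\<bar> \<le> \<bar>ln u\<bar>\<close>, so the bound is uniform in
    \<open>r\<close> and can serve as majorant.\<close>
  have E_bound: "\<bar>E (u / r)\<bar> \<le> K * (1 + (ln u)\<^sup>2)" if "u > 0" "0 < r" "r \<le> 1" for u r
  proof (cases "u / r \<ge> 1")
    case True
    have "\<bar>E (u / r)\<bar> \<le> K * 1" using K(2)[OF True] by simp
    also have "\<dots> \<le> K * (1 + (ln u)\<^sup>2)" using K(1) by (intro mult_left_mono) auto
    finally show ?thesis .
  next
    case False
    have "ln r \<le> 0" using that by simp
    moreover have "ln (u / r) < 0" using False that by simp
    moreover have "ln (u / r) = ln u - ln r" using that by (simp add: ln_div)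
    ultimately have "\<bar>ln (u / r)\<bar> \<le> \<bar>ln u\<bar>" by linarith
    then have "(ln (u / r))\<^sup>2 \<le> (ln u)\<^sup>2" by (simp add: abs_le_square_iff)
    then have "K * (1 + (ln (u / r))\<^sup>2) \<le> K * (1 + (ln u)\<^sup>2)" using K(1) by (intro mult_left_mono) auto
    then show ?thesis using K(3)[of "u / r"] False that by simp
  qed
  have Eint: "integrable lborel (\<lambda>u. E (u / r) * p u)" if "0 < r" "r \<le> 1" for r
    by (rule integrable_p_times[where K=K]) (use E_bound that in auto)
  have lim0: "((\<lambda>r. LINT u|lborel. E (u / r) * p u) \<longlongrightarrow> 0) (at_right 0)"
  proof -
    \<comment> \<open>Dominated convergence is applied with a parameter tending to infinity, whence
      \<open>r = inverse t\<close>.\<close>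
    have "((\<lambda>t. LINT u|lborel. E (u / inverse t) * p u) \<longlongrightarrow> (LINT (u::real)|lborel. (0::real))) at_top"
    proof (rule integral_dominated_convergence_at_top[where s="\<lambda>t u. E (u / inverse t) * p u" and f="\<lambda>_. 0"
        and w="\<lambda>u. K * C * (indicator {0<..} u * ((1 + (ln u)\<^sup>2) * exp (- u / 2)))" and M=lborel])
      show "integrable lborel (\<lambda>u. K * C * (indicator {0<..} u * ((1 + (ln u)\<^sup>2) * exp (- u / 2))))"
        using integrable_ln_sq_exp by (rule integrable_mult_right)
      show "AE u in lborel. ((\<lambda>t. E (u / inverse t) * p u) \<longlongrightarrow> 0) at_top"
      proof (rule AE_I2)
        fix u :: real
        show "((\<lambda>t. E (u / inverse t) * p u) \<longlongrightarrow> 0) at_top"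
        proof (cases "u > 0")
          case True
          have "filterlim (\<lambda>t. u / inverse t) at_top at_top"
            using True by real_asymp
          from filterlim_compose[OF E_lim this] have "((\<lambda>t. E (u / inverse t) * p u) \<longlongrightarrow> 0 * p u) at_top"
            by (intro tendsto_intros)
          then show ?thesis by simp
        qed (auto simp: p_def)
      qed
      show "\<forall>\<^sub>F t in at_top. AE u in lborel. norm (E (u / inverse t) * p u) \<le> K * C * (indicator {0<..} u * ((1 + (ln u)\<^sup>2) * exp (- u / 2)))"
        using eventually_ge_at_top[of 1]
      proof eventually_elim
        case (elim t)
        then have t: "inverse t > 0" "inverse t \<le> 1" by (auto simp: field_simps)
        show ?case
        proof (rule AE_I2)
          fix u :: real
          show "norm (E (u / inverse t) * p u) \<le> K * C * (indicator {0<..} u * ((1 + (ln u)\<^sup>2) * exp (- u / 2)))"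
          proof (cases "u > 0")
            case True
            have "\<bar>E (u / inverse t)\<bar> * \<bar>p u\<bar> \<le> (K * (1 + (ln u)\<^sup>2)) * (C * exp (- u / 2))"
              using E_bound[OF True t] p_bound[of u] True K(1) by (intro mult_mono) auto
            then show ?thesis using True by (simp add: abs_mult mult_ac)
          qed (auto simp: p_def)
        qed
      qed
    qed auto
    then show ?thesis by (simp add: filterlim_at_right_to_top)
  qed
  define J1 where "J1 = (LINT u|lborel. ln u * p u)"
  define J2 where "J2 = (LINT u|lborel. (ln u)\<^sup>2 * p u)"
  define d where "d = - (J2 / 2 + 2 * ?\<gamma> * J1 - c * \<psi>0)"
  have ints: "integrable lborel p" "integrable lborel (\<lambda>u. ln u * p u)" "integrable lborel (\<lambda>u. (ln u)\<^sup>2 * p u)"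
  proof -
    show "integrable lborel (\<lambda>u. ln u * p u)"
      by (intro integrable_p_times[where K=1]) (auto simp: abs_le_one_plus_square)
    show "integrable lborel p" using integrable_p_times[of "\<lambda>_. 1" 1] by simp
    show "integrable lborel (\<lambda>u. (ln u)\<^sup>2 * p u)"
      by (intro integrable_p_times[where K=1]) auto
  qed
  have main: "(\<Sum>n. \<psi> (real (wt n) * r) / real (wt n))
      = (\<psi>0 / 2 * (ln r)\<^sup>2 + (J1 - 2 * ?\<gamma> * \<psi>0) * ln r + d) - (LINT u|lborel. E (u / r) * p u)"
    if r: "0 < r" "r \<le> 1" for r
  proof -
    have "(\<Sum>n. \<psi> (real (wt n) * r) / real (wt n)) = - (LINT u|lborel. wsum (u / r) * p u)"
      using weighted_sums_integral[OF r(1)] by (simp add: sums_iff)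
    also have "(LINT u|lborel. wsum (u / r) * p u) = (LINT u|lborel. E (u / r) * p u + (1/2 * ((ln u)\<^sup>2 * p u)
         + (2 * ?\<gamma> - ln r) * (ln u * p u) + ((ln r)\<^sup>2 / 2 - 2 * ?\<gamma> * ln r + c) * p u))"
    proof (rule Bochner_Integration.integral_cong)
      fix u :: real
      show "wsum (u / r) * p u = E (u / r) * p u + (1/2 * ((ln u)\<^sup>2 * p u)
         + (2 * ?\<gamma> - ln r) * (ln u * p u) + ((ln r)\<^sup>2 / 2 - 2 * ?\<gamma> * ln r + c) * p u)"
      proof (cases "u > 0")
        case True
        then have "ln (u / r) = ln u - ln r" using r by (simp add: ln_div)
        then have w: "wsum (u / r) = E (u / r) + ((ln u - ln r)\<^sup>2 / 2 + 2 * ?\<gamma> * (ln u - ln r) + c)"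
          by (simp add: E_def)
        show ?thesis unfolding w by (simp add: field_simps power2_eq_square)
      qed (auto simp: p_def)
    qed simp
    also have "\<dots> = (LINT u|lborel. E (u / r) * p u) + (1/2 * J2 + (2 * ?\<gamma> - ln r) * J1
        + ((ln r)\<^sup>2 / 2 - 2 * ?\<gamma> * ln r + c) * (- \<psi>0))"
      unfolding J1_def J2_def integral_p[symmetric]
      using ints Eint[OF r] by (subst Bochner_Integration.integral_add; simp)+
    finally show ?thesis by (simp add: d_def algebra_simps)
  qed
  have "((\<lambda>r. - (LINT u|lborel. E (u / r) * p u)) \<longlongrightarrow> - 0) (at_right 0)"
    by (intro tendsto_intros lim0)
  moreover have "\<forall>\<^sub>F r in at_right 0. r < (1::real)"
    by (rule order_tendstoD(2)[OF tendsto_ident_at]) auto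
  then have "\<forall>\<^sub>F r in at_right 0. - (LINT u|lborel. E (u / r) * p u) = (\<Sum>n. \<psi> (real (wt n) * r) / real (wt n))
      - (\<psi>0 / 2 * (ln r)\<^sup>2 + (J1 - 2 * ?\<gamma> * \<psi>0) * ln r + d)"
    using eventually_at_right_less[of 0]
    by eventually_elim (subst main, auto)
  ultimately have "((\<lambda>r. (\<Sum>n. \<psi> (real (wt n) * r) / real (wt n))
      - (\<psi>0 / 2 * (ln r)\<^sup>2 + (J1 - 2 * ?\<gamma> * \<psi>0) * ln r + d)) \<longlongrightarrow> 0) (at_right 0)"
    by (auto intro: Lim_transform_eventually)
  then show ?thesis unfolding J1_def by blast
qed

end

section \<open>The derivatives of \<open>softplus\<close> and the weights built from them\<close>

definition sp1 :: "real \<Rightarrow> real" where "sp1 u = - exp (-u) / (1 + exp (-u))"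
definition sp2 :: "real \<Rightarrow> real" where "sp2 u = exp (-u) / (1 + exp (-u))\<^sup>2"
definition sp3 :: "real \<Rightarrow> real" where "sp3 u = exp (-u) * (exp (-u) - 1) / (1 + exp (-u)) ^ 3"

lemma one_plus_exp_neq_0: "1 + exp (- u) \<noteq> (0::real)"
  using exp_gt_zero[of "-u"] by linarith

lemma softplus_deriv: "(softplus has_real_derivative sp1 u) (at u)"
  unfolding softplus_def [abs_def] sp1_def
  using exp_gt_zero[of "-u"] by (auto intro!: derivative_eq_intros simp: add_pos_pos)

lemma sp1_deriv: "(sp1 has_real_derivative sp2 u) (at u)"
proof -
  define q where "q = exp (-u)"
  have q: "1 + q \<noteq> 0" unfolding q_def by (rule one_plus_exp_neq_0)
  have "(sp1 has_real_derivative (q * (1 + q) - q * q) / ((1 + q) * (1 + q))) (at u)"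
    unfolding sp1_def[abs_def] q_def
    by (rule derivative_eq_intros refl | simp add: one_plus_exp_neq_0)+
  moreover have "(q * (1 + q) - q * q) / ((1 + q) * (1 + q)) = sp2 u"
    using q by (simp add: sp2_def q_def[symmetric] power2_eq_square algebra_simps)
  ultimately show ?thesis by simp
qed

lemma sp2_deriv: "(sp2 has_real_derivative sp3 u) (at u)"
proof -
  define q where "q = exp (-u)"
  have q: "1 + q \<noteq> 0" unfolding q_def by (rule one_plus_exp_neq_0)
  have "(sp2 has_real_derivative ((- q) * (1 + q)\<^sup>2 - q * (2 * (1 + q) * (- q))) / ((1 + q)\<^sup>2 * (1 + q)\<^sup>2)) (at u)"
    unfolding sp2_def[abs_def] q_def
    by (rule derivative_eq_intros refl | simp add: one_plus_exp_neq_0)+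
  moreover have "((- q) * (1 + q)\<^sup>2 - q * (2 * (1 + q) * (- q))) / ((1 + q)\<^sup>2 * (1 + q)\<^sup>2) = sp3 u"
  proof -
    have "((- q) * (1 + q)\<^sup>2 - q * (2 * (1 + q) * (- q))) = (1 + q) * (q * (q - 1))"
      by (simp add: algebra_simps power2_eq_square)
    moreover have "(1 + q)\<^sup>2 * (1 + q)\<^sup>2 = (1 + q) * (1 + q) ^ 3"
      by (simp add: power2_eq_square power3_eq_cube mult_ac)
    ultimately show ?thesis
      using q by (simp add: sp3_def q_def[symmetric] del: power_Suc)
  qed
  ultimately show ?thesis by simp
qed

lemma sp_bounds:
  assumes "u > 0"
  shows "\<bar>sp1 u\<bar> \<le> exp (-u)" "\<bar>sp2 u\<bar> \<le> exp (-u)" "\<bar>sp3 u\<bar> \<le> exp (-u)"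
proof -
  define q where "q = exp (-u)"
  have q: "0 < q" "q < 1" using assms by (auto simp: q_def)
  have div: "\<bar>a / (1 + q) ^ k\<bar> \<le> \<bar>a\<bar>" for a k
  proof -
    have "1 \<le> (1 + q) ^ k" using q by (intro one_le_power) auto
    then show ?thesis using q by (simp add: abs_divide divide_le_eq mult_le_cancel_left1)
  qed
  show "\<bar>sp1 u\<bar> \<le> exp (-u)" using div[of "-q" 1] q by (simp add: sp1_def q_def[symmetric])
  show "\<bar>sp2 u\<bar> \<le> exp (-u)" using div[of "q" 2] q by (simp add: sp2_def q_def[symmetric])
  have "\<bar>q * (q - 1)\<bar> \<le> q" using q by (simp add: abs_mult mult_le_cancel_left1)
  then show "\<bar>sp3 u\<bar> \<le> exp (-u)" using div[of "q * (q - 1)" 3] q by (simp add: sp3_def q_def[symmetric])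
qed

lemma sp_isCont: "isCont sp1 u" "isCont sp2 u" "isCont sp3 u"
  using DERIV_isCont[OF sp1_deriv] DERIV_isCont[OF sp2_deriv]
  by (auto simp: sp3_def[abs_def] one_plus_exp_neq_0 intro!: continuous_intros)

text \<open>A single term of the exponential series gives
  \<open>(u / 2) ^ k / fact k \<le> exp (u / 2)\<close>. The constants 3, 12 and 72 of the instances
  below are sums of these factors.\<close>

lemma power_exp_bound:
  fixes u :: real
  assumes "u \<ge> 0"
  shows "u ^ k * exp (-u) \<le> (2 ^ k * fact k) * exp (- u / 2)"
proof -
  have "(\<Sum>n\<in>{k}. (u / 2) ^ n /\<^sub>R fact n) \<le> (\<Sum>n. (u / 2) ^ n /\<^sub>R fact n)"
    using assms by (intro sum_le_suminf summable_exp_generic) auto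
  then have "inverse (fact k) * (u / 2) ^ k \<le> exp (u / 2)"
    unfolding exp_def by simp
  then have "(2 ^ k * fact k) * (inverse (fact k) * (u / 2) ^ k) \<le> (2 ^ k * fact k) * exp (u / 2)"
    by (intro mult_left_mono) auto
  also have "(2 ^ k * fact k) * (inverse (fact k) * (u / 2) ^ k) = u ^ k"
    by (simp add: power_divide)
  finally have "u ^ k \<le> (2 ^ k * fact k) * exp (u / 2)" .
  then have "u ^ k * exp (-u) \<le> (2 ^ k * fact k) * exp (u / 2) * exp (-u)"
    by (intro mult_right_mono) auto
  also have "\<dots> = (2 ^ k * fact k) * exp (- u / 2)"
    by (simp flip: exp_add)
  finally show ?thesis .
qed

lemma weight_fun_softplus: "weight_fun softplus sp1 1 (ln 2)"
proof
  fix u :: real assume u: "u > 0"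
  show "(softplus has_real_derivative sp1 u) (at u)" by (rule softplus_deriv)
  show "isCont sp1 u" by (rule sp_isCont)
  show "\<bar>sp1 u\<bar> \<le> 1 * exp (- u / 2)"
  proof -
    have "exp (-u) \<le> exp (- u / 2)" using u by simp
    then show ?thesis using sp_bounds(1)[OF u] by linarith
  qed
next
  show "(softplus \<longlongrightarrow> 0) at_top" "(softplus \<longlongrightarrow> ln 2) (at_right 0)"
    unfolding softplus_def[abs_def] by real_asymp+
qed

lemma weight_fun_sp1: "weight_fun (\<lambda>u. u * sp1 u) (\<lambda>u. sp1 u + u * sp2 u) 3 0"
proof
  fix u :: real assume u: "u > 0"
  show "((\<lambda>u. u * sp1 u) has_real_derivative sp1 u + u * sp2 u) (at u)"
    by (auto intro!: derivative_eq_intros sp1_deriv[THEN DERIV_cong])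
  show "isCont (\<lambda>u. sp1 u + u * sp2 u) u" by (intro continuous_intros sp_isCont)
  have "\<bar>u * sp2 u\<bar> \<le> u * exp (-u)"
    using sp_bounds(2)[OF u] u by (simp add: abs_mult)
  moreover have "exp (-u) \<le> exp (- u / 2)" using u by simp
  moreover have "u * exp (-u) \<le> 2 * exp (- u / 2)" using power_exp_bound[of u 1] u by simp
  ultimately show "\<bar>sp1 u + u * sp2 u\<bar> \<le> 3 * exp (- u / 2)"
    using sp_bounds(1)[OF u] by linarith
next
  show "((\<lambda>u. u * sp1 u) \<longlongrightarrow> 0) at_top" "((\<lambda>u. u * sp1 u) \<longlongrightarrow> 0) (at_right 0)"
    unfolding sp1_def by real_asymp+
qed

lemma weight_fun_sp2: "weight_fun (\<lambda>u. u\<^sup>2 * sp2 u) (\<lambda>u. 2 * u * sp2 u + u\<^sup>2 * sp3 u) 12 0"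
proof
  fix u :: real assume u: "u > 0"
  show "((\<lambda>u. u\<^sup>2 * sp2 u) has_real_derivative 2 * u * sp2 u + u\<^sup>2 * sp3 u) (at u)"
    by (auto intro!: derivative_eq_intros sp2_deriv[THEN DERIV_cong])
  show "isCont (\<lambda>u. 2 * u * sp2 u + u\<^sup>2 * sp3 u) u" by (intro continuous_intros sp_isCont)
  have "\<bar>2 * u * sp2 u\<bar> \<le> 2 * (u * exp (-u))" "\<bar>u\<^sup>2 * sp3 u\<bar> \<le> u\<^sup>2 * exp (-u)"
    using sp_bounds(2,3)[OF u] u by (simp_all add: abs_mult)
  then show "\<bar>2 * u * sp2 u + u\<^sup>2 * sp3 u\<bar> \<le> 12 * exp (- u / 2)"
    using power_exp_bound[of u 1] power_exp_bound[of u 2] u by simp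
next
  show "((\<lambda>u. u\<^sup>2 * sp2 u) \<longlongrightarrow> 0) at_top" "((\<lambda>u. u\<^sup>2 * sp2 u) \<longlongrightarrow> 0) (at_right 0)"
    unfolding sp2_def by real_asymp+
qed

text \<open>Majorant of the third-order remainder in \<open>Ln_one_plus_exp_taylor\<close>.\<close>

lemma weight_fun_cube_exp: "weight_fun (\<lambda>u. u ^ 3 * exp (-u)) (\<lambda>u. 3 * u\<^sup>2 * exp (-u) - u ^ 3 * exp (-u)) 72 0"
proof
  fix u :: real assume u: "u > 0"
  show "((\<lambda>u. u ^ 3 * exp (-u)) has_real_derivative 3 * u\<^sup>2 * exp (-u) - u ^ 3 * exp (-u)) (at u)"
    by (auto intro!: derivative_eq_intros)
  show "isCont (\<lambda>u. 3 * u\<^sup>2 * exp (-u) - u ^ 3 * exp (-u)) u" by (intro continuous_intros)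
  have "0 \<le> u\<^sup>2 * exp (-u)" "0 \<le> u ^ 3 * exp (-u)" using u by auto
  moreover have "u\<^sup>2 * exp (-u) \<le> 8 * exp (- u / 2)" using power_exp_bound[of u 2] u by simp
  moreover have "u ^ 3 * exp (-u) \<le> 48 * exp (- u / 2)" using power_exp_bound[of u 3] u by (simp add: fact_numeral)
  ultimately show "\<bar>3 * u\<^sup>2 * exp (-u) - u ^ 3 * exp (-u)\<bar> \<le> 72 * exp (- u / 2)"
    unfolding mult.assoc by linarith
next
  show "((\<lambda>u::real. u ^ 3 * exp (-u)) \<longlongrightarrow> 0) at_top" "((\<lambda>u::real. u ^ 3 * exp (-u)) \<longlongrightarrow> 0) (at_right 0)"
    by real_asymp+
qed

lemma logQ_asymp:
  fixes l d0 d1 :: real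
  assumes "l = ln 2"
    and "d0 = euler_mascheroni\<^sup>2 * l / 2 + pi\<^sup>2 * l / 12 - euler_mascheroni * l\<^sup>2 + l ^ 3 / 6
                - 3 * stieltjes 1 * l"
    and "d1 = l\<^sup>2 / 2 - 2 * euler_mascheroni * l"
  shows "((\<lambda>t. logQ t - (l / 2 * (ln t)\<^sup>2 + d1 * ln t + d0)) \<longlongrightarrow> 0) (at_right 0)"
proof -
  obtain q c where lim: "((\<lambda>t. logQ t - (l / 2 * (ln t)\<^sup>2 + q * ln t + c)) \<longlongrightarrow> 0) (at_right 0)"
    using weight_fun.weighted_sum_asymp[OF weight_fun_softplus] assms(1)
    unfolding logQ_def by blast
  show ?thesis
    using lim logQ_coefficients[OF assms(1) lim] assms by simp
qed

definition wseries :: "(real \<Rightarrow> real) \<Rightarrow> real \<Rightarrow> real" where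
  "wseries \<psi> r = (\<Sum>n. \<psi> (real (wt n) * r) / real (wt n))"

text \<open>The series is formally \<open>r * logQ'(r)\<close>, and \<open>ln 2 * ln r\<close> is
  what differentiating the expansion of \<open>logQ\<close> predicts. As the weight vanishes at 0
  there is no squared logarithm, and the integral of \<open>ln u * p u\<close> has the primitive
  \<open>ln u * (u * sp1 u) - softplus u\<close>.\<close>

lemma wseries_sp1: "\<exists>c. ((\<lambda>r. wseries (\<lambda>u. u * sp1 u) r - ln 2 * ln r) \<longlongrightarrow> c) (at_right 0)"
proof -
  interpret W: weight_fun "\<lambda>u. u * sp1 u" "\<lambda>u. sp1 u + u * sp2 u" 3 0 by (rule weight_fun_sp1)
  have "(LINT u|lborel. indicator {0<..} u * (ln u * (sp1 u + u * sp2 u))) = 0 - (- ln 2)"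
  proof (rule integral_halfline_FTC[where F="\<lambda>u. ln u * (u * sp1 u) - softplus u"])
    fix u :: real assume u: "u > 0"
    show "((\<lambda>u. ln u * (u * sp1 u) - softplus u) has_real_derivative ln u * (sp1 u + u * sp2 u)) (at u)"
      using u by (auto intro!: derivative_eq_intros W.deriv[THEN DERIV_cong] sp1_deriv[THEN DERIV_cong]
           softplus_deriv[THEN DERIV_cong] simp: algebra_simps)
    show "isCont (\<lambda>u. ln u * (sp1 u + u * sp2 u)) u"
      using u by (intro continuous_intros sp_isCont) auto
  next
    have "integrable lborel (\<lambda>u. ln u * W.p u)"
      by (intro W.integrable_p_times[where K=1]) (auto simp: abs_le_one_plus_square)
    then show "integrable lborel (\<lambda>u. indicator {0<..} u * (ln u * (sp1 u + u * sp2 u)))"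
      unfolding W.p_def by (simp add: mult_ac)
    show "((\<lambda>u. ln u * (u * sp1 u) - softplus u) \<longlongrightarrow> 0) at_top"
      "((\<lambda>u. ln u * (u * sp1 u) - softplus u) \<longlongrightarrow> - ln 2) (at_right 0)"
      unfolding sp1_def softplus_def by real_asymp+
  qed
  then have J: "(LINT u|lborel. ln u * W.p u) = ln 2"
    unfolding W.p_def by (simp add: mult_ac)
  obtain c where "((\<lambda>r. wseries (\<lambda>u. u * sp1 u) r - (0 / 2 * (ln r)\<^sup>2 + (ln 2 - 2 * euler_mascheroni * 0) * ln r + c)) \<longlongrightarrow> 0) (at_right 0)"
    using W.weighted_sum_asymp unfolding J wseries_def by blast
  from tendsto_add[OF this tendsto_const[of c]] show ?thesis
    by (auto simp: algebra_simps)
qed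

text \<open>Formally \<open>r\<^sup>2 * logQ''(r)\<close>. The primitive again comes from
  integrating by parts, since \<open>u * sp1 u - softplus u\<close> has derivative
  \<open>u * sp2 u\<close>. The growth \<open>- ln 2 * ln r\<close> becomes the variance of the
  Gaussian.\<close>

lemma wseries_sp2: "\<exists>c. ((\<lambda>r. wseries (\<lambda>u. u\<^sup>2 * sp2 u) r + ln 2 * ln r) \<longlongrightarrow> c) (at_right 0)"
proof -
  interpret W: weight_fun "\<lambda>u. u\<^sup>2 * sp2 u" "\<lambda>u. 2 * u * sp2 u + u\<^sup>2 * sp3 u" 12 0 by (rule weight_fun_sp2)
  have "(LINT u|lborel. indicator {0<..} u * (ln u * (2 * u * sp2 u + u\<^sup>2 * sp3 u))) = 0 - ln 2"
  proof (rule integral_halfline_FTC[where F="\<lambda>u. ln u * (u\<^sup>2 * sp2 u) - (u * sp1 u - softplus u)"])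
    fix u :: real assume u: "u > 0"
    show "((\<lambda>u. ln u * (u\<^sup>2 * sp2 u) - (u * sp1 u - softplus u)) has_real_derivative ln u * (2 * u * sp2 u + u\<^sup>2 * sp3 u)) (at u)"
      using u by (auto intro!: derivative_eq_intros sp1_deriv[THEN DERIV_cong] sp2_deriv[THEN DERIV_cong]
           softplus_deriv[THEN DERIV_cong] simp: algebra_simps power2_eq_square)
    show "isCont (\<lambda>u. ln u * (2 * u * sp2 u + u\<^sup>2 * sp3 u)) u"
      using u by (intro continuous_intros sp_isCont) auto
  next
    have "integrable lborel (\<lambda>u. ln u * W.p u)"
      by (intro W.integrable_p_times[where K=1]) (auto simp: abs_le_one_plus_square)
    then show "integrable lborel (\<lambda>u. indicator {0<..} u * (ln u * (2 * u * sp2 u + u\<^sup>2 * sp3 u)))"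
      unfolding W.p_def by (simp add: mult_ac)
    show "((\<lambda>u. ln u * (u\<^sup>2 * sp2 u) - (u * sp1 u - softplus u)) \<longlongrightarrow> 0) at_top"
      "((\<lambda>u. ln u * (u\<^sup>2 * sp2 u) - (u * sp1 u - softplus u)) \<longlongrightarrow> ln 2) (at_right 0)"
      unfolding sp1_def sp2_def softplus_def by real_asymp+
  qed
  then have J: "(LINT u|lborel. ln u * W.p u) = - ln 2"
    unfolding W.p_def by (simp add: mult_ac)
  obtain c where "((\<lambda>r. wseries (\<lambda>u. u\<^sup>2 * sp2 u) r - (0 / 2 * (ln r)\<^sup>2 + (- ln 2 - 2 * euler_mascheroni * 0) * ln r + c)) \<longlongrightarrow> 0) (at_right 0)"
    using W.weighted_sum_asymp unfolding J wseries_def by blast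
  from tendsto_add[OF this tendsto_const[of c]] show ?thesis
    by (auto simp: algebra_simps)
qed

text \<open>Only logarithmic growth matters: the remainder is multiplied by
  \<open>\<bar>y\<bar> ^ 3\<close>, of order \<open>L powr (-3/2)\<close>, so \<open>J\<close> may
  stay unevaluated.\<close>

lemma wseries_cube_exp: "\<exists>J c. ((\<lambda>r. wseries (\<lambda>u. u ^ 3 * exp (-u)) r - J * ln r) \<longlongrightarrow> c) (at_right 0)"
proof -
  obtain J c where "((\<lambda>r. wseries (\<lambda>u. u ^ 3 * exp (-u)) r - (0 / 2 * (ln r)\<^sup>2 + (J - 2 * euler_mascheroni * 0) * ln r + c)) \<longlongrightarrow> 0) (at_right 0)"
    using weight_fun.weighted_sum_asymp[OF weight_fun_cube_exp] unfolding wseries_def by blast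
  from tendsto_add[OF this tendsto_const[of c]] show ?thesis
    by (auto simp: algebra_simps)
qed

section \<open>The logarithm of the generating function\<close>

text \<open>Absolute convergence along the enumeration \<open>prod_decode\<close> yields the
  iterated sums. This links the single-index series used for estimates with the iterated product in
  \<open>Q_fun\<close>.\<close>

lemma double_sums:
  fixes f :: "nat \<Rightarrow> nat \<Rightarrow> 'a :: {banach, complete_uniform_space, uniform_topological_group_add}"
  assumes "summable (\<lambda>n. norm (case prod_decode n of (i, j) \<Rightarrow> f i j))"
  shows "summable (f i)"
    and "(\<lambda>i. \<Sum>j. f i j) sums (\<Sum>n. case prod_decode n of (i, j) \<Rightarrow> f i j)"
proof -
  define S where "S = (\<Sum>n. case prod_decode n of (i, j) \<Rightarrow> f i j)"
  have "((\<lambda>n. case prod_decode n of (i, j) \<Rightarrow> f i j) has_sum S) UNIV"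
    unfolding S_def by (rule norm_summable_imp_has_sum[OF assms summable_sums[OF summable_norm_cancel[OF assms]]])
  then have "((\<lambda>n. (\<lambda>(i, j). f i j) (prod_decode n)) has_sum S) UNIV" .
  then have S: "((\<lambda>(i, j). f i j) has_sum S) (Sigma UNIV (\<lambda>_. UNIV))"
    using has_sum_reindex_bij_betw[OF bij_prod_decode, of "\<lambda>(i, j). f i j" S] by simp
  then have "f i summable_on UNIV" for i
    using summable_on_SigmaD1[of f UNIV "\<lambda>_. UNIV" i] by (auto simp: summable_on_def)
  then have hs: "(f i has_sum infsum (f i) UNIV) UNIV" for i by simp
  then have sums: "f i sums infsum (f i) UNIV" for i by (rule has_sum_imp_sums)
  then show "summable (f i)" by (rule sums_summable)
  have "((\<lambda>i. infsum (f i) UNIV) has_sum S) UNIV"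
    using has_sum_SigmaD[OF S, of "\<lambda>i. infsum (f i) UNIV"] hs by simp
  then have "(\<lambda>i. infsum (f i) UNIV) sums S" by (rule has_sum_imp_sums)
  moreover have "(\<Sum>j. f i j) = infsum (f i) UNIV" for i
    using sums[of i] by (simp add: sums_iff)
  ultimately show "(\<lambda>i. \<Sum>j. f i j) sums S" by simp
qed

lemma norm_Ln_one_plus_le:
  fixes z :: complex
  assumes "norm z \<le> \<rho>" "\<rho> < 1"
  shows "norm (Ln (1 + z)) \<le> norm z / (1 - \<rho>)"
proof -
  have "norm (Ln (1 + z) - Ln (1 + 0)) \<le> 1 / (1 - \<rho>) * norm (z - 0)"
  proof (rule field_differentiable_bound[where S="cball 0 \<rho>" and f'="\<lambda>w. 1 / (1 + w)"])
    fix w :: complex assume w: "w \<in> cball 0 \<rho>"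
    have "Re (1 + w) > 0"
      using w assms abs_Re_le_cmod[of w] by (auto simp: abs_le_iff)
    then have "1 + w \<notin> \<real>\<^sub>\<le>\<^sub>0" by (auto simp: complex_nonpos_Reals_iff)
    then show "((\<lambda>w. Ln (1 + w)) has_field_derivative 1 / (1 + w)) (at w within cball 0 \<rho>)"
      by (auto intro!: derivative_eq_intros simp: divide_inverse)
    have "1 - \<rho> \<le> norm (1 + w)"
      using norm_diff_ineq[of 1 w] w by simp
    then show "norm (1 / (1 + w)) \<le> 1 / (1 - \<rho>)"
      using assms by (simp add: norm_divide frac_le)
  next
    show "0 \<in> cball (0::complex) \<rho>" using assms(1) norm_ge_zero[of z] by (simp del: norm_ge_zero)
  qed (use assms in auto)
  then show ?thesis by simp
qed

text \<open>A holomorphic logarithm of \<open>Q_fun\<close> on the unit disc, assembled from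
  principal logarithms of the factors; each \<open>1 + z ^ wt n\<close> lies in the right half
  plane.\<close>

definition clogQ :: "complex \<Rightarrow> complex" where
  "clogQ z = (\<Sum>n. Ln (1 + z ^ wt n) / of_nat (wt n))"

lemma clogQ_term_bound:
  assumes "norm z \<le> \<rho>" "\<rho> < 1"
  shows "norm (Ln (1 + z ^ wt n) / of_nat (wt n)) \<le> \<rho> ^ wt n / (1 - \<rho>)"
proof -
  have zw: "norm (z ^ wt n) \<le> \<rho> ^ wt n"
    unfolding norm_power using assms by (intro power_mono) auto
  have "\<rho> \<ge> 0" using assms(1) norm_ge_zero[of z] by linarith
  then have "\<rho> ^ wt n \<le> \<rho> ^ 1"
    using assms wt_pos[of n] by (intro power_decreasing) (auto simp: Suc_le_eq)
  with zw have "norm (z ^ wt n) \<le> \<rho>" by simp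
  then have "norm (Ln (1 + z ^ wt n)) \<le> norm (z ^ wt n) / (1 - \<rho>)"
    using assms(2) by (rule norm_Ln_one_plus_le)
  also have "\<dots> \<le> \<rho> ^ wt n / (1 - \<rho>)" using zw assms by (intro divide_right_mono) auto
  finally have "norm (Ln (1 + z ^ wt n)) \<le> \<rho> ^ wt n / (1 - \<rho>)" .
  moreover have "norm (Ln (1 + z ^ wt n) / of_nat (wt n)) \<le> norm (Ln (1 + z ^ wt n))"
    unfolding norm_divide norm_of_nat by (rule wt_div_le) simp
  ultimately show ?thesis by simp
qed

lemma summable_norm_clogQ:
  assumes "norm z < 1"
  shows "summable (\<lambda>n. norm (Ln (1 + z ^ wt n) / of_nat (wt n)))"
proof (rule summable_comparison_test'[where N=0])
  show "summable (\<lambda>n. norm z ^ wt n / (1 - norm z))"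
    using assms by (intro summable_divide summable_power_wt) auto
  show "norm (norm (Ln (1 + z ^ wt n) / of_nat (wt n))) \<le> norm z ^ wt n / (1 - norm z)" for n
    using clogQ_term_bound[of z "norm z" n] assms by (simp only: real_norm_def abs_norm_cancel)
qed

lemma Re_one_plus_pos: "norm z < 1 \<Longrightarrow> Re (1 + z) > 0"
  using abs_Re_le_cmod[of z] by (auto simp: abs_le_iff)

lemma Q_fun_eq:
  assumes z: "norm z < 1"
  shows "Q_fun z = exp (clogQ z)"
proof -
  define f where "f i j = Ln (1 + z ^ (Suc i * Suc j)) / of_nat (Suc i * Suc j)" for i j
  have f_wt: "(case prod_decode n of (i, j) \<Rightarrow> f i j) = Ln (1 + z ^ wt n) / of_nat (wt n)" for n
    by (simp add: f_def wt_def split: prod.splits)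
  have sm: "summable (\<lambda>n. norm (case prod_decode n of (i, j) \<Rightarrow> f i j))"
    unfolding f_wt using summable_norm_clogQ[OF z] .
  have "(1 + z ^ (Suc i * Suc j)) powr (1 / of_nat (Suc i * Suc j)) = exp (f i j)" for i j
  proof -
    have "norm (z ^ (Suc i * Suc j)) < 1"
      unfolding norm_power using z by (subst power_less_one_iff) auto
    from Re_one_plus_pos[OF this] have "1 + z ^ (Suc i * Suc j) \<noteq> 0" by (metis less_irrefl zero_complex.sel(1))
    then show ?thesis by (simp add: powr_def f_def del: mult_Suc mult_Suc_right)
  qed
  then have "Q_fun z = (\<Prod>i. \<Prod>j. exp (f i j))"
    by (simp only: Q_fun_def)
  also have "\<dots> = (\<Prod>i. exp (\<Sum>j. f i j))"
    by (simp add: prodinf_exp double_sums(1)[OF sm])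
  also have "\<dots> = exp (\<Sum>i. \<Sum>j. f i j)"
    using double_sums(2)[OF sm] by (intro prodinf_exp sums_summable)
  also have "(\<Sum>i. \<Sum>j. f i j) = clogQ z"
    using double_sums(2)[OF sm] by (simp add: sums_iff f_wt clogQ_def)
  finally show ?thesis .
qed

lemma clogQ_holomorphic: "clogQ holomorphic_on ball 0 1"
proof (rule holomorphic_uniform_sequence[where f="\<lambda>N z. \<Sum>n<N. Ln (1 + z ^ wt n) / of_nat (wt n)"])
  fix N
  have "1 + z ^ wt n \<notin> \<real>\<^sub>\<le>\<^sub>0" if "z \<in> ball 0 1" for n and z :: complex
  proof -
    have "norm (z ^ wt n) < 1" using that by (simp add: norm_power power_less_one_iff)
    then show ?thesis using Re_one_plus_pos[of "z ^ wt n"] by (auto simp: complex_nonpos_Reals_iff)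
  qed
  then show "(\<lambda>z. \<Sum>n<N. Ln (1 + z ^ wt n) / of_nat (wt n)) holomorphic_on ball 0 1"
    by (intro holomorphic_intros) auto
next
  fix x :: complex assume x: "x \<in> ball 0 1"
  define \<rho> where "\<rho> = (1 + norm x) / 2"
  have \<rho>: "0 \<le> \<rho>" "\<rho> < 1" using x by (auto simp: \<rho>_def)
  define d where "d = (1 - norm x) / 2"
  have d: "d > 0" using x by (simp add: d_def)
  have sub: "norm z \<le> \<rho>" if "z \<in> cball x d" for z
  proof -
    have "norm z \<le> norm x + norm (z - x)" using norm_triangle_ineq[of x "z - x"] by simp
    then show ?thesis using that by (simp add: dist_norm norm_minus_commute d_def \<rho>_def field_simps)
  qed
  have "uniform_limit (cball x d) (\<lambda>N z. \<Sum>n<N. Ln (1 + z ^ wt n) / of_nat (wt n)) clogQ sequentially"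
    unfolding clogQ_def[abs_def]
    by (rule Weierstrass_m_test[where M="\<lambda>n. \<rho> ^ wt n / (1 - \<rho>)"])
       (use sub \<rho> in \<open>auto intro!: clogQ_term_bound summable_divide summable_power_wt\<close>)
  moreover have "cball x d \<subseteq> ball 0 1" using sub \<rho> by force
  ultimately show "\<exists>d>0. cball x d \<subseteq> ball 0 1 \<and>
      uniform_limit (cball x d) (\<lambda>N z. \<Sum>n<N. Ln (1 + z ^ wt n) / of_nat (wt n)) clogQ sequentially"
    using d by blast
qed auto

text \<open>Taylor expansion of \<open>Ln (1 + exp (-z))\<close> along the vertical segment from
  \<open>u\<close> to \<open>u * (1 + \<i> * y)\<close>. The danger is that
  \<open>1 + exp (-z)\<close> vanishes at odd multiples of \<open>\<i> * pi\<close>; the condition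
  \<open>\<bar>y\<bar> \<le> 1\<close> keeps the segment away from there.\<close>

lemma Ln_one_plus_exp_taylor:
  fixes u y :: real
  assumes u: "u > 0" and y: "\<bar>y\<bar> \<le> 1"
  shows "cmod (Ln (1 + exp (- (of_real u * (1 + \<i> * of_real y))))
      - (of_real (softplus u) + \<i> * of_real (y * (u * sp1 u)) - of_real (y\<^sup>2 / 2 * (u\<^sup>2 * sp2 u))))
      \<le> 8 * \<bar>y\<bar> ^ 3 * (u ^ 3 * exp (-u))"
proof -
  define f where "f k z = (if k = 0 then Ln (1 + exp (-z))
     else if k = Suc 0 then - exp (-z) / (1 + exp (-z))
     else if k = Suc (Suc 0) then exp (-z) / (1 + exp (-z))\<^sup>2
     else exp (-z) * (exp (-z) - 1) / (1 + exp (-z)) ^ 3)" for k :: nat and z :: complex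
  define w where "w = complex_of_real u"
  define z where "z = complex_of_real u * (1 + \<i> * of_real y)"
  \<comment> \<open>For \<open>u \<le> 1\<close> the imaginary part is at most 1, so the cosine is
    nonnegative; for \<open>u > 1\<close> already \<open>exp (-u) \<le> 1/2\<close>.\<close>
  have seg: "Re x = u \<and> Re (1 + exp (-x)) \<ge> 1/2" if "x \<in> closed_segment w z" for x
  proof -
    from that obtain t where t: "x = (1 - t) *\<^sub>R w + t *\<^sub>R z" "0 \<le> t" "t \<le> 1"
      by (auto simp: closed_segment_def)
    have re: "Re x = u" and im: "Im x = t * u * y"
      using t(1) by (auto simp: w_def z_def algebra_simps)
    have imb: "\<bar>Im x\<bar> \<le> u"
    proof -
      have "\<bar>t * u * y\<bar> \<le> 1 * u * 1" unfolding abs_mult using t u y by (intro mult_mono) auto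
      then show ?thesis using im by simp
    qed
    have "Re (1 + exp (-x)) = 1 + exp (-u) * cos (Im x)" by (simp add: Re_exp re)
    moreover have "exp (-u) * cos (Im x) \<ge> -1/2"
    proof (cases "u \<le> 1")
      case True
      have "cos (Im x) \<ge> 0" using imb True pi_gt3 by (intro cos_ge_zero) auto
      then have "0 \<le> exp (-u) * cos (Im x)" by simp
      then show ?thesis by linarith
    next
      case False
      have "2 \<le> exp u" using exp_ge_add_one_self[of u] False by linarith
      then have "exp (-u) \<le> 1/2" by (simp add: exp_minus field_simps)
      moreover have "exp (-u) * cos (Im x) \<ge> exp (-u) * (-1)" by (intro mult_left_mono) auto
      ultimately show ?thesis by linarith
    qed
    ultimately show ?thesis using re by linarith
  qed
  \<comment> \<open>The third derivative is at most \<open>exp (-u) * 2 / (1/2) ^ 3\<close>, which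
    is \<open>16 * exp (-u)\<close>; this form of Taylor's theorem divides by \<open>fact 2\<close>,
    leaving 8.\<close>
  have "cmod (f 0 z - (\<Sum>i\<le>2. f i w * (z - w) ^ i / fact i)) \<le> 16 * exp (-u) * cmod (z - w) ^ Suc 2 / fact 2"
  proof (rule complex_Taylor[where S="closed_segment w z"])
    fix x assume x: "x \<in> closed_segment w z"
    define q where "q = exp (-x)"
    have nq: "norm q = exp (-u)" using seg[OF x] by (simp add: q_def norm_exp)
    have q2: "norm (1 + q) \<ge> 1/2"
      using seg[OF x] complex_Re_le_cmod[of "1 + q"] by (simp add: q_def)
    then have q0: "1 + q \<noteq> 0" by auto
    have "Re (1 + q) > 0" using seg[OF x] unfolding q_def by linarith
    then have qn: "1 + q \<notin> \<real>\<^sub>\<le>\<^sub>0" by (auto simp: complex_nonpos_Reals_iff)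
    show "(f i has_field_derivative f (Suc i) x) (at x within closed_segment w z)" if "i \<le> 2" for i
    proof -
      have "i = 0 \<or> i = Suc 0 \<or> i = Suc (Suc 0)" using that by arith
      then consider "i = 0" | "i = Suc 0" | "i = Suc (Suc 0)" by blast
      then show ?thesis
      proof cases
        case 1
        have "((\<lambda>z. Ln (1 + exp (-z))) has_field_derivative - exp (-x) / (1 + exp (-x))) (at x within closed_segment w z)"
          using qn unfolding q_def by (auto intro!: derivative_eq_intros simp: divide_inverse mult.commute)
        then show ?thesis by (simp add: 1 f_def[abs_def])
      next
        case 2
        have "((\<lambda>z. - exp (-z) / (1 + exp (-z))) has_field_derivative - ((q * q - q * (1 + q)) / ((1 + q) * (1 + q)))) (at x within closed_segment w z)"
          using q0 unfolding q_def
          by (auto intro!: derivative_eq_intros)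
        moreover have "- ((q * q - q * (1 + q)) / ((1 + q) * (1 + q))) = q / (1 + q)\<^sup>2"
          by (simp add: power2_eq_square algebra_simps)
        ultimately show ?thesis by (simp add: 2 f_def[abs_def] q_def)
      next
        case 3
        have "((\<lambda>z. exp (-z) / (1 + exp (-z))\<^sup>2) has_field_derivative ((- q) * (1 + q)\<^sup>2 - q * (2 * (1 + q) * (- q))) / ((1 + q)\<^sup>2 * (1 + q)\<^sup>2)) (at x within closed_segment w z)"
          using q0 unfolding q_def
          by (auto intro!: derivative_eq_intros)
        moreover have "((- q) * (1 + q)\<^sup>2 - q * (2 * (1 + q) * (- q))) = (1 + q) * (q * (q - 1))"
          by (simp add: algebra_simps power2_eq_square)
        moreover have "(1 + q)\<^sup>2 * (1 + q)\<^sup>2 = (1 + q) * (1 + q) ^ 3"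
          by (simp add: power2_eq_square power3_eq_cube mult_ac)
        ultimately have "((\<lambda>z. exp (-z) / (1 + exp (-z))\<^sup>2) has_field_derivative (q * (q - 1)) / (1 + q) ^ 3) (at x within closed_segment w z)"
          using q0 by (simp del: power_Suc)
        then show ?thesis by (simp add: 3 f_def[abs_def] q_def)
      qed
    qed
    have "norm (q - 1) \<le> 2"
      using norm_triangle_ineq4[of q 1] nq u by (simp add: order.trans[of _ "exp (-u) + 1"])
    moreover have "(1/2) ^ 3 \<le> norm (1 + q) ^ 3" using q2 by (intro power_mono) auto
    ultimately have "norm q * norm (q - 1) / norm (1 + q) ^ 3 \<le> exp (-u) * 2 / (1/2) ^ 3"
      unfolding nq by (intro frac_le mult_left_mono) auto
    then show "cmod (f (Suc 2) x) \<le> 16 * exp (-u)"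
      by (simp add: f_def q_def[symmetric] norm_mult norm_divide norm_power power3_eq_cube)
  qed auto
  moreover have "f 0 z - (\<Sum>i\<le>2. f i w * (z - w) ^ i / fact i) =
     Ln (1 + exp (- (of_real u * (1 + \<i> * of_real y))))
      - (of_real (softplus u) + \<i> * of_real (y * (u * sp1 u)) - of_real (y\<^sup>2 / 2 * (u\<^sup>2 * sp2 u)))"
  proof -
    have zw: "z - w = \<i> * of_real (u * y)" by (simp add: z_def w_def algebra_simps)
    have f0: "f 0 w = of_real (softplus u)"
    proof -
      have "f 0 w = Ln (of_real (1 + exp (-u)))"
        by (simp add: f_def w_def exp_of_real[symmetric])
      also have "\<dots> = of_real (softplus u)"
        unfolding softplus_def by (rule Ln_of_real) (simp add: add_pos_pos)
      finally show ?thesis .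
    qed
    have f1: "f (Suc 0) w = of_real (sp1 u)"
      by (simp add: f_def w_def sp1_def exp_of_real[symmetric])
    have f2: "f 2 w = of_real (sp2 u)"
      by (simp add: f_def w_def sp2_def exp_of_real[symmetric])
    have "(\<Sum>i\<le>2. f i w * (z - w) ^ i / fact i) = f 0 w + f (Suc 0) w * (z - w) + f 2 w * (z - w)\<^sup>2 / 2"
      by (simp add: numeral_2_eq_2)
    also have "\<dots> = of_real (softplus u) + \<i> * of_real (y * (u * sp1 u)) - of_real (y\<^sup>2 / 2 * (u\<^sup>2 * sp2 u))"
      unfolding zw f0 f1 f2 by (simp add: power_mult_distrib mult_ac)
    finally show ?thesis by (simp add: f_def z_def)
  qed
  moreover have "16 * exp (-u) * cmod (z - w) ^ Suc 2 / fact 2 = 8 * \<bar>y\<bar> ^ 3 * (u ^ 3 * exp (-u))"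
  proof -
    have "cmod (z - w) = u * \<bar>y\<bar>" using u by (simp add: z_def w_def algebra_simps norm_mult abs_mult)
    then show ?thesis by (simp add: power_mult_distrib eval_nat_numeral)
  qed
  ultimately show ?thesis by (simp only:)
qed

text \<open>The parametrisation \<open>r * (1 + \<i> * y)\<close> makes this a termwise sum: passing
  to the weight \<open>m\<close> scales \<open>u = m * r\<close> and leaves the relative
  displacement \<open>y\<close> unchanged.\<close>

lemma clogQ_taylor:
  fixes r y :: real
  assumes r: "r > 0" and y: "\<bar>y\<bar> \<le> 1"
  shows "cmod (clogQ (exp (- (of_real r * (1 + \<i> * of_real y))))
      - (of_real (logQ r) + \<i> * of_real (y * wseries (\<lambda>u. u * sp1 u) r) - of_real (y\<^sup>2 / 2 * wseries (\<lambda>u. u\<^sup>2 * sp2 u) r)))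
      \<le> 8 * \<bar>y\<bar> ^ 3 * wseries (\<lambda>u. u ^ 3 * exp (-u)) r"
proof -
  define z where "z = exp (- (complex_of_real r * (1 + \<i> * of_real y)))"
  have z: "norm z < 1" using r by (simp add: z_def norm_exp)
  define W where "W n = real (wt n)" for n
  have W: "W n > 0" for n by (simp add: W_def)
  define a where "a n = (of_real (softplus (W n * r)) + \<i> * of_real (y * (W n * r * sp1 (W n * r)))
       - complex_of_real (y\<^sup>2 / 2 * ((W n * r)\<^sup>2 * sp2 (W n * r)))) / of_real (W n)" for n
  have s0: "(\<lambda>n. softplus (W n * r) / W n) sums logQ r"
    unfolding logQ_def W_def using summable_sums[OF summable_logQ[OF r]] .
  have s1: "(\<lambda>n. (W n * r * sp1 (W n * r)) / W n) sums wseries (\<lambda>u. u * sp1 u) r"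
    using weight_fun.weighted_sums_integral[OF weight_fun_sp1 r] unfolding wseries_def W_def
    by (simp add: sums_iff)
  have s2: "(\<lambda>n. ((W n * r)\<^sup>2 * sp2 (W n * r)) / W n) sums wseries (\<lambda>u. u\<^sup>2 * sp2 u) r"
    using weight_fun.weighted_sums_integral[OF weight_fun_sp2 r] unfolding wseries_def W_def
    by (simp add: sums_iff)
  have s3: "(\<lambda>n. ((W n * r) ^ 3 * exp (-(W n * r))) / W n) sums wseries (\<lambda>u. u ^ 3 * exp (-u)) r"
    using weight_fun.weighted_sums_integral[OF weight_fun_cube_exp r] unfolding wseries_def W_def
    by (simp add: sums_iff)
  have "(\<lambda>n. of_real (softplus (W n * r) / W n) + \<i> * of_real (y * ((W n * r * sp1 (W n * r)) / W n))
       - complex_of_real (y\<^sup>2 / 2 * (((W n * r)\<^sup>2 * sp2 (W n * r)) / W n)))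
      sums (of_real (logQ r) + \<i> * of_real (y * wseries (\<lambda>u. u * sp1 u) r) - of_real (y\<^sup>2 / 2 * wseries (\<lambda>u. u\<^sup>2 * sp2 u) r))"
    by (intro sums_add sums_diff sums_mult sums_of_real s0 s1 s2)
  then have a: "a sums (of_real (logQ r) + \<i> * of_real (y * wseries (\<lambda>u. u * sp1 u) r) - of_real (y\<^sup>2 / 2 * wseries (\<lambda>u. u\<^sup>2 * sp2 u) r))"
  proof (rule back_subst[where P="\<lambda>f. f sums _"], intro ext)
    fix n
    show "of_real (softplus (W n * r) / W n) + \<i> * of_real (y * ((W n * r * sp1 (W n * r)) / W n))
       - complex_of_real (y\<^sup>2 / 2 * (((W n * r)\<^sup>2 * sp2 (W n * r)) / W n)) = a n"
      unfolding a_def using W[of n] by (simp add: add_divide_distrib diff_divide_distrib)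
  qed
  have b: "(\<lambda>n. Ln (1 + z ^ wt n) / of_nat (wt n)) sums clogQ z"
    unfolding clogQ_def by (rule summable_sums[OF summable_norm_cancel[OF summable_norm_clogQ[OF z]]])
  have term_bound: "norm (Ln (1 + z ^ wt n) / of_nat (wt n) - a n) \<le> 8 * \<bar>y\<bar> ^ 3 * (((W n * r) ^ 3 * exp (-(W n * r))) / W n)" for n
  proof -
    have zp: "z ^ wt n = exp (- (of_real (W n * r) * (1 + \<i> * of_real y)))"
      unfolding z_def W_def by (simp add: exp_of_nat_mult[symmetric] algebra_simps)
    have "norm (Ln (1 + z ^ wt n) / of_nat (wt n) - a n) = norm (Ln (1 + exp (- (of_real (W n * r) * (1 + \<i> * of_real y))))
      - (of_real (softplus (W n * r)) + \<i> * of_real (y * (W n * r * sp1 (W n * r))) - of_real (y\<^sup>2 / 2 * ((W n * r)\<^sup>2 * sp2 (W n * r))))) / W n"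
    proof -
      have "Ln (1 + z ^ wt n) / of_nat (wt n) - a n = (Ln (1 + exp (- (of_real (W n * r) * (1 + \<i> * of_real y))))
      - (of_real (softplus (W n * r)) + \<i> * of_real (y * (W n * r * sp1 (W n * r))) - of_real (y\<^sup>2 / 2 * ((W n * r)\<^sup>2 * sp2 (W n * r))))) / of_real (W n)"
        unfolding zp a_def by (simp add: W_def diff_divide_distrib)
      then show ?thesis using W[of n] by (simp add: norm_divide)
    qed
    also have "\<dots> \<le> 8 * \<bar>y\<bar> ^ 3 * ((W n * r) ^ 3 * exp (-(W n * r))) / W n"
      using W[of n] r y by (intro divide_right_mono Ln_one_plus_exp_taylor) auto
    finally show ?thesis by simp
  qed
  have "norm (clogQ z - (of_real (logQ r) + \<i> * of_real (y * wseries (\<lambda>u. u * sp1 u) r) - of_real (y\<^sup>2 / 2 * wseries (\<lambda>u. u\<^sup>2 * sp2 u) r)))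
     = norm (\<Sum>n. Ln (1 + z ^ wt n) / of_nat (wt n) - a n)"
    using sums_diff[OF b a] by (simp add: sums_iff)
  also have "\<dots> \<le> (\<Sum>n. 8 * \<bar>y\<bar> ^ 3 * (((W n * r) ^ 3 * exp (-(W n * r))) / W n))"
  proof (rule norm_suminf_le[OF term_bound])
    show "summable (\<lambda>n. 8 * \<bar>y\<bar> ^ 3 * (((W n * r) ^ 3 * exp (-(W n * r))) / W n))"
      using s3 by (intro summable_mult sums_summable)
  qed
  also have "\<dots> = 8 * \<bar>y\<bar> ^ 3 * wseries (\<lambda>u. u ^ 3 * exp (-u)) r"
    using sums_mult[OF s3, of "8 * \<bar>y\<bar> ^ 3"] by (simp add: sums_iff)
  finally show ?thesis unfolding z_def .
qed

text \<open>With \<open>y = v / sqrt L\<close> the quantity \<open>y\<^sup>2 * L\<close> is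
  constant. Of the linear term only the part with \<open>ln 2 * ln r\<close> diverges, and it is
  subtracted; the quadratic term tends to \<open>- ln 2 * v\<^sup>2 / 2\<close>; bounded corrections
  and the cubic remainder vanish with \<open>y\<close>.\<close>

lemma clogQ_local:
  fixes v :: real
  defines "y \<equiv> \<lambda>r. v / sqrt (- ln r)"
  shows "((\<lambda>r. clogQ (exp (- (of_real r * (1 + \<i> * of_real (y r))))) - of_real (logQ r) - \<i> * of_real (y r * (ln 2 * ln r)))
     \<longlongrightarrow> - of_real (ln 2 * v\<^sup>2 / 2)) (at_right 0)"
proof -
  obtain c1 where c1: "((\<lambda>r. wseries (\<lambda>u. u * sp1 u) r - ln 2 * ln r) \<longlongrightarrow> c1) (at_right 0)"
    using wseries_sp1 by blast
  obtain c2 where c2: "((\<lambda>r. wseries (\<lambda>u. u\<^sup>2 * sp2 u) r + ln 2 * ln r) \<longlongrightarrow> c2) (at_right 0)"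
    using wseries_sp2 by blast
  obtain J c3 where c3: "((\<lambda>r. wseries (\<lambda>u. u ^ 3 * exp (-u)) r - J * ln r) \<longlongrightarrow> c3) (at_right 0)"
    using wseries_cube_exp by blast
  have y0: "(y \<longlongrightarrow> 0) (at_right 0)"
    unfolding y_def by real_asymp
  have small: "\<forall>\<^sub>F r in at_right 0. r < (1::real)"
    by (rule order_tendstoD(2)[OF tendsto_ident_at]) auto
  have y2: "\<forall>\<^sub>F r in at_right 0. (y r)\<^sup>2 * ln r = - v\<^sup>2"
    using small eventually_at_right_less[of 0]
  proof eventually_elim
    case (elim r)
    then have "ln r < 0" by simp
    then show ?case by (simp add: y_def power_divide)
  qed
  define R where "R r = clogQ (exp (- (of_real r * (1 + \<i> * of_real (y r)))))
      - (of_real (logQ r) + \<i> * of_real (y r * wseries (\<lambda>u. u * sp1 u) r) - of_real ((y r)\<^sup>2 / 2 * wseries (\<lambda>u. u\<^sup>2 * sp2 u) r))" for r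
  have "(R \<longlongrightarrow> 0) (at_right 0)"
  proof (rule Lim_null_comparison)
    have "\<forall>\<^sub>F r in at_right 0. \<bar>y r\<bar> < 1"
      using tendstoD[OF y0, of 1] by (simp add: dist_real_def)
    then show "\<forall>\<^sub>F r in at_right 0. norm (R r) \<le> 8 * (\<bar>y r\<bar> ^ 3 * (wseries (\<lambda>u. u ^ 3 * exp (-u)) r - J * ln r) + \<bar>y r\<bar> * (- v\<^sup>2) * J)"
      using y2 eventually_at_right_less[of 0]
    proof eventually_elim
      case (elim r)
      have "norm (R r) \<le> 8 * \<bar>y r\<bar> ^ 3 * wseries (\<lambda>u. u ^ 3 * exp (-u)) r"
        unfolding R_def using elim by (intro clogQ_taylor) auto
      moreover have "\<bar>y r\<bar> ^ 3 * ln r = \<bar>y r\<bar> * (- v\<^sup>2)"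
      proof -
        have "\<bar>y r\<bar> ^ 3 = \<bar>y r\<bar> * (y r)\<^sup>2" by (simp add: power3_eq_cube power2_eq_square)
        then show ?thesis using elim(2) by (simp add: mult.assoc)
      qed
      then have "\<bar>y r\<bar> ^ 3 * (ln r * J) = \<bar>y r\<bar> * (- v\<^sup>2) * J" by (simp add: mult.assoc[symmetric])
      ultimately show ?case by (simp add: algebra_simps)
    qed
    have "((\<lambda>r. 8 * (\<bar>y r\<bar> ^ 3 * (wseries (\<lambda>u. u ^ 3 * exp (-u)) r - J * ln r) + \<bar>y r\<bar> * (- v\<^sup>2) * J))
       \<longlongrightarrow> 8 * (\<bar>0\<bar> ^ 3 * c3 + \<bar>0\<bar> * (- v\<^sup>2) * J)) (at_right 0)"
      by (intro tendsto_intros y0 c3)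
    then show "((\<lambda>r. 8 * (\<bar>y r\<bar> ^ 3 * (wseries (\<lambda>u. u ^ 3 * exp (-u)) r - J * ln r) + \<bar>y r\<bar> * (- v\<^sup>2) * J)) \<longlongrightarrow> 0) (at_right 0)"
      by simp
  qed
  then have "((\<lambda>r. R r + \<i> * of_real (y r * (wseries (\<lambda>u. u * sp1 u) r - ln 2 * ln r))
      - of_real ((y r)\<^sup>2 / 2 * (wseries (\<lambda>u. u\<^sup>2 * sp2 u) r + ln 2 * ln r)) + of_real (ln 2 / 2 * (- v\<^sup>2)))
    \<longlongrightarrow> 0 + \<i> * of_real (0 * c1) - of_real (0\<^sup>2 / 2 * c2) + of_real (ln 2 / 2 * (- v\<^sup>2))) (at_right 0)"
    by (intro tendsto_intros y0 c1 c2) auto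
  moreover have "\<forall>\<^sub>F r in at_right 0. R r + \<i> * of_real (y r * (wseries (\<lambda>u. u * sp1 u) r - ln 2 * ln r))
      - of_real ((y r)\<^sup>2 / 2 * (wseries (\<lambda>u. u\<^sup>2 * sp2 u) r + ln 2 * ln r)) + of_real (ln 2 / 2 * (- v\<^sup>2))
      = clogQ (exp (- (of_real r * (1 + \<i> * of_real (y r))))) - of_real (logQ r) - \<i> * of_real (y r * (ln 2 * ln r))"
    using y2
  proof eventually_elim
    case (elim r)
    show ?case unfolding elim[symmetric] R_def by (simp add: algebra_simps)
  qed
  ultimately have "((\<lambda>r. clogQ (exp (- (of_real r * (1 + \<i> * of_real (y r))))) - of_real (logQ r) - \<i> * of_real (y r * (ln 2 * ln r)))
     \<longlongrightarrow> 0 + \<i> * of_real (0 * c1) - of_real (0\<^sup>2 / 2 * c2) + of_real (ln 2 / 2 * (- v\<^sup>2))) (at_right 0)"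
    by (rule Lim_transform_eventually)
  then show ?thesis by simp
qed

section \<open>Domination on the circle\<close>

text \<open>Jordan's inequality with \<open>1/2\<close> in place of \<open>2 / pi\<close>. Up to
  \<open>pi / 3\<close> the mean value theorem suffices, as the cosine is at least
  \<open>1/2\<close>; beyond, \<open>sqrt 3 / 2 \<ge> 4/5 \<ge> pi / 4\<close>.\<close>

lemma sin_ge_half:
  fixes x :: real
  assumes "0 \<le> x" "x \<le> pi / 2"
  shows "x / 2 \<le> sin x"
proof (cases "x \<le> pi / 3")
  case True
  show ?thesis
  proof (cases "x = 0")
    case False
    then have x0: "0 < x" using assms by simp
    obtain z where z: "0 < z" "z < x" "sin x - sin 0 = (x - 0) * cos z"
      using MVT2[OF x0, of sin cos] by (auto intro!: derivative_eq_intros)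
    have "cos (pi / 3) \<le> cos z"
      using z True by (intro cos_monotone_0_pi_le) auto
    then have "1 / 2 \<le> cos z" by (simp add: cos_60)
    then have "x * (1 / 2) \<le> x * cos z" using x0 by (intro mult_left_mono) auto
    then show ?thesis using z by simp
  qed simp
next
  case False
  have "sin (pi / 3) \<le> sin x"
    using False assms by (intro sin_monotone_2pi_le) auto
  moreover have "sqrt 3 \<ge> 8 / 5"
    by (rule real_le_rsqrt) (simp add: power2_eq_square)
  moreover have "pi \<le> 16 / 5" using pi_approx(2) by simp
  then have "x / 2 \<le> 4 / 5" using assms by linarith
  ultimately show ?thesis by (simp add: sin_60)
qed

lemma abs_sin_ge_half:
  fixes x :: real
  assumes "\<bar>x\<bar> \<le> pi / 2"
  shows "\<bar>x\<bar> / 2 \<le> \<bar>sin x\<bar>"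
  using sin_ge_half[of "\<bar>x\<bar>"] assms by (auto simp: abs_if split: if_splits)

text \<open>From \<open>\<bar>1 + w\<bar>^2 = (1 + a)^2 - 2 * (a - Re w)\<close>,
  \<open>ln (1 - x) \<le> - x\<close> and \<open>(1 + a)^2 \<le> 4\<close>. The bound is linear in
  \<open>a - Re w\<close>, so after inserting powers of \<open>z\<close> the sum over one divisor
  can be carried out exactly.\<close>

lemma ln_one_plus_deficit:
  fixes w :: complex and a :: real
  assumes a: "norm w = a" "a < 1"
  shows "ln (1 + a) - ln (norm (1 + w)) \<ge> (a - Re w) / 4"
proof -
  have a0: "a \<ge> 0" using a(1) norm_ge_zero by metis
  have w0: "norm (1 + w) > 0" using Re_one_plus_pos[of w] a by (auto simp del: plus_complex.sel)
  define x where "x = 2 * (a - Re w) / (1 + a)\<^sup>2"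
  have aRe: "a - Re w \<ge> 0" using complex_Re_le_cmod[of w] a by simp
  have sq: "(norm (1 + w))\<^sup>2 = (1 + a)\<^sup>2 * (1 - x)"
  proof -
    have "(norm (1 + w))\<^sup>2 = 1 + 2 * Re w + a\<^sup>2"
      unfolding a(1)[symmetric] cmod_power2 by (simp add: power2_eq_square algebra_simps)
    also have "\<dots> = (1 + a)\<^sup>2 - 2 * (a - Re w)" by (simp add: power2_eq_square algebra_simps)
    also have "2 * (a - Re w) = (1 + a)\<^sup>2 * x" using a0 by (simp add: x_def)
    also have "(1 + a)\<^sup>2 - (1 + a)\<^sup>2 * x = (1 + a)\<^sup>2 * (1 - x)" by (simp add: right_diff_distrib)
    finally show ?thesis .
  qed
  have x1: "1 - x > 0"
  proof -
    have "0 < (1 + a)\<^sup>2 * (1 - x)" using sq w0 by (metis zero_less_power)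
    then show ?thesis using a0 by (simp add: zero_less_mult_iff)
  qed
  have "2 * ln (norm (1 + w)) = ln ((norm (1 + w))\<^sup>2)" using w0 by (simp add: ln_realpow)
  also have "\<dots> = 2 * ln (1 + a) + ln (1 - x)"
    unfolding sq using a0 x1 by (subst ln_mult_pos) (auto simp: ln_realpow)
  also have "ln (1 - x) \<le> - x" using ln_le_minus_one[OF x1] by simp
  finally have "ln (1 + a) - ln (norm (1 + w)) \<ge> x / 2" by simp
  moreover have "x / 2 \<ge> (a - Re w) / 4"
  proof -
    have "(1 + a)\<^sup>2 \<le> 2\<^sup>2" using a a0 by (intro power_mono) auto
    then have "(a - Re w) / 4 \<le> (a - Re w) / (1 + a)\<^sup>2"
      using aRe a0 by (intro divide_left_mono) auto
    moreover have "2 * t / b / 2 = t / b" for t b :: real by simp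
    ultimately show ?thesis unfolding x_def by (simp only:)
  qed
  ultimately show ?thesis by linarith
qed

text \<open>Real part of the logarithmic series at \<open>w\<close>, minus the series at
  \<open>norm w\<close>. It evaluates the sum over the second divisor.\<close>

lemma log_deficit_sums:
  fixes w :: complex
  assumes "norm w < 1"
  shows "(\<lambda>j. (norm w ^ Suc j - Re (w ^ Suc j)) / real (Suc j)) sums (ln (norm (1 - w)) - ln (1 - norm w))"
proof -
  have "(\<lambda>n. - ((- (- w)) ^ n) / of_nat n) sums ln (1 + (- w))"
    using assms by (intro Ln_series') auto
  then have "(\<lambda>n. Re (- ((- (- w)) ^ n) / of_nat n)) sums Re (ln (1 + (- w)))"
    by (rule sums_Re)
  moreover have "1 - w \<noteq> 0" using assms by auto
  ultimately have 1: "(\<lambda>n. - (Re (w ^ n) / real n)) sums ln (norm (1 - w))"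
    by (simp add: Re_divide_of_nat)
  have "(\<lambda>n. - ((- (- norm w)) ^ n) / real n) sums ln (1 + (- norm w))"
    using assms by (intro ln_series') auto
  then have 2: "(\<lambda>n. - (norm w ^ n / real n)) sums ln (1 - norm w)" by simp
  from sums_diff[OF 1 2] have "(\<lambda>n. (norm w ^ n - Re (w ^ n)) / real n) sums (ln (norm (1 - w)) - ln (1 - norm w))"
    by (simp add: diff_divide_distrib)
  then show ?thesis by (subst sums_Suc_iff) simp
qed

text \<open>With \<open>\<rho> = exp (-s)\<close>, \<open>\<bar>1 - w\<bar>^2 = (1 - \<rho>)^2 + 4 *
  \<rho> * (sin (\<theta> / 2))^2\<close>, where \<open>1 - \<rho> \<le> s\<close> and, because
  \<open>s \<le> 1\<close>, \<open>4 * \<rho> \<ge> 4 / 3\<close>.\<close>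

lemma log_deficit_lower:
  fixes s \<theta> :: real
  assumes s: "0 < s" "s \<le> 1"
  defines "w \<equiv> exp (- (complex_of_real s + \<i> * of_real \<theta>))"
  shows "ln (norm (1 - w)) - ln (1 - norm w) \<ge> ln (1 + (sin (\<theta> / 2))\<^sup>2 / s\<^sup>2) / 2"
proof -
  define \<rho> where "\<rho> = exp (-s)"
  have nw: "norm w = \<rho>" by (simp add: w_def \<rho>_def norm_exp)
  have \<rho>: "0 < \<rho>" "\<rho> < 1" using s by (auto simp: \<rho>_def)
  have Re_w: "Re w = \<rho> * cos \<theta>" by (simp add: w_def \<rho>_def Re_exp)
  have w1: "norm (1 - w) > 0" using nw \<rho> by auto
  have cos2: "cos \<theta> = 1 - 2 * (sin (\<theta> / 2))\<^sup>2"
    using cos_double_sin[of "\<theta> / 2"] by simp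
  have sq: "(norm (1 - w))\<^sup>2 = (1 - \<rho>)\<^sup>2 + 4 * \<rho> * (sin (\<theta> / 2))\<^sup>2"
  proof -
    have "(norm (1 - w))\<^sup>2 = 1 - 2 * Re w + (norm w)\<^sup>2"
      unfolding cmod_power2 by (simp add: power2_eq_square algebra_simps)
    then show ?thesis unfolding nw Re_w cos2 by (simp add: power2_eq_square algebra_simps)
  qed
  have "1 - \<rho> \<le> s" using exp_ge_add_one_self[of "-s"] by (simp add: \<rho>_def)
  then have "(1 - \<rho>)\<^sup>2 \<le> s\<^sup>2" using \<rho> by (intro power_mono) auto
  moreover have "4 * \<rho> \<ge> 1"
  proof -
    have "exp s \<le> exp 1" using s by simp
    also have "\<dots> \<le> 3" by (rule exp_le)
    finally show ?thesis by (simp add: \<rho>_def exp_minus field_simps)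
  qed
  ultimately have *: "(sin (\<theta> / 2))\<^sup>2 * (1 - \<rho>)\<^sup>2 \<le> 4 * \<rho> * (sin (\<theta> / 2))\<^sup>2 * s\<^sup>2"
  proof -
    assume a: "(1 - \<rho>)\<^sup>2 \<le> s\<^sup>2" "1 \<le> 4 * \<rho>"
    have "(sin (\<theta> / 2))\<^sup>2 * (1 - \<rho>)\<^sup>2 \<le> (sin (\<theta> / 2))\<^sup>2 * s\<^sup>2" using a by (intro mult_left_mono) auto
    also have "\<dots> = 1 * ((sin (\<theta> / 2))\<^sup>2 * s\<^sup>2)" by simp
    also have "\<dots> \<le> 4 * \<rho> * ((sin (\<theta> / 2))\<^sup>2 * s\<^sup>2)" using a by (intro mult_right_mono) auto
    finally show ?thesis by (simp add: mult_ac)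
  qed
  have "(1 - \<rho>)\<^sup>2 * (1 + (sin (\<theta> / 2))\<^sup>2 / s\<^sup>2) \<le> (norm (1 - w))\<^sup>2"
    unfolding sq using * s by (simp add: field_simps)
  then have "ln ((1 - \<rho>)\<^sup>2 * (1 + (sin (\<theta> / 2))\<^sup>2 / s\<^sup>2)) \<le> ln ((norm (1 - w))\<^sup>2)"
    using \<rho> w1 by (intro ln_mono) (auto intro!: mult_pos_pos add_pos_nonneg)
  moreover have "ln ((1 - \<rho>)\<^sup>2 * (1 + (sin (\<theta> / 2))\<^sup>2 / s\<^sup>2)) = 2 * ln (1 - \<rho>) + ln (1 + (sin (\<theta> / 2))\<^sup>2 / s\<^sup>2)"
    using \<rho> by (subst ln_mult_pos) (auto simp: ln_realpow intro!: add_pos_nonneg)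
  ultimately show ?thesis
    unfolding nw using w1 by (simp add: ln_realpow)
qed

text \<open>Each weight \<open>m\<close> loses at least
  \<open>(norm z ^ m - Re (z ^ m)) / (4 * m)\<close>. Summing over the second divisor turns this
  into logarithmic deficits at \<open>z ^ i\<close>; all are nonnegative, and only those with
  \<open>i * r \<le> 1\<close> are kept, where \<open>log_deficit_lower\<close> applies. The factor
  1/8 is 1/4 times 1/2.\<close>

lemma logQ_deficit:
  fixes r y :: real and A :: nat
  assumes r: "r > 0" and A: "real A * r \<le> 1"
  shows "logQ r - Re (clogQ (exp (- (of_real r * (1 + \<i> * of_real y)))))
     \<ge> (\<Sum>i=1..A. ln (1 + (sin (real i * (r * y) / 2))\<^sup>2 / (real i * r)\<^sup>2) / real i) / 8"
proof -
  define z where "z = exp (- (complex_of_real r * (1 + \<i> * of_real y)))"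
  have nz: "norm z = exp (-r)" by (simp add: z_def norm_exp)
  then have z1: "norm z < 1" using r by simp
  define g where "g m = (norm z ^ m - Re (z ^ m)) / real m" for m :: nat
  have g_nonneg: "g m \<ge> 0" for m
    unfolding g_def using complex_Re_le_cmod[of "z ^ m"] by (simp add: norm_power)
  have g_le: "g m \<le> 2 * norm z ^ m" if "m > 0" for m
  proof -
    have "- Re (z ^ m) \<le> norm z ^ m" using abs_Re_le_cmod[of "z ^ m"] by (simp add: norm_power abs_le_iff)
    then have "g m \<le> (2 * norm z ^ m) / real m" unfolding g_def by (intro divide_right_mono) auto
    also have "\<dots> \<le> 2 * norm z ^ m / 1" using that by (intro divide_left_mono) auto
    finally show ?thesis by simp
  qed
  have g_sm: "summable (\<lambda>n. norm (g (wt n)))"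
    by (rule summable_comparison_test'[where N=0 and g="\<lambda>n. 2 * norm z ^ wt n"])
       (use z1 g_nonneg g_le in \<open>auto intro!: summable_mult summable_power_wt\<close>)
  have g_sm': "summable (\<lambda>n. norm (case prod_decode n of (i, j) \<Rightarrow> g (Suc i * Suc j)))"
    using g_sm by (simp add: wt_def case_prod_beta)
  have g_wt: "(case prod_decode n of (i, j) \<Rightarrow> g (Suc i * Suc j)) = g (wt n)" for n
    by (simp add: wt_def split: prod.splits)
  note ds = double_sums[OF g_sm', unfolded g_wt]
  have inner: "(\<Sum>j. g (Suc i * Suc j)) = (ln (norm (1 - z ^ Suc i)) - ln (1 - norm (z ^ Suc i))) / real (Suc i)" for i
  proof -
    have "norm (z ^ Suc i) < 1" unfolding norm_power using z1 by (subst power_less_one_iff) auto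
    from sums_divide[OF log_deficit_sums[OF this], of "real (Suc i)"]
    have "(\<lambda>j. (norm (z ^ Suc i) ^ Suc j - Re ((z ^ Suc i) ^ Suc j)) / real (Suc j) / real (Suc i))
       sums ((ln (norm (1 - z ^ Suc i)) - ln (1 - norm (z ^ Suc i))) / real (Suc i))" .
    moreover have "(norm (z ^ Suc i) ^ Suc j - Re ((z ^ Suc i) ^ Suc j)) / real (Suc j) / real (Suc i) = g (Suc i * Suc j)" for j
      by (simp only: g_def norm_power power_mult[symmetric] of_nat_mult divide_divide_eq_left mult.commute)
    ultimately show ?thesis by (simp add: sums_iff)
  qed
  have lower: "(\<Sum>i=1..A. ln (1 + (sin (real i * (r * y) / 2))\<^sup>2 / (real i * r)\<^sup>2) / real i) / 2 \<le> (\<Sum>n. g (wt n))"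
  proof -
    have "(\<Sum>i=1..A. ln (1 + (sin (real i * (r * y) / 2))\<^sup>2 / (real i * r)\<^sup>2) / real i) / 2
       = (\<Sum>i<A. ln (1 + (sin (real (Suc i) * (r * y) / 2))\<^sup>2 / (real (Suc i) * r)\<^sup>2) / 2 / real (Suc i))"
      by (simp only: One_nat_def sum.atLeast1_atMost_eq sum_divide_distrib divide_divide_eq_left mult.commute)
    also have "\<dots> \<le> (\<Sum>i<A. \<Sum>j. g (Suc i * Suc j))"
    proof (rule sum_mono)
      fix i assume "i \<in> {..<A}"
      then have "real (Suc i) * r \<le> real A * r" using r by (intro mult_right_mono) auto
      with A have "real (Suc i) * r \<le> 1" by linarith
      moreover have "0 < real (Suc i) * r" using r by simp
      ultimately have s: "0 < real (Suc i) * r" "real (Suc i) * r \<le> 1" by blast+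
      have "z ^ Suc i = exp (of_nat (Suc i) * (- (complex_of_real r * (1 + \<i> * of_real y))))"
        unfolding z_def by (rule exp_of_nat_mult[symmetric])
      also have "of_nat (Suc i) * (- (complex_of_real r * (1 + \<i> * of_real y)))
          = - (complex_of_real (real (Suc i) * r) + \<i> * of_real (real (Suc i) * (r * y)))"
        by (simp add: algebra_simps)
      finally have zi: "z ^ Suc i = exp (- (complex_of_real (real (Suc i) * r) + \<i> * of_real (real (Suc i) * (r * y))))" .
      show "ln (1 + (sin (real (Suc i) * (r * y) / 2))\<^sup>2 / (real (Suc i) * r)\<^sup>2) / 2 / real (Suc i) \<le> (\<Sum>j. g (Suc i * Suc j))"
        unfolding inner zi
        by (rule divide_right_mono[OF log_deficit_lower[OF s, of "real (Suc i) * (r * y)"]]) simp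
    qed
    also have "\<dots> \<le> (\<Sum>i. \<Sum>j. g (Suc i * Suc j))"
      by (rule sum_le_suminf[OF sums_summable[OF ds(2)]])
         (auto intro!: suminf_nonneg ds(1) g_nonneg simp del: mult_Suc mult_Suc_right)
    also have "\<dots> = (\<Sum>n. g (wt n))" using ds(2) by (simp add: sums_iff)
    finally show ?thesis .
  qed
  have c: "(\<lambda>n. Re (Ln (1 + z ^ wt n) / of_nat (wt n))) sums Re (clogQ z)"
    unfolding clogQ_def by (rule sums_Re[OF summable_sums[OF summable_norm_cancel[OF summable_norm_clogQ[OF z1]]]])
  have d: "(\<lambda>n. softplus (real (wt n) * r) / real (wt n)) sums logQ r"
    unfolding logQ_def by (rule summable_sums[OF summable_logQ[OF r]])
  have "(\<Sum>n. g (wt n) / 4) \<le> logQ r - Re (clogQ z)"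
  proof (rule sums_le)
    show "(\<lambda>n. g (wt n) / 4) sums (\<Sum>n. g (wt n) / 4)"
      using g_sm by (intro summable_sums summable_divide) (rule summable_norm_cancel)
    show "(\<lambda>n. softplus (real (wt n) * r) / real (wt n) - Re (Ln (1 + z ^ wt n) / of_nat (wt n))) sums (logQ r - Re (clogQ z))"
      by (rule sums_diff[OF d c])
    fix n
    have nzw: "norm (z ^ wt n) = exp (- (real (wt n) * r))"
      using exp_of_nat_mult[of "wt n" "-r"] by (simp add: norm_power nz)
    have lt: "exp (- (real (wt n) * r)) < 1" using r by simp
    have "1 + z ^ wt n \<noteq> 0"
      using Re_one_plus_pos[of "z ^ wt n"] nzw lt by (metis less_irrefl zero_complex.sel(1))
    then have "Re (Ln (1 + z ^ wt n)) = ln (norm (1 + z ^ wt n))" by simp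
    then have "softplus (real (wt n) * r) - Re (Ln (1 + z ^ wt n)) \<ge> (norm z ^ wt n - Re (z ^ wt n)) / 4"
      using ln_one_plus_deficit[OF nzw lt] nzw by (simp add: softplus_def norm_power)
    then have "(norm z ^ wt n - Re (z ^ wt n)) / 4 / real (wt n) \<le> (softplus (real (wt n) * r) - Re (Ln (1 + z ^ wt n))) / real (wt n)"
      by (intro divide_right_mono) auto
    then show "g (wt n) / 4 \<le> softplus (real (wt n) * r) / real (wt n) - Re (Ln (1 + z ^ wt n) / of_nat (wt n))"
      by (simp add: g_def diff_divide_distrib Re_divide_of_nat mult_ac)
  qed
  moreover have "(\<Sum>n. g (wt n) / 4) = (\<Sum>n. g (wt n)) / 4"
    using summable_norm_cancel[OF g_sm] by (rule suminf_divide)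
  ultimately show ?thesis using lower unfolding z_def by linarith
qed

text \<open>
  On the arc \<open>\<bar>r * y\<bar> \<le> sqrt r\<close> every \<open>i \<le> 1 / sqrt r\<close> contributes \<open>ln (1 + y\<^sup>2 / 16) / i\<close> to the deficit.
\<close>

lemma deficit_near:
  fixes r y :: real
  assumes r: "0 < r" "r < 1" and y: "\<bar>r * y\<bar> \<le> sqrt r" and L: "- ln r \<ge> 16"
  shows "logQ r - Re (clogQ (exp (- (of_real r * (1 + \<i> * of_real y))))) \<ge> ln (1 + y\<^sup>2 * (- ln r) / 512)"
proof -
  \<comment> \<open>This cut-off ensures both \<open>i * r \<le> 1\<close> and
    \<open>\<bar>i * r * y\<bar> \<le> 1\<close>, so the sine is at least
    \<open>i * r * \<bar>y\<bar> / 4\<close> in modulus, whence \<open>x = y\<^sup>2 / 16\<close>;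
    still \<open>harm A \<ge> L / 2\<close>.\<close>
  define A where "A = nat \<lfloor>1 / sqrt r\<rfloor>"
  define x where "x = y\<^sup>2 / 16"
  have x0: "x \<ge> 0" by (simp add: x_def)
  have Aub: "real A \<le> 1 / sqrt r" using r by (simp add: A_def)
  have sr: "0 < sqrt r" "sqrt r < 1" using r by auto
  have Ar: "real A * sqrt r \<le> 1" using Aub sr by (simp add: field_simps)
  have "real A * r \<le> 1"
  proof -
    have "real A * r = real A * sqrt r * sqrt r" using r by simp
    also have "\<dots> \<le> 1 * 1" using Ar sr by (intro mult_mono) auto
    finally show ?thesis by simp
  qed
  note def = logQ_deficit[OF r(1) this, of y]
  have "harm A * ln (1 + x) \<le> (\<Sum>i=1..A. ln (1 + (sin (real i * (r * y) / 2))\<^sup>2 / (real i * r)\<^sup>2) / real i)"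
    unfolding harm_def sum_distrib_right
  proof (rule sum_mono)
    fix i assume i: "i \<in> {1..A}"
    have "\<bar>real i * (r * y) / 2\<bar> \<le> 1 / 2"
    proof -
      have "real i * \<bar>r * y\<bar> \<le> real A * sqrt r" using i y by (intro mult_mono) auto
      then show ?thesis using Ar by (simp add: abs_mult)
    qed
    then have "\<bar>real i * (r * y) / 2\<bar> \<le> pi / 2" using pi_gt3 by linarith
    from abs_sin_ge_half[OF this] have "(\<bar>real i * (r * y) / 2\<bar> / 2)\<^sup>2 \<le> \<bar>sin (real i * (r * y) / 2)\<bar>\<^sup>2"
      by (intro power_mono) auto
    then have "(real i * r)\<^sup>2 * x \<le> (sin (real i * (r * y) / 2))\<^sup>2"
      by (simp add: x_def power_mult_distrib power_divide)
    then have "x \<le> (sin (real i * (r * y) / 2))\<^sup>2 / (real i * r)\<^sup>2"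
      using i r by (simp add: field_simps)
    then have "ln (1 + x) \<le> ln (1 + (sin (real i * (r * y) / 2))\<^sup>2 / (real i * r)\<^sup>2)"
      using x0 by simp
    then have "ln (1 + x) / real i \<le> ln (1 + (sin (real i * (r * y) / 2))\<^sup>2 / (real i * r)\<^sup>2) / real i"
      by (intro divide_right_mono) auto
    then show "inverse (real i) * ln (1 + x) \<le> ln (1 + (sin (real i * (r * y) / 2))\<^sup>2 / (real i * r)\<^sup>2) / real i"
      by (simp only: divide_inverse[of "ln (1 + x)"] mult.commute)
  qed
  moreover have "harm A \<ge> - ln r / 2"
  proof -
    have "1 / sqrt r < real A + 1" using r unfolding A_def by linarith
    then have "ln (1 / sqrt r) \<le> ln (real A + 1)" using sr by simp
    moreover have "ln (1 / sqrt r) = - ln r / 2" using r by (simp add: ln_div ln_sqrt)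
    ultimately show ?thesis using ln_le_harm[of A] by linarith
  qed
  then have "- ln r / 2 * ln (1 + x) \<le> harm A * ln (1 + x)" using x0 by (intro mult_right_mono) auto
  ultimately have 1: "- ln r / 16 * ln (1 + x) \<le> logQ r - Re (clogQ (exp (- (of_real r * (1 + \<i> * of_real y)))))"
    using def by linarith
  \<comment> \<open>Bernoulli's inequality requires an integer exponent. Since
    \<open>L \<ge> 16\<close>, rounding \<open>L / 16\<close> down loses at most a factor 2, and 512
    is 16 times 32.\<close>
  define N where "N = nat \<lfloor>- ln r / 16\<rfloor>"
  have N: "real N \<le> - ln r / 16" "- ln r / 32 \<le> real N"
  proof -
    show "real N \<le> - ln r / 16" using L by (simp add: N_def)
    have "- ln r / 16 < real N + 1" using L unfolding N_def by linarith
    moreover have "real N \<ge> 1" using L by (simp add: N_def le_nat_iff)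
    ultimately show "- ln r / 32 \<le> real N" by linarith
  qed
  have "y\<^sup>2 * (- ln r) / 512 = x * (- ln r / 32)" by (simp add: x_def)
  also have "\<dots> \<le> x * real N" using N x0 by (intro mult_left_mono) auto
  finally have "1 + y\<^sup>2 * (- ln r) / 512 \<le> 1 + real N * x" by (simp add: mult.commute)
  also have "\<dots> \<le> (1 + x) ^ N" using x0 by (intro Bernoulli_inequality) auto
  finally have "1 + y\<^sup>2 * (- ln r) / 512 \<le> (1 + x) ^ N" .
  moreover have "0 \<le> y\<^sup>2 * (- ln r) / 512" using L by (intro divide_nonneg_nonneg mult_nonneg_nonneg) auto
  ultimately have "ln (1 + y\<^sup>2 * (- ln r) / 512) \<le> ln ((1 + x) ^ N)"
    by (intro ln_mono) auto
  also have "\<dots> = real N * ln (1 + x)" using x0 by (simp add: ln_realpow)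
  also have "\<dots> \<le> - ln r / 16 * ln (1 + x)" using N x0 by (intro mult_right_mono) auto
  finally show ?thesis using 1 by linarith
qed

lemma sum_pairs: "(\<Sum>i=1..2*K. h i) = (\<Sum>k=1..K. h (2 * k - 1) + h (2 * k))" for h :: "nat \<Rightarrow> real"
  by (induction K) auto

text \<open>
  Away from the positive axis \<open>sin (i * \<phi> / 2)\<close> may be small, but not for two consecutive \<open>i\<close>,
  since \<open>\<bar>sin (\<phi> / 2)\<bar>\<close> is at most the sum of the two absolute values.
\<close>

lemma deficit_far:
  fixes r y :: real
  assumes r: "0 < r" "r < 1/16" and y: "sqrt r \<le> \<bar>r * y\<bar>" "\<bar>r * y\<bar> \<le> pi" and L: "- ln r \<ge> 4 * ln 256"
  shows "logQ r - Re (clogQ (exp (- (of_real r * (1 + \<i> * of_real y))))) \<ge> (ln r)\<^sup>2 / 256"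
proof -
  \<comment> \<open>For \<open>i \<le> 2 * K\<close>,
    \<open>(i * r)\<^sup>2 \<le> 4 * r powr (3/2)\<close> is much smaller than
    \<open>r / 64\<close>, so a good index gains \<open>L / 2 - ln 256 \<ge> L / 4\<close>; yet
    \<open>harm K \<ge> L / 4\<close>. Altogether this is
    \<open>L / 4 * L / 8 / 8 = L\<^sup>2 / 256\<close>.\<close>
  define K where "K = nat \<lfloor>r powr (-1/4)\<rfloor>"
  define \<phi> where "\<phi> = r * y"
  define L where "L = - ln r"
  have L0: "L > 0" using r by (simp add: L_def)
  have Kub: "real K \<le> r powr (-1/4)" by (simp add: K_def)
  have "real (2 * K) * r \<le> 1"
  proof -
    have "real (2 * K) * r \<le> 2 * r powr (-1/4) * r" using Kub r by (simp add: mult_right_mono)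
    also have "\<dots> = 2 * r powr (3/4)" using r powr_add[of r "-1/4" 1] by simp
    also have "r powr (3/4) \<le> (1/16) powr (3/4)" using r by (intro powr_mono2) auto
    also have "(1/16::real) powr (3/4) \<le> (1/16) powr (1/2)" by (intro powr_mono') auto
    also have "(1/16::real) powr (1/2) = 1/4" by (simp add: powr_half_sqrt real_sqrt_divide)
    finally show ?thesis by simp
  qed
  note def = logQ_deficit[OF r(1) this, of y]
  define h where "h i = ln (1 + (sin (real i * \<phi> / 2))\<^sup>2 / (real i * r)\<^sup>2) / real i" for i
  have "harm K * (L / 8) \<le> (\<Sum>k=1..K. h (2 * k - 1) + h (2 * k))"
    unfolding harm_def sum_distrib_right
  proof (rule sum_mono)
    fix k assume k: "k \<in> {1..K}"
    then have k1: "k \<ge> 1" by simp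
    define a where "a = sin (real (2 * k - 1) * \<phi> / 2)"
    define b where "b = sin (real (2 * k) * \<phi> / 2)"
    have sphi: "(sin (\<phi> / 2))\<^sup>2 \<ge> r / 16"
    proof -
      have "\<bar>\<phi> / 2\<bar> \<le> pi / 2" using y by (simp add: \<phi>_def)
      from abs_sin_ge_half[OF this] have "(\<bar>\<phi> / 2\<bar> / 2)\<^sup>2 \<le> \<bar>sin (\<phi> / 2)\<bar>\<^sup>2" by (intro power_mono) auto
      moreover have "(sqrt r)\<^sup>2 \<le> \<bar>\<phi>\<bar>\<^sup>2" using y r unfolding \<phi>_def by (intro power_mono) auto
      ultimately show ?thesis using r by (simp add: power_divide)
    qed
    have tri: "\<bar>sin (\<phi> / 2)\<bar> \<le> \<bar>a\<bar> + \<bar>b\<bar>"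
    proof -
      have "\<phi> / 2 = real (2 * k) * \<phi> / 2 - real (2 * k - 1) * \<phi> / 2"
        using k1 by (simp add: of_nat_diff algebra_simps diff_divide_distrib)
      then have "sin (\<phi> / 2) = b * cos (real (2 * k - 1) * \<phi> / 2) - cos (real (2 * k) * \<phi> / 2) * a"
        unfolding a_def b_def by (metis sin_diff)
      also have "\<bar>\<dots>\<bar> \<le> \<bar>b\<bar> * \<bar>cos (real (2 * k - 1) * \<phi> / 2)\<bar> + \<bar>cos (real (2 * k) * \<phi> / 2)\<bar> * \<bar>a\<bar>"
        by (simp flip: abs_mult)
      also have "\<dots> \<le> \<bar>b\<bar> * 1 + 1 * \<bar>a\<bar>" by (intro add_mono mult_left_mono mult_right_mono) auto
      finally show ?thesis by simp
    qed
    \<comment> \<open>Otherwise \<open>(\<bar>a\<bar> + \<bar>b\<bar>)\<^sup>2 \<le> 2 * a\<^sup>2 +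
      2 * b\<^sup>2 < r / 16\<close>, contradicting \<open>sphi\<close>.\<close>
    have "r / 64 \<le> a\<^sup>2 \<or> r / 64 \<le> b\<^sup>2"
    proof (rule ccontr)
      assume "\<not> ?thesis"
      then have "a\<^sup>2 < r / 64" "b\<^sup>2 < r / 64" by auto
      moreover have "(sin (\<phi> / 2))\<^sup>2 \<le> (\<bar>a\<bar> + \<bar>b\<bar>)\<^sup>2" using power_mono[OF tri, of 2] by simp
      moreover have "(\<bar>a\<bar> + \<bar>b\<bar>)\<^sup>2 \<le> 2 * a\<^sup>2 + 2 * b\<^sup>2"
        using sum_squares_bound[of "\<bar>a\<bar>" "\<bar>b\<bar>"] by (simp add: power2_sum)
      ultimately show False using sphi by linarith
    qed
    have large: "L / 8 / real k \<le> h i" if i: "0 < i" "i \<le> 2 * k" and s: "r / 64 \<le> (sin (real i * \<phi> / 2))\<^sup>2" for i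
    proof -
      have "real k \<le> r powr (-1/4)" using k Kub by (meson atLeastAtMost_iff of_nat_le_iff order.trans)
      then have "(real k)\<^sup>2 \<le> (r powr (-1/4))\<^sup>2" by (intro power_mono) auto
      also have "(r powr (-1/4))\<^sup>2 = r powr (-1/2)" using r by (simp add: power2_eq_square flip: powr_add)
      finally have k2: "(real k)\<^sup>2 \<le> r powr (-1/2)" .
      have "(real i * r)\<^sup>2 \<le> (2 * real k * r)\<^sup>2" using i r by (intro power_mono mult_right_mono) auto
      also have "\<dots> = 4 * r\<^sup>2 * (real k)\<^sup>2" by (simp add: power_mult_distrib)
      also have "\<dots> \<le> 4 * r\<^sup>2 * r powr (-1/2)" using k2 by (intro mult_left_mono) auto
      finally have den: "(real i * r)\<^sup>2 \<le> 4 * r\<^sup>2 * r powr (-1/2)" .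
      have "r powr (-1/2) / 256 = (r / 64) / (4 * r\<^sup>2 * r powr (-1/2))"
      proof -
        have "r powr (-1/2) * r powr (-1/2) * r = 1" using r by (simp flip: powr_add add: powr_minus_divide)
        then show ?thesis using r by (simp add: field_simps power2_eq_square)
      qed
      also have "\<dots> \<le> (sin (real i * \<phi> / 2))\<^sup>2 / (real i * r)\<^sup>2"
        using s den r i by (intro frac_le) auto
      finally have "r powr (-1/2) / 256 \<le> (sin (real i * \<phi> / 2))\<^sup>2 / (real i * r)\<^sup>2" .
      then have "ln (r powr (-1/2) / 256) \<le> ln (1 + (sin (real i * \<phi> / 2))\<^sup>2 / (real i * r)\<^sup>2)"
        using r by (intro ln_mono) auto
      moreover have "ln (r powr (-1/2) / 256) = L / 2 - ln 256"
        using r by (simp add: ln_div ln_powr L_def)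
      ultimately have "L / 4 \<le> ln (1 + (sin (real i * \<phi> / 2))\<^sup>2 / (real i * r)\<^sup>2)"
        using \<open>- ln r \<ge> 4 * ln 256\<close> unfolding L_def by linarith
      then have "L / 4 / real i \<le> h i" unfolding h_def by (intro divide_right_mono) auto
      moreover have "L / 8 / real k = L / 4 / (2 * real k)" by simp
      moreover have "L / 4 / (2 * real k) \<le> L / 4 / real i" using i L0 by (intro divide_left_mono) auto
      ultimately show ?thesis by linarith
    qed
    have hnn: "h i \<ge> 0" for i unfolding h_def by (intro divide_nonneg_nonneg) auto
    have "L / 8 / real k \<le> h (2 * k - 1) + h (2 * k)"
      using \<open>r / 64 \<le> a\<^sup>2 \<or> r / 64 \<le> b\<^sup>2\<close>
    proof
      assume "r / 64 \<le> a\<^sup>2"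
      then have "L / 8 / real k \<le> h (2 * k - 1)" using k1 unfolding a_def by (intro large) auto
      then show ?thesis using hnn[of "2 * k"] by linarith
    next
      assume "r / 64 \<le> b\<^sup>2"
      then have "L / 8 / real k \<le> h (2 * k)" using k1 unfolding b_def by (intro large) auto
      then show ?thesis using hnn[of "2 * k - 1"] by linarith
    qed
    then show "inverse (real k) * (L / 8) \<le> h (2 * k - 1) + h (2 * k)"
      by (simp only: divide_inverse[of "L / 8"] mult.commute)
  qed
  then have "harm K * (L / 8) \<le> (\<Sum>i=1..2*K. h i)" by (simp only: sum_pairs)
  moreover have "harm K \<ge> L / 4"
  proof -
    have "r powr (-1/4) < real K + 1" unfolding K_def by linarith
    then have "ln (r powr (-1/4)) \<le> ln (real K + 1)" using r by (intro ln_mono) auto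
    then show ?thesis using ln_le_harm[of K] r by (simp add: ln_powr L_def)
  qed
  then have "L / 4 * (L / 8) \<le> harm K * (L / 8)" using L0 by (intro mult_right_mono) auto
  ultimately show ?thesis
    using def unfolding h_def \<phi>_def L_def by (simp add: power2_eq_square)
qed

text \<open>On the far arc the deficit is of order \<open>L\<^sup>2\<close>, whereas
  \<open>\<bar>y\<bar> \<le> pi / r\<close> keeps \<open>ln (1 + y\<^sup>2 * L / 512)\<close> of
  order \<open>L\<close>; so the majorant obtained near the axis serves the whole circle.\<close>

lemma logQ_domination:
  "\<forall>\<^sub>F r in at_right 0. \<forall>y. \<bar>r * y\<bar> \<le> pi \<longrightarrow>
     Re (clogQ (exp (- (of_real r * (1 + \<i> * of_real y))))) \<le> logQ r - ln (1 + y\<^sup>2 * (- ln r) / 512)"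
proof -
  have "\<forall>\<^sub>F r::real in at_right 0. - ln r \<ge> 16" by real_asymp
  moreover have "\<forall>\<^sub>F r::real in at_right 0. - ln r \<ge> 4 * ln 256" by real_asymp
  moreover have "\<forall>\<^sub>F r::real in at_right 0. r < 1/16"
    by (rule order_tendstoD(2)[OF tendsto_ident_at]) auto
  moreover have "\<forall>\<^sub>F r::real in at_right 0. 1 + pi\<^sup>2 / r\<^sup>2 * (- ln r) / 512 \<le> exp ((ln r)\<^sup>2 / 256)" by real_asymp
  ultimately show ?thesis
    using eventually_at_right_less[of 0]
  proof eventually_elim
    case (elim r)
    show ?case
    proof (intro allI impI)
      fix y assume y: "\<bar>r * y\<bar> \<le> pi"
      show "Re (clogQ (exp (- (of_real r * (1 + \<i> * of_real y))))) \<le> logQ r - ln (1 + y\<^sup>2 * (- ln r) / 512)"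
      proof (cases "\<bar>r * y\<bar> \<le> sqrt r")
        case True
        then show ?thesis using deficit_near[of r y] elim by linarith
      next
        case False
        have "y\<^sup>2 \<le> pi\<^sup>2 / r\<^sup>2"
          using power_mono[OF y, of 2] elim by (simp add: field_simps power_mult_distrib)
        then have "y\<^sup>2 * (- ln r) / 512 \<le> pi\<^sup>2 / r\<^sup>2 * (- ln r) / 512"
          using elim by (intro divide_right_mono mult_right_mono) auto
        then have "1 + y\<^sup>2 * (- ln r) / 512 \<le> exp ((ln r)\<^sup>2 / 256)" using elim by linarith
        moreover have "0 \<le> y\<^sup>2 * (- ln r) / 512" using elim by (intro divide_nonneg_nonneg mult_nonneg_nonneg) auto
        ultimately have "ln (1 + y\<^sup>2 * (- ln r) / 512) \<le> (ln r)\<^sup>2 / 256"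
          using ln_mono[of "1 + y\<^sup>2 * (- ln r) / 512" "exp ((ln r)\<^sup>2 / 256)"] by simp
        moreover have "(ln r)\<^sup>2 / 256 \<le> logQ r - Re (clogQ (exp (- (of_real r * (1 + \<i> * of_real y)))))"
          using False y elim by (intro deficit_far) auto
        ultimately show ?thesis by linarith
      qed
    qed
  qed
qed

section \<open>The saddle point integral\<close>

lemma Q_fun_holomorphic: "Q_fun holomorphic_on ball 0 1"
proof -
  have "(\<lambda>z. exp (clogQ z)) holomorphic_on ball 0 1"
    by (intro holomorphic_intros clogQ_holomorphic)
  then show ?thesis
    by (rule holomorphic_transform) (auto simp: Q_fun_eq)
qed

text \<open>Cauchy's formula for \<open>Q_fun (- z)\<close>, which centres the range of integration at the positive axis.\<close>

lemma Q_coeff_has_integral: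
  assumes \<rho>: "0 < \<rho>" "\<rho> < 1"
  shows "((\<lambda>t. Q_fun (of_real \<rho> * cis (t - pi)) / (of_real \<rho> * cis (t - pi)) ^ n) has_integral (2 * pi * Q_coeff n)) {0..2*pi}"
proof -
  define f where "f w = Q_fun ((-1) * w)" for w
  have hol: "f holomorphic_on ball 0 1"
  proof -
    have "(Q_fun \<circ> (\<lambda>w. (-1) * w)) holomorphic_on ball 0 1"
      by (intro holomorphic_on_compose_gen[OF _ Q_fun_holomorphic] holomorphic_intros) auto
    then show ?thesis by (simp add: f_def[abs_def] o_def)
  qed
  have hd: "(deriv ^^ n) f 0 = (-1) ^ n * (deriv ^^ n) Q_fun 0"
    unfolding f_def using higher_deriv_compose_linear[OF Q_fun_holomorphic open_ball open_ball, of 0 0 1 "-1" n] by simp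
  have sub: "cball (0::complex) \<rho> \<subseteq> ball 0 1" using \<rho> by auto
  have "((\<lambda>u. f u / (u - 0) ^ Suc n) has_contour_integral (2 * pi * \<i>) / fact n * (deriv ^^ n) f 0) (circlepath 0 \<rho>)"
  proof (rule Cauchy_has_contour_integral_higher_derivative_circlepath)
    show "continuous_on (cball 0 \<rho>) f"
      using holomorphic_on_imp_continuous_on[OF hol] sub by (rule continuous_on_subset)
    show "f holomorphic_on ball 0 \<rho>"
      using hol by (rule holomorphic_on_subset) (use \<rho> in auto)
  qed (use \<rho> in auto)
  then have "((\<lambda>t. f (0 + \<rho> * cis t) / (0 + \<rho> * cis t - 0) ^ Suc n * \<rho> * \<i> * cis t) has_integral
      (2 * pi * \<i>) / fact n * (deriv ^^ n) f 0) {0..2*pi}"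
    unfolding circlepath_def by (subst (asm) has_contour_integral_part_circlepath_iff) auto
  then have "((\<lambda>t. ((-1) ^ n / \<i>) * (f (0 + \<rho> * cis t) / (0 + \<rho> * cis t - 0) ^ Suc n * \<rho> * \<i> * cis t)) has_integral
      ((-1) ^ n / \<i>) * ((2 * pi * \<i>) / fact n * (deriv ^^ n) f 0)) {0..2*pi}"
    by (rule has_integral_mult_right)
  moreover have "((-1) ^ n / \<i>) * ((2 * pi * \<i>) / fact n * (deriv ^^ n) f 0) = 2 * pi * Q_coeff n"
  proof -
    have "s / \<i> * ((2 * pi * \<i>) / F * (s * D)) = (s * s) * (2 * pi * (D / F))" if "F \<noteq> 0" for s D F :: complex
      using that by (simp add: divide_simps)
    from this[of "fact n" "(-1) ^ n" "(deriv ^^ n) Q_fun 0"] show ?thesis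
      unfolding hd Q_coeff_def fps_expansion_def by (simp flip: power_mult_distrib)
  qed
  moreover have "((-1) ^ n / \<i>) * (f (0 + \<rho> * cis t) / (0 + \<rho> * cis t - 0) ^ Suc n * \<rho> * \<i> * cis t)
     = Q_fun (of_real \<rho> * cis (t - pi)) / (of_real \<rho> * cis (t - pi)) ^ n" for t
  proof -
    define u where "u = of_real \<rho> * cis t"
    have u0: "u \<noteq> 0" using \<rho> by (simp add: u_def)
    have cu: "of_real \<rho> * cis (t - pi) = - u"
      by (simp add: u_def cis_divide[symmetric])
    have "a / \<i> * (X * q * \<i> * c) = a * (X * (q * c))" for a X q c :: complex by (simp add: mult_ac)
    from this[of "(-1) ^ n" "f u / u ^ Suc n" "of_real \<rho>" "cis t"]
    have "((-1) ^ n / \<i>) * (f u / u ^ Suc n * \<rho> * \<i> * cis t) = (-1) ^ n * (f u / u ^ Suc n * u)"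
      unfolding u_def[symmetric] .
    also have "f u / u ^ Suc n * u = f u / u ^ n" using u0 by simp
    also have "(-1) ^ n * (f u / u ^ n) = f u / (- u) ^ n"
    proof -
      have "s * (X / P) = X / (s * P)" if "s * s = 1" for s X P :: complex
      proof -
        have s0: "s \<noteq> 0" using that by auto
        have "X / (s * P) = (s * s) * X / (s * P)" using that by simp
        also have "\<dots> = s * (X / P)" using s0 by (simp add: mult.assoc)
        finally show ?thesis by simp
      qed
      moreover have "(-1) ^ n * (-1) ^ n = (1 :: complex)" by (simp flip: power_mult_distrib)
      ultimately show ?thesis unfolding power_minus[of u] by blast
    qed
    finally show ?thesis unfolding cu by (simp add: u_def f_def)
  qed
  ultimately show ?thesis by simp
qed

text \<open>The integrand of Cauchy's formula at \<open>z = exp (- r * (1 + \<i> * y))\<close>,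
  divided by its value at \<open>y = 0\<close>. The last exponent comes from \<open>z\<close> to the
  power \<open>-n\<close>, and the indicator restricts \<open>y\<close> to one turn of the
  circle.\<close>

definition kern :: "nat \<Rightarrow> real \<Rightarrow> real \<Rightarrow> complex" where
  "kern n r y = indicator {y. \<bar>r * y\<bar> \<le> pi} y *
     exp (clogQ (exp (- (of_real r * (1 + \<i> * of_real y)))) - of_real (logQ r) + \<i> * of_real (real n * r * y))"

lemma continuous_clogQ_exp:
  assumes "r > 0"
  shows "continuous_on UNIV (\<lambda>y. clogQ (exp (- (of_real r * (1 + \<i> * of_real y)))))"
  by (rule continuous_on_compose2[OF holomorphic_on_imp_continuous_on[OF clogQ_holomorphic]])
     (use assms in \<open>auto intro!: continuous_intros simp: norm_exp\<close>)

lemma kern_measurable: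
  assumes "r > 0" "s > 0"
  shows "(\<lambda>v. kern n r (v / s)) \<in> borel_measurable borel"
proof -
  have "(\<lambda>y. clogQ (exp (- (of_real r * (1 + \<i> * of_real y))))) \<in> borel_measurable borel"
    by (rule borel_measurable_continuous_onI[OF continuous_clogQ_exp[OF assms(1)]])
  then have [measurable]: "kern n r \<in> borel_measurable borel"
    unfolding kern_def[abs_def] by measurable
  show ?thesis by measurable
qed

text \<open>The scale \<open>s\<close> is free here and later becomes \<open>sqrt L\<close>, the
  value for which the integrand converges; \<open>r / s\<close> is the Jacobian.\<close>

lemma Q_coeff_integral:
  assumes r: "r > 0" and s: "s > 0"
  shows "2 * pi * Q_coeff n = of_real (r / s * exp (logQ r + real n * r)) * (LINT v|lborel. kern n r (v / s))"
proof -
  define \<rho> where "\<rho> = exp (-r)"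
  have \<rho>: "0 < \<rho>" "\<rho> < 1" using r by (auto simp: \<rho>_def)
  define G where "G t = Q_fun (of_real \<rho> * cis t) / (of_real \<rho> * cis t) ^ n" for t
  have "continuous_on UNIV G"
    unfolding G_def
  proof (intro continuous_intros)
    show "continuous_on UNIV (\<lambda>t. Q_fun (of_real \<rho> * cis t))"
      by (rule continuous_on_compose2[OF holomorphic_on_imp_continuous_on[OF Q_fun_holomorphic]])
         (use \<rho> in \<open>auto intro!: continuous_intros simp: norm_mult\<close>)
  qed (use \<rho> in auto)
  then have cont: "continuous_on A (\<lambda>t. G (t - pi))" for A
    by (rule continuous_on_compose2) (auto intro!: continuous_intros)
  have si: "set_integrable lborel {0..2*pi} (\<lambda>t. G (t - pi))"
    by (rule borel_integrable_atLeastAtMost'[OF cont])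
  have "2 * pi * Q_coeff n = integral {0..2*pi} (\<lambda>t. G (t - pi))"
    using Q_coeff_has_integral[OF \<rho>, of n] unfolding G_def by (simp add: integral_unique)
  also have "\<dots> = (LINT t|lborel. indicator {0..2*pi} t *\<^sub>R G (t - pi))"
    using set_borel_integral_eq_integral(2)[OF si] by (simp add: set_lebesgue_integral_def)
  \<comment> \<open>The point \<open>exp (- r * (1 + \<i> * y))\<close> has angle
    \<open>- r * y\<close>, so the substitution is \<open>t - pi = - r * y\<close> with
    \<open>y = v / s\<close>.\<close>
  also have "\<dots> = \<bar>- (r / s)\<bar> *\<^sub>R (LINT v|lborel. indicator {0..2*pi} (pi + (- (r / s)) * v) *\<^sub>R G (pi + (- (r / s)) * v - pi))"
    by (rule lborel_integral_real_affine) (use r s in auto)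
  also have "(LINT v|lborel. indicator {0..2*pi} (pi + (- (r / s)) * v) *\<^sub>R G (pi + (- (r / s)) * v - pi))
     = (LINT v|lborel. of_real (exp (logQ r + real n * r)) * kern n r (v / s))"
  proof (rule Bochner_Integration.integral_cong)
    fix v :: real
    define y where "y = v / s"
    have rv: "(- (r / s)) * v = - (r * y)" by (simp add: y_def)
    define z where "z = exp (- (complex_of_real r * (1 + \<i> * of_real y)))"
    have z: "of_real \<rho> * cis (- (r * y)) = z"
      by (simp add: z_def \<rho>_def cis_conv_exp exp_of_real[symmetric] algebra_simps flip: exp_add)
    have nz: "norm z < 1" using r by (simp add: z_def norm_exp)
    have "G (- (r * y)) = exp (clogQ z) * exp (of_nat n * (complex_of_real r * (1 + \<i> * of_real y)))"
      unfolding G_def z using nz by (simp add: Q_fun_eq z_def exp_of_nat_mult exp_minus divide_inverse power_inverse)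
    also have "\<dots> = of_real (exp (logQ r + real n * r)) * exp (clogQ z - of_real (logQ r) + \<i> * of_real (real n * r * y))"
      unfolding exp_of_real[symmetric] exp_add[symmetric] by (rule arg_cong[where f=exp]) (simp add: algebra_simps)
    finally have Gv: "G (- (r * y)) = of_real (exp (logQ r + real n * r)) * exp (clogQ z - of_real (logQ r) + \<i> * of_real (real n * r * y))" .
    have ind: "indicator {0..2*pi} (pi + - (r * y)) = (indicator {y. \<bar>r * y\<bar> \<le> pi} y :: real)"
      by (auto simp: indicator_def abs_le_iff)
    have "indicator {0..2*pi} (pi + - (r * y)) *\<^sub>R G (pi + - (r * y) - pi) = of_real (exp (logQ r + real n * r)) * kern n r y"
      unfolding ind using Gv by (simp add: kern_def z_def[symmetric] indicator_def scaleR_conv_of_real)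
    then show "indicator {0..2*pi} (pi + (- (r / s)) * v) *\<^sub>R G (pi + (- (r / s)) * v - pi) = of_real (exp (logQ r + real n * r)) * kern n r (v / s)"
      unfolding rv y_def[symmetric] .
  qed simp
  finally show ?thesis
    using r s by (simp add: scaleR_conv_of_real)
qed

lemma integrable_inverse_quadratic: "integrable lborel (\<lambda>v::real. 1 / (1 + v\<^sup>2 / 512))"
proof (rule Bochner_Integration.integrable_bound)
  show "integrable lborel (\<lambda>v::real. 512 * inverse (1 + v\<^sup>2))"
    using integrable_inverse_1_plus_square by (auto simp: set_integrable_def)
  show "AE v in lborel. norm (1 / (1 + v\<^sup>2 / 512)) \<le> norm (512 * inverse (1 + v\<^sup>2) :: real)"
  proof (rule AE_I2)
    fix v :: real
    have pos: "0 < 1 + v\<^sup>2 / 512" "0 < 1 + v\<^sup>2" by (auto intro: add_pos_nonneg)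
    then have "1 / (1 + v\<^sup>2 / 512) \<le> 512 * inverse (1 + v\<^sup>2)"
      by (simp add: field_simps)
    then show "norm (1 / (1 + v\<^sup>2 / 512)) \<le> norm (512 * inverse (1 + v\<^sup>2) :: real)"
      using pos by simp
  qed
qed measurable

lemma gaussian_integral:
  assumes l: "l > 0"
  shows "(LINT v|lborel. exp (- (l * v\<^sup>2 / 2))) = sqrt (2 * pi / l)"
proof -
  define S where "S = sqrt (2 * pi / l)"
  have S: "S > 0" using l by (simp add: S_def)
  have nd: "normal_density 0 (1 / sqrt l) v = 1 / S * exp (- (l * v\<^sup>2 / 2))" for v
    using l by (simp add: normal_density_def power_divide mult.commute S_def)
  have "1 = (LINT v|lborel. normal_density 0 (1 / sqrt l) v)"
    using l by (intro integral_normal_density[symmetric]) auto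
  also have "\<dots> = 1 / S * (LINT v|lborel. exp (- (l * v\<^sup>2 / 2)))"
    unfolding nd by (rule integral_mult_right_zero)
  finally show ?thesis using S unfolding S_def[symmetric] by (simp add: field_simps)
qed

text \<open>The hypothesis \<open>saddle\<close> makes the phase \<open>n * r * y\<close> cancel the
  divergent part \<open>y * l * ln r\<close> left in \<open>clogQ_local\<close>. The remaining phase
  \<open>- d * y\<close> tends to 0, so any constant \<open>d\<close> is admissible.\<close>

lemma Q_coeff_saddle:
  fixes r :: "nat \<Rightarrow> real" and l d :: real
  assumes l: "l = ln 2" and r0: "filterlim r (at_right 0) sequentially"
    and saddle: "\<forall>\<^sub>F n in sequentially. real n * r n = - d - l * ln (r n)"
  shows "(\<lambda>n. Q_coeff n / of_real (r n / sqrt (- ln (r n)) * exp (logQ (r n) + real n * r n)))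
     \<longlonglongrightarrow> of_real (1 / sqrt (2 * pi * l))"
proof -
  define s where "s n = sqrt (- ln (r n))" for n
  have l0: "l > 0" using l by simp
  have ev: "\<forall>\<^sub>F n in sequentially. 0 < r n \<and> r n < 1 \<and> (\<forall>y. \<bar>r n * y\<bar> \<le> pi \<longrightarrow>
     Re (clogQ (exp (- (of_real (r n) * (1 + \<i> * of_real y))))) \<le> logQ (r n) - ln (1 + y\<^sup>2 * (- ln (r n)) / 512))
     \<and> real n * r n = - d - l * ln (r n)"
  proof -
    have "\<forall>\<^sub>F r in at_right 0. r < (1::real)"
      by (rule order_tendstoD(2)[OF tendsto_ident_at]) auto
    then show ?thesis
      using eventually_compose_filterlim[OF logQ_domination r0] eventually_compose_filterlim[OF eventually_at_right_less[of 0] r0]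
        eventually_compose_filterlim[OF _ r0, of "\<lambda>r. r < 1"] saddle
      by (auto simp: eventually_conj_iff)
  qed
  then obtain N where N: "\<And>n. n \<ge> N \<Longrightarrow> 0 < r n \<and> r n < 1 \<and> (\<forall>y. \<bar>r n * y\<bar> \<le> pi \<longrightarrow>
     Re (clogQ (exp (- (of_real (r n) * (1 + \<i> * of_real y))))) \<le> logQ (r n) - ln (1 + y\<^sup>2 * (- ln (r n)) / 512))
     \<and> real n * r n = - d - l * ln (r n)"
    by (auto simp: eventually_sequentially)
  have s_pos: "s n > 0" if "n \<ge> N" for n
    using N[OF that] by (simp add: s_def)
  \<comment> \<open>Dominated convergence asks for the bound at every index, whereas it holds only
    from \<open>N\<close> on; \<open>LIMSEQ_offset\<close> later removes the shift.\<close>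
  have "(\<lambda>n. LINT v|lborel. kern (n + N) (r (n + N)) (v / s (n + N))) \<longlonglongrightarrow> (LINT v|lborel. complex_of_real (exp (- (l * v\<^sup>2 / 2))))"
  proof (rule integral_dominated_convergence[where w="\<lambda>v. 1 / (1 + v\<^sup>2 / 512)"])
    show "(\<lambda>v. kern (n + N) (r (n + N)) (v / s (n + N))) \<in> borel_measurable lborel" for n
      using kern_measurable[of "r (n + N)" "s (n + N)"] N[of "n + N"] s_pos[of "n + N"] by simp
    show "integrable lborel (\<lambda>v::real. 1 / (1 + v\<^sup>2 / 512))" by (rule integrable_inverse_quadratic)
    show "AE v in lborel. norm (kern (n + N) (r (n + N)) (v / s (n + N))) \<le> 1 / (1 + v\<^sup>2 / 512)" for n
    proof (rule AE_I2)
      fix v :: real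
      define m where "m = n + N"
      have m: "m \<ge> N" by (simp add: m_def)
      define y where "y = v / s m"
      have yL: "y\<^sup>2 * (- ln (r m)) = v\<^sup>2"
        using N[OF m] s_pos[OF m] by (simp add: y_def s_def power_divide)
      show "norm (kern (n + N) (r (n + N)) (v / s (n + N))) \<le> 1 / (1 + v\<^sup>2 / 512)"
        unfolding m_def[symmetric] y_def[symmetric]
      proof (cases "\<bar>r m * y\<bar> \<le> pi")
        case True
        then have "Re (clogQ (exp (- (of_real (r m) * (1 + \<i> * of_real y))))) - logQ (r m) \<le> - ln (1 + v\<^sup>2 / 512)"
        proof -
          have "Re (clogQ (exp (- (of_real (r m) * (1 + \<i> * of_real y))))) \<le> logQ (r m) - ln (1 + y\<^sup>2 * (- ln (r m)) / 512)"
            using N[OF m] True by blast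
          then show ?thesis unfolding yL by linarith
        qed
        moreover have "norm (kern m (r m) y) = exp (Re (clogQ (exp (- (of_real (r m) * (1 + \<i> * of_real y))))) - logQ (r m))"
          using True by (simp add: kern_def norm_mult norm_exp)
        ultimately have "norm (kern m (r m) y) \<le> exp (- ln (1 + v\<^sup>2 / 512))" by simp
        also have "\<dots> = 1 / (1 + v\<^sup>2 / 512)"
        proof -
          have "1 + v\<^sup>2 / 512 > 0" by (simp add: add_pos_nonneg)
          then show ?thesis by (simp only: exp_minus exp_ln inverse_eq_divide)
        qed
        finally show "norm (kern m (r m) y) \<le> 1 / (1 + v\<^sup>2 / 512)" .
      next
        case False
        then have "kern m (r m) y = 0" by (simp add: kern_def)
        then show "norm (kern m (r m) y) \<le> 1 / (1 + v\<^sup>2 / 512)" by (simp add: add_nonneg_nonneg)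
      qed
    qed
    show "AE v in lborel. (\<lambda>n. kern (n + N) (r (n + N)) (v / s (n + N))) \<longlonglongrightarrow> complex_of_real (exp (- (l * v\<^sup>2 / 2)))"
    proof (rule AE_I2)
      fix v :: real
      define D where "D \<rho> = clogQ (exp (- (of_real \<rho> * (1 + \<i> * of_real (v / sqrt (- ln \<rho>)))))) - of_real (logQ \<rho>)
          - \<i> * of_real (v / sqrt (- ln \<rho>) * (ln 2 * ln \<rho>))" for \<rho>
      have "(\<lambda>n. D (r n)) \<longlonglongrightarrow> - of_real (ln 2 * v\<^sup>2 / 2)"
        unfolding D_def by (rule filterlim_compose[OF clogQ_local r0])
      moreover have ylim: "(\<lambda>n. v / s n) \<longlonglongrightarrow> 0"
      proof -
        have "((\<lambda>\<rho>. v / sqrt (- ln \<rho>)) \<longlongrightarrow> 0) (at_right 0)" by real_asymp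
        from filterlim_compose[OF this r0] show ?thesis by (simp add: s_def)
      qed
      ultimately have "(\<lambda>n. exp (D (r n) - \<i> * of_real (d * (v / s n)))) \<longlonglongrightarrow> exp (- of_real (ln 2 * v\<^sup>2 / 2) - \<i> * of_real (d * 0))"
        by (intro tendsto_intros)
      also have "exp (- of_real (ln 2 * v\<^sup>2 / 2) - \<i> * of_real (d * 0)) = complex_of_real (exp (- (l * v\<^sup>2 / 2)))"
        unfolding exp_of_real[symmetric] l by simp
      finally have lim: "(\<lambda>n. exp (D (r n) - \<i> * of_real (d * (v / s n)))) \<longlonglongrightarrow> complex_of_real (exp (- (l * v\<^sup>2 / 2)))" .
      have "(\<lambda>n. r n * (v / s n)) \<longlonglongrightarrow> 0 * 0"
        using r0 ylim by (intro tendsto_intros) (auto simp: filterlim_at)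
      then have "\<forall>\<^sub>F n in sequentially. \<bar>r n * (v / s n)\<bar> < pi"
        using tendstoD[of "\<lambda>n. r n * (v / s n)" 0 sequentially pi] by (simp add: dist_real_def)
      then have "\<forall>\<^sub>F n in sequentially. exp (D (r n) - \<i> * of_real (d * (v / s n))) = kern n (r n) (v / s n)"
        using saddle
      proof eventually_elim
        case (elim n)
        have eq: "\<i> * of_real (real n * r n * (v / s n)) = - (\<i> * of_real (d * (v / s n))) - \<i> * of_real (v / s n * (ln 2 * ln (r n)))"
          unfolding elim(2) l by (simp add: algebra_simps)
        have K: "kern n (r n) (v / s n) = exp (clogQ (exp (- (of_real (r n) * (1 + \<i> * of_real (v / s n))))) - of_real (logQ (r n))
            + \<i> * of_real (real n * r n * (v / s n)))"
          unfolding kern_def using elim(1) by (simp only: indicator_simps mem_Collect_eq less_imp_le mult_1_left)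
        have g: "a - b - c - e = a - b + (- e - c)" for a b c e :: complex by simp
        show ?case unfolding K eq unfolding D_def s_def by (rule arg_cong[where f=exp], rule g)
      qed
      from Lim_transform_eventually[OF lim this] have "(\<lambda>n. kern n (r n) (v / s n)) \<longlonglongrightarrow> complex_of_real (exp (- (l * v\<^sup>2 / 2)))" .
      then show "(\<lambda>n. kern (n + N) (r (n + N)) (v / s (n + N))) \<longlonglongrightarrow> complex_of_real (exp (- (l * v\<^sup>2 / 2)))"
        by (rule LIMSEQ_ignore_initial_segment)
    qed
  qed auto
  also have "(LINT v|lborel. complex_of_real (exp (- (l * v\<^sup>2 / 2)))) = of_real (sqrt (2 * pi / l))"
    by (simp add: gaussian_integral[OF l0])
  finally have "(\<lambda>n. LINT v|lborel. kern n (r n) (v / s n)) \<longlonglongrightarrow> of_real (sqrt (2 * pi / l))"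
    by (rule LIMSEQ_offset)
  then have lim: "(\<lambda>n. (LINT v|lborel. kern n (r n) (v / s n)) / of_real (2 * pi)) \<longlonglongrightarrow>
      complex_of_real (sqrt (2 * pi / l)) / of_real (2 * pi)"
    by (intro tendsto_divide tendsto_const) auto
  have "complex_of_real (sqrt (2 * pi / l)) / of_real (2 * pi) = of_real (1 / sqrt (2 * pi * l))"
  proof -
    have "sqrt (2 * pi / l) * sqrt (2 * pi * l) = sqrt ((2 * pi)\<^sup>2)"
      unfolding real_sqrt_mult[symmetric] using l0 by (simp add: power2_eq_square)
    also have "\<dots> = 2 * pi" unfolding real_sqrt_abs by simp
    finally have "sqrt (2 * pi / l) * sqrt (2 * pi * l) = 2 * pi" .
    moreover have *: "a / c = 1 / b" if "a * b = c" "b \<noteq> 0" "c \<noteq> 0" for a b c :: real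
      using that by (simp add: field_simps)
    moreover have "sqrt (2 * pi * l) \<noteq> 0" using l0 by simp
    ultimately have "sqrt (2 * pi / l) / (2 * pi) = 1 / sqrt (2 * pi * l)" by (intro *) auto
    then show ?thesis by (simp only: of_real_divide[symmetric])
  qed
  note lim' = lim[unfolded this]
  have "\<forall>\<^sub>F n in sequentially. (LINT v|lborel. kern n (r n) (v / s n)) / of_real (2 * pi) =
     Q_coeff n / of_real (r n / sqrt (- ln (r n)) * exp (logQ (r n) + real n * r n))"
    using eventually_ge_at_top[of N]
  proof eventually_elim
    case (elim n)
    define c where "c = complex_of_real (r n / s n * exp (logQ (r n) + real n * r n))"
    define I where "I = (LINT v|lborel. kern n (r n) (v / s n))"
    have c0: "c \<noteq> 0" using N[OF elim] s_pos[OF elim] by (simp add: c_def)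
    have "of_real (2 * pi) * Q_coeff n = c * I"
      unfolding c_def I_def using Q_coeff_integral[of "r n" "s n" n] N[OF elim] s_pos[OF elim] by simp
    then have "I / of_real (2 * pi) = Q_coeff n / c"
      using c0 by (simp add: field_simps)
    then show ?case unfolding c_def s_def I_def .
  qed
  from Lim_transform_eventually[OF lim' this] show ?thesis .
qed

section \<open>The Lambert W function and the final comparison\<close>

lemma lambert_W_inverse:
  assumes "x \<ge> 0"
  shows "lambert_W x \<ge> 0" "lambert_W x * exp (lambert_W x) = x"
proof -
  let ?f = "\<lambda>w::real. w * exp w"
  have inj: "inj_on ?f {0..}"
  proof (rule strict_mono_on_imp_inj_on, rule strict_mono_onI)
    fix a b :: real assume "a \<in> {0..}" "b \<in> {0..}" "a < b"
    then show "a * exp a < b * exp b" by (intro mult_less_le_imp_less) auto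
  qed
  have "\<exists>w\<ge>0. w \<le> x \<and> ?f w = x"
  proof (rule IVT')
    have "x * 1 \<le> x * exp x" using assms by (intro mult_left_mono) auto
    then show "x \<le> x * exp x" by simp
  qed (use assms in \<open>auto intro!: continuous_intros\<close>)
  then have mem: "x \<in> ?f ` {0..}" by (auto simp: image_iff)
  show "lambert_W x \<ge> 0"
    using the_inv_into_into[OF inj mem subset_refl] by (simp add: lambert_W_def)
  show "lambert_W x * exp (lambert_W x) = x"
    using f_the_inv_into_f[OF inj mem] by (simp add: lambert_W_def)
qed

lemma lambert_W_at_top: "filterlim lambert_W at_top at_top"
  unfolding filterlim_at_top
proof
  fix B :: real
  show "\<forall>\<^sub>F x in at_top. B \<le> lambert_W x"
    using eventually_ge_at_top[of 0] eventually_gt_at_top[of "B * exp B"]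
  proof eventually_elim
    case (elim x)
    show ?case
    proof (rule ccontr)
      assume "\<not> B \<le> lambert_W x"
      then have "lambert_W x * exp (lambert_W x) \<le> B * exp B"
        using lambert_W_inverse(1)[OF elim(1)] by (intro mult_mono) auto
      then show False using lambert_W_inverse(2)[OF elim(1)] elim(2) by linarith
    qed
  qed
qed

theorem theorem5p4:
  fixes l d0 d1 d2 :: real and x \<theta> \<theta>1 :: "nat \<Rightarrow> real"
  assumes "l = ln 2"
    and "d0 = euler_mascheroni\<^sup>2 * l / 2 + pi\<^sup>2 * l / 12 - euler_mascheroni * l\<^sup>2 + l ^ 3 / 6
                - 3 * stieltjes 1 * l"
    and "d1 = l\<^sup>2 / 2 - 2 * euler_mascheroni * l"
    and "d2 = l / 2"
    and "\<And>n. n \<ge> 1 \<Longrightarrow> x n = real n * exp (- d1 / (2 * d2)) / (2 * d2)"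
    and "\<And>n. n \<ge> 1 \<Longrightarrow> \<theta> n = 2 * d2 / real n * lambert_W (x n)"
    and "\<And>n. n \<ge> 1 \<Longrightarrow> \<theta>1 n = 2 * d2 / real n * ln (x n)"
  shows "(\<lambda>n. Q_coeff n /
            complex_of_real
              (exp (d0 + d1 * ln (\<theta> n) + d2 * (ln (\<theta> n))\<^sup>2 - d1)
                 / (2 * sqrt pi * sqrt (- d2 * ln (\<theta>1 n)))
               * \<theta>1 n powr (1 - 2 * d2)))
         \<longlonglongrightarrow> 1"
proof -
  have l: "l > 0" using assms(1) by simp
  have d2: "2 * d2 = l" using assms(4) by simp
  define k where "k = exp (- d1 / l) / l"
  have k: "k > 0" using l by (simp add: k_def)
  define w where "w n = lambert_W (x n)" for n
  have xk: "x n = real n * k" if "n \<ge> 1" for n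
    using assms(5)[OF that] by (simp add: d2 k_def)
  have x_top: "filterlim x at_top sequentially"
  proof -
    have "filterlim (\<lambda>n. real n * k) at_top sequentially" using k by real_asymp
    then show ?thesis
      by (rule filterlim_mono_eventually[OF _ order.refl order.refl])
         (use eventually_ge_at_top[of 1] in \<open>eventually_elim, auto simp: xk\<close>)
  qed
  have w_top: "filterlim w at_top sequentially"
    unfolding w_def by (rule filterlim_compose[OF lambert_W_at_top x_top])
  have ev: "\<forall>\<^sub>F n in sequentially. n \<ge> 1 \<and> w n > 1"
    using eventually_ge_at_top[of 1] w_top by (auto simp: filterlim_at_top_dense eventually_conj_iff)
  \<comment> \<open>As \<open>w * exp w = n * k\<close>, one gets \<open>\<theta> = l * w / n = l *
    k * exp (- w) = exp (- d1 / l - w)\<close>. Hence \<open>n * \<theta> = l * w\<close> is the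
    saddle equation, and \<open>\<theta>1 / \<theta> = ln x / w\<close> with
    \<open>ln x = w + ln w\<close>.\<close>
  have facts: "w n * exp (w n) = x n" "ln (x n) = ln (w n) + w n" "\<theta> n > 0" "ln (\<theta> n) = - d1 / l - w n"
      "real n * \<theta> n = - d1 - l * ln (\<theta> n)" "\<theta>1 n / \<theta> n = 1 + ln (w n) / w n"
    if n: "n \<ge> 1 \<and> w n > 1" for n
  proof -
    have xn: "x n > 0" using xk[of n] n k by simp
    show wx: "w n * exp (w n) = x n"
      unfolding w_def using xn by (intro lambert_W_inverse(2)) simp
    have lnx: "ln (x n) = ln (w n) + w n"
      unfolding wx[symmetric] using n by (simp add: ln_mult_pos)
    then show "ln (x n) = ln (w n) + w n" .
    have th: "\<theta> n = l / real n * w n" using assms(6)[of n] n d2 by (simp add: w_def)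
    then show "\<theta> n > 0" using n l by simp
    have "ln (\<theta> n) = ln l - ln (real n) + ln (w n)"
      unfolding th using n l by (simp add: ln_mult_pos ln_div)
    moreover have "ln (x n) = ln (real n) - d1 / l - ln l"
      using xk[of n] n l by (simp add: k_def ln_mult_pos ln_div)
    ultimately show lnth: "ln (\<theta> n) = - d1 / l - w n" using lnx by simp
    show "real n * \<theta> n = - d1 - l * ln (\<theta> n)"
      unfolding lnth unfolding th using n l by (simp add: field_simps)
    show "\<theta>1 n / \<theta> n = 1 + ln (w n) / w n"
    proof -
      have "\<theta>1 n = l / real n * (ln (w n) + w n)" using assms(7)[of n] n d2 lnx by simp
      then show ?thesis unfolding th using n l by (simp add: field_simps)
    qed
  qed
  have th0: "filterlim \<theta> (at_right 0) sequentially"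
  proof -
    have "filterlim (\<lambda>t::real. exp (- d1 / l - t)) (at_right 0) at_top" by real_asymp
    from filterlim_compose[OF this w_top]
    have "filterlim (\<lambda>n. exp (- d1 / l - w n)) (at_right 0) sequentially" .
    then show ?thesis
    proof (rule filterlim_mono_eventually[OF _ order.refl order.refl])
      show "\<forall>\<^sub>F n in sequentially. exp (- d1 / l - w n) = \<theta> n"
        using ev by eventually_elim (metis exp_ln facts(3,4))
    qed
  qed
  define A where "A n = Q_coeff n / of_real (\<theta> n / sqrt (- ln (\<theta> n)) * exp (logQ (\<theta> n) + real n * \<theta> n))" for n
  have A: "A \<longlonglongrightarrow> of_real (1 / sqrt (2 * pi * l))"
    unfolding A_def
    by (rule Q_coeff_saddle[where d=d1, OF assms(1) th0 eventually_mono[OF ev facts(5)]])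
  define B where "B n = exp (logQ (\<theta> n) - (l / 2 * (ln (\<theta> n))\<^sup>2 + d1 * ln (\<theta> n) + d0))" for n
  have B: "B \<longlonglongrightarrow> exp 0"
    unfolding B_def by (intro tendsto_exp filterlim_compose[OF logQ_asymp[OF assms(1-3)] th0])
  define \<rho> where "\<rho> n = \<theta>1 n / \<theta> n" for n
  have rho: "\<rho> \<longlonglongrightarrow> 1"
  proof -
    have "((\<lambda>t::real. 1 + ln t / t) \<longlongrightarrow> 1) at_top" by real_asymp
    from filterlim_compose[OF this w_top] have "(\<lambda>n. 1 + ln (w n) / w n) \<longlonglongrightarrow> 1" .
    then show ?thesis
      by (rule Lim_transform_eventually) (use ev in \<open>eventually_elim, simp add: \<rho>_def facts(6)\<close>)
  qed
  have lnth_bot: "filterlim (\<lambda>n. ln (\<theta> n)) at_bot sequentially"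
    by (rule filterlim_compose[OF ln_at_0 th0])
  \<comment> \<open>Eventually this is the quotient of \<open>ln (\<theta>1 n)\<close> by
    \<open>ln (\<theta> n)\<close>.\<close>
  define R where "R n = 1 + ln (\<rho> n) / ln (\<theta> n)" for n
  have "(\<lambda>n. ln (\<rho> n) / ln (\<theta> n)) \<longlonglongrightarrow> 0"
    by (rule tendsto_divide_0[OF tendsto_ln[OF rho]]) (use lnth_bot filterlim_at_bot_imp_at_infinity in auto)
  then have R: "R \<longlonglongrightarrow> 1 + 0"
    unfolding R_def by (intro tendsto_intros)
  define c where "c = sqrt (2 * pi * l)"
  have c: "c > 0" using l by (simp add: c_def)
  \<comment> \<open>Each correction factor replaces one ingredient of the saddle point formula by
    the one in the claim: \<open>c\<close> removes the Gaussian constant, \<open>B\<close> exchanges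
    \<open>logQ\<close> for its expansion, and the last two exchange \<open>\<theta>\<close> for
    \<open>\<theta>1\<close> in the power and under the root.\<close>
  have "(\<lambda>n. A n * of_real (c * (B n * \<rho> n powr (l - 1) * sqrt (R n)))) \<longlonglongrightarrow>
      of_real (1 / c) * of_real (c * (exp 0 * 1 powr (l - 1) * sqrt (1 + 0)))"
    unfolding c_def by (intro tendsto_intros A B rho R) auto
  then have lim: "(\<lambda>n. A n * of_real (c * (B n * \<rho> n powr (l - 1) * sqrt (R n)))) \<longlonglongrightarrow> 1"
    using c by simp
  have "\<forall>\<^sub>F n in sequentially. \<rho> n > 1 / 2"
    by (rule order_tendstoD(1)[OF rho]) simp
  moreover have "\<forall>\<^sub>F n in sequentially. R n > 1 / 2"
    by (rule order_tendstoD(1)[OF R]) simp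
  moreover have "\<forall>\<^sub>F n in sequentially. ln (\<theta> n) < 0"
    using lnth_bot by (simp add: filterlim_at_bot_dense)
  ultimately have "\<forall>\<^sub>F n in sequentially. A n * of_real (c * (B n * \<rho> n powr (l - 1) * sqrt (R n))) =
      Q_coeff n / complex_of_real (exp (d0 + d1 * ln (\<theta> n) + d2 * (ln (\<theta> n))\<^sup>2 - d1)
         / (2 * sqrt pi * sqrt (- d2 * ln (\<theta>1 n))) * \<theta>1 n powr (1 - 2 * d2))"
    using ev
  proof eventually_elim
    case (elim n)
    note f = facts[OF elim(4)]
    define T where "T = \<theta> n"
    define a where "a = - ln T"
    define E where "E = exp (d0 + d1 * ln T + d2 * (ln T)\<^sup>2 - d1)"
    have T: "T > 0" using f(3) by (simp add: T_def)
    have a: "a > 0" using elim(3) by (simp add: a_def T_def)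
    have rh: "\<rho> n > 0" using elim(1) by simp
    have th1: "\<theta>1 n = T * \<rho> n" using T by (simp add: \<rho>_def T_def)
    have ln1: "- ln (\<theta>1 n) = a * R n"
      unfolding th1 using T rh elim(3) a by (simp add: ln_mult_pos R_def a_def T_def[symmetric] field_simps)
    have sq: "2 * sqrt pi * sqrt (- d2 * ln (\<theta>1 n)) = c * sqrt a * sqrt (R n)"
    proof -
      have "- d2 * ln (\<theta>1 n) = d2 * (a * R n)" unfolding ln1[symmetric] by simp
      moreover have "2 = sqrt (4::real)" by simp
      ultimately have "2 * sqrt pi * sqrt (- d2 * ln (\<theta>1 n)) = sqrt (4 * pi * (d2 * (a * R n)))"
        by (simp only: real_sqrt_mult)
      also have "4 * pi * (d2 * (a * R n)) = (2 * pi * l) * a * R n" using assms(4) by simp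
      finally show ?thesis by (simp only: c_def real_sqrt_mult)
    qed
    have pw: "\<theta>1 n powr (1 - 2 * d2) = T powr (1 - l) * \<rho> n powr (1 - l)"
      unfolding th1 d2 using T rh by (simp add: powr_mult)
    \<comment> \<open>By the saddle equation
      \<open>exp (real n * T) = exp (- d1) * T powr (-l)\<close>: the first factor is part of
      \<open>E\<close>, and the second joins the prefactor \<open>T\<close> to form
      \<open>T powr (1 - l)\<close>.\<close>
    have S: "exp (logQ T + real n * T) = B n * E * T powr (-l)"
    proof -
      have "B n * E * T powr (-l) = exp (logQ T - (l / 2 * (ln T)\<^sup>2 + d1 * ln T + d0) + (d0 + d1 * ln T + d2 * (ln T)\<^sup>2 - d1) + (-l) * ln T)"
        unfolding B_def E_def T_def[symmetric] powr_def using T by (simp only: exp_add) simp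
      also have "logQ T - (l / 2 * (ln T)\<^sup>2 + d1 * ln T + d0) + (d0 + d1 * ln T + d2 * (ln T)\<^sup>2 - d1) + (-l) * ln T = logQ T + real n * T"
        using f(5) assms(4) unfolding T_def by simp
      finally show ?thesis by simp
    qed
    define V where "V = T powr (1 - l)"
    have V: "V = T * T powr (-l)" "V > 0" using T powr_add[of T 1 "-l"] by (auto simp: V_def)
    define P where "P = \<rho> n powr (1 - l)"
    have P: "P > 0" "\<rho> n powr (l - 1) = 1 / P"
      using rh powr_minus_divide[of "\<rho> n" "1 - l"] by (auto simp: P_def)
    define q where "q = sqrt (R n)"
    have q: "q > 0" using elim(2) by (simp add: q_def)
    define sa where "sa = sqrt a"
    have sa: "sa > 0" using a by (simp add: sa_def)
    have E0: "E > 0" "B n > 0" by (auto simp: E_def B_def)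
    have An: "A n = Q_coeff n / of_real (V * B n * E / sa)"
    proof -
      have "\<theta> n / sqrt (- ln (\<theta> n)) * exp (logQ (\<theta> n) + real n * \<theta> n) = V * B n * E / sa"
        unfolding T_def[symmetric] a_def[symmetric] S sa_def[symmetric] V(1) by (simp add: mult_ac)
      then show ?thesis unfolding A_def by (simp only:)
    qed
    have real_eq: "V * B n * E / sa / (c * (B n * (1 / P) * q)) = E / (c * sa * q) * (V * P)"
      using V(2) P(1) q sa E0 c by (simp add: field_simps)
    have "A n * of_real (c * (B n * (1 / P) * q)) = Q_coeff n / of_real (V * B n * E / sa / (c * (B n * (1 / P) * q)))"
      unfolding An by simp
    also have "\<dots> = Q_coeff n / of_real (E / (c * sa * q) * (V * P))"
      unfolding real_eq ..
    finally show ?case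
      unfolding sq pw P(2) unfolding E_def[symmetric] T_def[symmetric] V_def[symmetric] P_def[symmetric] q_def[symmetric] sa_def[symmetric] .
  qed
  from Lim_transform_eventually[OF lim this] show ?thesis .
qed

end
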